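(* Let $\mathcal{B}$ be a 1-closed 1-contravariant $\mathrm{O}(1)$-dagger 2-category. Then $\mathcal{B}$ is enriched in lax $\mathrm{O}(1)$-volutive categories.
   Context: "2-category" means bicategory, "2-functor" means pseudofunctor. A (classical) 1-contravariant $\mathrm{O}(1)$-dagger 2-category is a 2-category $\mathcal{B}$ with an identity-on-objects 2-functor $d\colon\mathcal{B}\to\mathcal{B}^{1\mathrm{op}}$ (reversing 1-morphisms) and an invertible 2-transformation $\eta\colon\mathrm{id}\to d^{1\mathrm{op}}\circ d$ with identity 1-morphism components, so with invertible 2-morphism components $X\cong d^2(X)$, which is coherent: the two induced comparisons between $d$ and $d\circ d^{1\mathrm{op}}\circ d$ (whiskering $\eta$ with $d$ on either side) agree, i.e. are mutually inverse when composed. $\mathcal{B}$ is 1-closed if for every object $c$ and 1-morphism $X\colon a\to b$ the functors $(-)\circ X\colon\mathrm{Hom}(b,c)\to\mathrm{Hom}(a,c)$ and $X\circ(-)\colon\mathrm{Hom}(c,a)\to\mathrm{Hom}(c,b)$ both admit right adjoints, written $Z\mapsto Z^X$ and $Z\mapsto{}^XZ$, with counits $\mathrm{ev}_X^Z\colon Z^X\circ X\to Z$ and $\widetilde{\mathrm{ev}}_X^Z\colon X\circ{}^XZ\to Z$. A lax $\mathrm{O}(1)$-volutive category $(\mathcal{C},d,\eta)$ is a category $\mathcal{C}$ with a functor $d\colon\mathcal{C}\to\mathcal{C}^{\mathrm{op}}$ and a natural transformation $\eta\colon\mathrm{id}\to d^{\mathrm{op}}\circ d$ with $d(\eta_x)\circ\eta_{d(x)}=\mathrm{id}_{d(x)}$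 for all $x$. A lax $\mathrm{O}(1)$-volutive functor $(\mathcal{C},d,\eta)\to(\mathcal{C}',d',\eta')$ is a functor $F$ with a natural family $\alpha_x\colon F(d(x))\to d'(F(x))$ in $\mathcal{C}'$ (a natural transformation $d'\circ F\to F^{\mathrm{op}}\circ d$ of functors $\mathcal{C}\to\mathcal{C}'^{\mathrm{op}}$) satisfying $\alpha_{d(x)}\circ F(\eta_x)=d'(\alpha_x)\circ\eta'_{F(x)}$. A lax $\mathrm{O}(1)$-volutive transformation $(F_1,\alpha_1)\to(F_2,\alpha_2)$ is a natural transformation $\xi$ with $d'(\xi_x)\circ(\alpha_2)_x\circ\xi_{d(x)}=(\alpha_1)_x$. These form a 2-category, symmetric monoidal under the cartesian product $(\mathcal{C}\times\mathcal{C}',d\times d',\eta\times\eta')$. That a 2-category is enriched in lax $\mathrm{O}(1)$-volutive categories means that its Hom-categories carry lax $\mathrm{O}(1)$-volutive structures and its composition functors $\mathrm{Hom}(b,c)\times\mathrm{Hom}(a,b)\to\mathrm{Hom}(a,c)$ and unit functors $\star\to\mathrm{Hom}(a,a)$ carry compatible lax $\mathrm{O}(1)$-volutive functor structures. The lax $\mathrm{O}(1)$-volutive structure considered on $\mathrm{Hom}_{\mathcal{B}}(a,b)$ is $(\overline{d}_{a,b},\overline{\eta}_{a,b})$. Here $\overline{d}_{a,b}(X)=d(\mathrm{id}_a^X)$ for $X\colon a\to b$ (note $\mathrm{id}_a^X\colon b\to a$). Using $\mathcal{B}\simeq\mathcal{B}^{1\mathrm{op}}$ via $d$ one has $\overline{d}_{a,b}^{\mathrm{op}}\overline{d}_{a,b}(X)\cong{}^{\mathrm{id}_a^X}\mathrm{id}_a$,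 and $(\overline{\eta}_{a,b})_X\colon X\to{}^{\mathrm{id}_a^X}\mathrm{id}_a$ is the 2-morphism adjoint to $\mathrm{ev}_X\colon\mathrm{id}_a^X\circ X\to\mathrm{id}_a$. The structure 2-morphisms of the composition functor are the canonical maps $d(\mathrm{id}^Y)\circ d(\mathrm{id}^X)\cong d(\mathrm{id}^X\circ\mathrm{id}^Y)\to d(\mathrm{id}^{Y\circ X})$. Those of the unit functor are the canonical maps $\mathrm{id}_a\to d(\mathrm{id}_a^{\mathrm{id}_a})$. *)

theory Defs
  imports Main
begin

section \<open>Categories, functors, natural transformations\<close>

text \<open>All structures carry explicit carriers; operations are unconstrained outside of them.\<close>

record ('o, 'a) cat =
  Ob  :: "'o set"
  Arr :: "'a set"
  Dom :: "'a \<Rightarrow> 'o"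
  Cod :: "'a \<Rightarrow> 'o"
  Id  :: "'o \<Rightarrow> 'a"
  Comp :: "'a \<Rightarrow> 'a \<Rightarrow> 'a"  (infixl "\<cdot>\<index>" 70)

definition homset :: "('o, 'a) cat \<Rightarrow> 'o \<Rightarrow> 'o \<Rightarrow> 'a set" where
  "homset C x y = {f \<in> Arr C. Dom C f = x \<and> Cod C f = y}"

definition category :: "('o, 'a) cat \<Rightarrow> bool" where
  "category C \<longleftrightarrow>
     (\<forall>f\<in>Arr C. Dom C f \<in> Ob C \<and> Cod C f \<in> Ob C) \<and>
     (\<forall>x\<in>Ob C. Id C x \<in> homset C x x) \<and>
     (\<forall>x\<in>Ob C. \<forall>y\<in>Ob C. \<forall>z\<in>Ob C. \<forall>f\<in>homset C x y. \<forall>g\<in>homset C y z.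
        g \<cdot>\<^bsub>C\<^esub> f \<in> homset C x z) \<and>
     (\<forall>x\<in>Ob C. \<forall>y\<in>Ob C. \<forall>f\<in>homset C x y.
        f \<cdot>\<^bsub>C\<^esub> Id C x = f \<and> Id C y \<cdot>\<^bsub>C\<^esub> f = f) \<and>
     (\<forall>w\<in>Ob C. \<forall>x\<in>Ob C. \<forall>y\<in>Ob C. \<forall>z\<in>Ob C.
        \<forall>f\<in>homset C w x. \<forall>g\<in>homset C x y. \<forall>h\<in>homset C y z.
        (h \<cdot>\<^bsub>C\<^esub> g) \<cdot>\<^bsub>C\<^esub> f = h \<cdot>\<^bsub>C\<^esub> (g \<cdot>\<^bsub>C\<^esub> f))"

definition inverses :: "('o, 'a) cat \<Rightarrow> 'a \<Rightarrow> 'a \<Rightarrow> bool" where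
  "inverses C f g \<longleftrightarrow>
     f \<in> Arr C \<and> g \<in> homset C (Cod C f) (Dom C f) \<and>
     g \<cdot>\<^bsub>C\<^esub> f = Id C (Dom C f) \<and> f \<cdot>\<^bsub>C\<^esub> g = Id C (Cod C f)"

definition iso :: "('o, 'a) cat \<Rightarrow> 'a \<Rightarrow> bool" where
  "iso C f \<longleftrightarrow> (\<exists>g. inverses C f g)"

definition inv_arr :: "('o, 'a) cat \<Rightarrow> 'a \<Rightarrow> 'a" where
  "inv_arr C f = (THE g. inverses C f g)"

definition op_cat :: "('o, 'a) cat \<Rightarrow> ('o, 'a) cat" where
  "op_cat C = \<lparr>Ob = Ob C, Arr = Arr C, Dom = Cod C, Cod = Dom C, Id = Id C,
               Comp = (\<lambda>g f. f \<cdot>\<^bsub>C\<^esub> g)\<rparr>"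

definition prod_cat :: "('o, 'a) cat \<Rightarrow> ('p, 'b) cat \<Rightarrow> ('o \<times> 'p, 'a \<times> 'b) cat" where
  "prod_cat C D = \<lparr>Ob = Ob C \<times> Ob D, Arr = Arr C \<times> Arr D,
     Dom = map_prod (Dom C) (Dom D), Cod = map_prod (Cod C) (Cod D),
     Id = map_prod (Id C) (Id D),
     Comp = (\<lambda>(g, g') (f, f'). (g \<cdot>\<^bsub>C\<^esub> f, g' \<cdot>\<^bsub>D\<^esub> f'))\<rparr>"

definition unit_cat :: "(unit, unit) cat" where
  "unit_cat = \<lparr>Ob = {()}, Arr = {()}, Dom = (\<lambda>_. ()), Cod = (\<lambda>_. ()), Id = (\<lambda>_. ()),
               Comp = (\<lambda>_ _. ())\<rparr>"

record ('o, 'a, 'p, 'b) ftr =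
  fo :: "'o \<Rightarrow> 'p"
  fa :: "'a \<Rightarrow> 'b"

definition is_functor :: "('o, 'a) cat \<Rightarrow> ('p, 'b) cat \<Rightarrow> ('o, 'a, 'p, 'b) ftr \<Rightarrow> bool" where
  "is_functor C D F \<longleftrightarrow>
     category C \<and> category D \<and>
     (\<forall>x\<in>Ob C. fo F x \<in> Ob D) \<and>
     (\<forall>x\<in>Ob C. \<forall>y\<in>Ob C. \<forall>f\<in>homset C x y. fa F f \<in> homset D (fo F x) (fo F y)) \<and>
     (\<forall>x\<in>Ob C. fa F (Id C x) = Id D (fo F x)) \<and>
     (\<forall>x\<in>Ob C. \<forall>y\<in>Ob C. \<forall>z\<in>Ob C. \<forall>f\<in>homset C x y. \<forall>g\<in>homset C y z.
        fa F (g \<cdot>\<^bsub>C\<^esub> f) = fa F g \<cdot>\<^bsub>D\<^esub> fa F f)"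

definition ftr_id :: "('o, 'a, 'o, 'a) ftr" where
  "ftr_id = \<lparr>fo = (\<lambda>x. x), fa = (\<lambda>f. f)\<rparr>"

definition ftr_comp ::
    "('p, 'b, 'q, 'c) ftr \<Rightarrow> ('o, 'a, 'p, 'b) ftr \<Rightarrow> ('o, 'a, 'q, 'c) ftr"
    (infixr "\<circ>\<circ>" 75) where
  "G \<circ>\<circ> F = \<lparr>fo = (\<lambda>x. fo G (fo F x)), fa = (\<lambda>f. fa G (fa F f))\<rparr>"

definition ftr_prod ::
    "('o, 'a, 'p, 'b) ftr \<Rightarrow> ('o', 'a', 'p', 'b') ftr \<Rightarrow>
     ('o \<times> 'o', 'a \<times> 'a', 'p \<times> 'p', 'b \<times> 'b') ftr" where
  "ftr_prod F G = \<lparr>fo = map_prod (fo F) (fo G), fa = map_prod (fa F) (fa G)\<rparr>"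

definition nat_trans ::
    "('o, 'a) cat \<Rightarrow> ('p, 'b) cat \<Rightarrow> ('o, 'a, 'p, 'b) ftr \<Rightarrow> ('o, 'a, 'p, 'b) ftr \<Rightarrow>
     ('o \<Rightarrow> 'b) \<Rightarrow> bool" where
  "nat_trans C D F G \<tau> \<longleftrightarrow>
     is_functor C D F \<and> is_functor C D G \<and>
     (\<forall>x\<in>Ob C. \<tau> x \<in> homset D (fo F x) (fo G x)) \<and>
     (\<forall>x\<in>Ob C. \<forall>y\<in>Ob C. \<forall>f\<in>homset C x y.
        \<tau> y \<cdot>\<^bsub>D\<^esub> fa F f = fa G f \<cdot>\<^bsub>D\<^esub> \<tau> x)"

definition nat_iso ::
    "('o, 'a) cat \<Rightarrow> ('p, 'b) cat \<Rightarrow> ('o, 'a, 'p, 'b) ftr \<Rightarrow> ('o, 'a, 'p, 'b) ftr \<Rightarrow>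
     ('o \<Rightarrow> 'b) \<Rightarrow> bool" where
  "nat_iso C D F G \<tau> \<longleftrightarrow> nat_trans C D F G \<tau> \<and> (\<forall>x\<in>Ob C. iso D (\<tau> x))"

text \<open>\<open>G\<close> is right adjoint to \<open>F\<close> with counit \<open>\<epsilon>\<close>.\<close>

definition right_adjoint ::
    "('o, 'a) cat \<Rightarrow> ('p, 'b) cat \<Rightarrow> ('o, 'a, 'p, 'b) ftr \<Rightarrow> ('p, 'b, 'o, 'a) ftr \<Rightarrow>
     ('p \<Rightarrow> 'b) \<Rightarrow> bool" where
  "right_adjoint C D F G \<epsilon> \<longleftrightarrow>
     is_functor C D F \<and> is_functor D C G \<and> nat_trans D D (F \<circ>\<circ> G) ftr_id \<epsilon> \<and>
     (\<forall>x\<in>Ob C. \<forall>y\<in>Ob D.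
        bij_betw (\<lambda>g. \<epsilon> y \<cdot>\<^bsub>D\<^esub> fa F g) (homset C x (fo G y)) (homset D (fo F x) y))"


section \<open>Bicategories and pseudofunctors\<close>

record ('o, 'm, 'c) bicat =
  Obj  :: "'o set"
  Mor  :: "'m set"
  Cell :: "'c set"
  src  :: "'m \<Rightarrow> 'o"
  trg  :: "'m \<Rightarrow> 'o"
  dm   :: "'c \<Rightarrow> 'm"
  cd   :: "'c \<Rightarrow> 'm"
  idt  :: "'m \<Rightarrow> 'c"
  vc   :: "'c \<Rightarrow> 'c \<Rightarrow> 'c"  (infixl "\<bullet>\<index>" 65)
  h1   :: "'m \<Rightarrow> 'm \<Rightarrow> 'm"  (infixr "\<odot>\<index>" 75)
  h2   :: "'c \<Rightarrow> 'c \<Rightarrow> 'c"  (infixr "\<star>\<index>" 75)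
  one  :: "'o \<Rightarrow> 'm"
  asc  :: "'m \<Rightarrow> 'm \<Rightarrow> 'm \<Rightarrow> 'c"
  lu   :: "'m \<Rightarrow> 'c"
  ru   :: "'m \<Rightarrow> 'c"

definition hom :: "('o, 'm, 'c) bicat \<Rightarrow> 'o \<Rightarrow> 'o \<Rightarrow> ('m, 'c) cat" where
  "hom B a b = \<lparr>
     Ob = {X \<in> Mor B. src B X = a \<and> trg B X = b},
     Arr = {f \<in> Cell B. src B (dm B f) = a \<and> trg B (dm B f) = b},
     Dom = dm B, Cod = cd B, Id = idt B, Comp = vc B\<rparr>"

definition cells :: "('o, 'm, 'c) bicat \<Rightarrow> 'm \<Rightarrow> 'm \<Rightarrow> 'c set" where
  "cells B X Y = {f \<in> Cell B. dm B f = X \<and> cd B f = Y}"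

definition inv2 :: "('o, 'm, 'c) bicat \<Rightarrow> 'c \<Rightarrow> 'c" where
  "inv2 B f = inv_arr (hom B (src B (dm B f)) (trg B (dm B f))) f"

definition hcomp :: "('o, 'm, 'c) bicat \<Rightarrow> ('m \<times> 'm, 'c \<times> 'c, 'm, 'c) ftr" where
  "hcomp B = \<lparr>fo = (\<lambda>(Y, X). Y \<odot>\<^bsub>B\<^esub> X), fa = (\<lambda>(g, f). g \<star>\<^bsub>B\<^esub> f)\<rparr>"

text \<open>The functors \<open>(-) \<odot> X\<close> and \<open>X \<odot> (-)\<close>.\<close>

definition precomp :: "('o, 'm, 'c) bicat \<Rightarrow> 'm \<Rightarrow> ('m, 'c, 'm, 'c) ftr" where
  "precomp B X = \<lparr>fo = (\<lambda>W. W \<odot>\<^bsub>B\<^esub> X), fa = (\<lambda>g. g \<star>\<^bsub>B\<^esub> idt B X)\<rparr>"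

definition postcomp :: "('o, 'm, 'c) bicat \<Rightarrow> 'm \<Rightarrow> ('m, 'c, 'm, 'c) ftr" where
  "postcomp B X = \<lparr>fo = (\<lambda>W. X \<odot>\<^bsub>B\<^esub> W), fa = (\<lambda>g. idt B X \<star>\<^bsub>B\<^esub> g)\<rparr>"

definition prod_assoc ::
    "(('o \<times> 'p) \<times> 'q, ('a \<times> 'b) \<times> 'c, 'o \<times> ('p \<times> 'q), 'a \<times> ('b \<times> 'c)) ftr" where
  "prod_assoc = \<lparr>fo = (\<lambda>((x, y), z). (x, (y, z))), fa = (\<lambda>((f, g), h). (f, (g, h)))\<rparr>"

text \<open>Associators run \<open>(W \<odot> Y) \<odot> X \<rightarrow> W \<odot> (Y \<odot> X)\<close>, unitors
  \<open>1 \<odot> X \<rightarrow> X\<close> and \<open>X \<odot> 1 \<rightarrow> X\<close>.\<close>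

definition bicategory :: "('o, 'm, 'c) bicat \<Rightarrow> bool" where
  "bicategory B \<longleftrightarrow>
     (\<forall>X\<in>Mor B. src B X \<in> Obj B \<and> trg B X \<in> Obj B) \<and>
     (\<forall>f\<in>Cell B. dm B f \<in> Mor B \<and> cd B f \<in> Mor B \<and>
        src B (dm B f) = src B (cd B f) \<and> trg B (dm B f) = trg B (cd B f)) \<and>
     (\<forall>a\<in>Obj B. \<forall>b\<in>Obj B. category (hom B a b)) \<and>
     (\<forall>a\<in>Obj B. \<forall>b\<in>Obj B. \<forall>c\<in>Obj B.
        is_functor (prod_cat (hom B b c) (hom B a b)) (hom B a c) (hcomp B)) \<and>
     (\<forall>a\<in>Obj B. one B a \<in> Ob (hom B a a)) \<and>
     (\<forall>a\<in>Obj B. \<forall>b\<in>Obj B. \<forall>c\<in>Obj B. \<forall>e\<in>Obj B.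
        nat_iso (prod_cat (prod_cat (hom B c e) (hom B b c)) (hom B a b)) (hom B a e)
          (hcomp B \<circ>\<circ> ftr_prod (hcomp B) ftr_id)
          (hcomp B \<circ>\<circ> ftr_prod ftr_id (hcomp B) \<circ>\<circ> prod_assoc)
          (\<lambda>((W, Y), X). asc B W Y X)) \<and>
     (\<forall>a\<in>Obj B. \<forall>b\<in>Obj B.
        nat_iso (hom B a b) (hom B a b) (postcomp B (one B b)) ftr_id (lu B) \<and>
        nat_iso (hom B a b) (hom B a b) (precomp B (one B a)) ftr_id (ru B)) \<and>
     (\<forall>V\<in>Mor B. \<forall>W\<in>Mor B. \<forall>X\<in>Mor B. \<forall>Y\<in>Mor B.
        src B V = trg B W \<longrightarrow> src B W = trg B X \<longrightarrow> src B X = trg B Y \<longrightarrow>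
        asc B V W (X \<odot>\<^bsub>B\<^esub> Y) \<bullet>\<^bsub>B\<^esub> asc B (V \<odot>\<^bsub>B\<^esub> W) X Y =
        (idt B V \<star>\<^bsub>B\<^esub> asc B W X Y) \<bullet>\<^bsub>B\<^esub> asc B V (W \<odot>\<^bsub>B\<^esub> X) Y
          \<bullet>\<^bsub>B\<^esub> (asc B V W X \<star>\<^bsub>B\<^esub> idt B Y)) \<and>
     (\<forall>X\<in>Mor B. \<forall>Y\<in>Mor B. src B Y = trg B X \<longrightarrow>
        (idt B Y \<star>\<^bsub>B\<^esub> lu B X) \<bullet>\<^bsub>B\<^esub> asc B Y (one B (trg B X)) X =
        ru B Y \<star>\<^bsub>B\<^esub> idt B X)"

definition op1 :: "('o, 'm, 'c) bicat \<Rightarrow> ('o, 'm, 'c) bicat" where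
  "op1 B = \<lparr>Obj = Obj B, Mor = Mor B, Cell = Cell B, src = trg B, trg = src B,
     dm = dm B, cd = cd B, idt = idt B, vc = vc B,
     h1 = (\<lambda>Y X. X \<odot>\<^bsub>B\<^esub> Y), h2 = (\<lambda>g f. f \<star>\<^bsub>B\<^esub> g),
     one = one B, asc = (\<lambda>W Y X. inv2 B (asc B X Y W)), lu = ru B, ru = lu B\<rparr>"

text \<open>Structure 2-morphisms of a pseudofunctor \<open>F\<close>:
  \<open>pcomp F Y X : F Y \<odot> F X \<rightarrow> F (Y \<odot> X)\<close> and \<open>punit F a : 1 \<rightarrow> F 1\<close>.\<close>

record ('o, 'm, 'c, 'p, 'n, 'e) psftr =
  pobj  :: "'o \<Rightarrow> 'p"
  pftr  :: "('m, 'c, 'n, 'e) ftr"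
  pcomp :: "'m \<Rightarrow> 'm \<Rightarrow> 'e"
  punit :: "'o \<Rightarrow> 'e"

abbreviation pmor :: "('o, 'm, 'c, 'p, 'n, 'e) psftr \<Rightarrow> 'm \<Rightarrow> 'n" where
  "pmor F \<equiv> fo (pftr F)"

abbreviation pcell :: "('o, 'm, 'c, 'p, 'n, 'e) psftr \<Rightarrow> 'c \<Rightarrow> 'e" where
  "pcell F \<equiv> fa (pftr F)"

definition pseudofunctor ::
    "('o, 'm, 'c) bicat \<Rightarrow> ('p, 'n, 'e) bicat \<Rightarrow> ('o, 'm, 'c, 'p, 'n, 'e) psftr \<Rightarrow> bool" where
  "pseudofunctor B C F \<longleftrightarrow>
     bicategory B \<and> bicategory C \<and>
     (\<forall>a\<in>Obj B. pobj F a \<in> Obj C) \<and>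
     (\<forall>a\<in>Obj B. \<forall>b\<in>Obj B. is_functor (hom B a b) (hom C (pobj F a) (pobj F b)) (pftr F)) \<and>
     (\<forall>a\<in>Obj B. \<forall>b\<in>Obj B. \<forall>c\<in>Obj B.
        nat_iso (prod_cat (hom B b c) (hom B a b)) (hom C (pobj F a) (pobj F c))
          (hcomp C \<circ>\<circ> ftr_prod (pftr F) (pftr F)) (pftr F \<circ>\<circ> hcomp B)
          (\<lambda>(Y, X). pcomp F Y X)) \<and>
     (\<forall>a\<in>Obj B. punit F a \<in> cells C (one C (pobj F a)) (pmor F (one B a)) \<and>
        iso (hom C (pobj F a) (pobj F a)) (punit F a)) \<and>
     (\<forall>W\<in>Mor B. \<forall>Y\<in>Mor B. \<forall>X\<in>Mor B. src B W = trg B Y \<longrightarrow> src B Y = trg B X \<longrightarrow>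
        pcell F (asc B W Y X) \<bullet>\<^bsub>C\<^esub> pcomp F (W \<odot>\<^bsub>B\<^esub> Y) X
          \<bullet>\<^bsub>C\<^esub> (pcomp F W Y \<star>\<^bsub>C\<^esub> idt C (pmor F X)) =
        pcomp F W (Y \<odot>\<^bsub>B\<^esub> X) \<bullet>\<^bsub>C\<^esub> (idt C (pmor F W) \<star>\<^bsub>C\<^esub> pcomp F Y X)
          \<bullet>\<^bsub>C\<^esub> asc C (pmor F W) (pmor F Y) (pmor F X)) \<and>
     (\<forall>X\<in>Mor B.
        pcell F (lu B X) \<bullet>\<^bsub>C\<^esub> pcomp F (one B (trg B X)) X
          \<bullet>\<^bsub>C\<^esub> (punit F (trg B X) \<star>\<^bsub>C\<^esub> idt C (pmor F X)) = lu C (pmor F X) \<and>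
        pcell F (ru B X) \<bullet>\<^bsub>C\<^esub> pcomp F X (one B (src B X))
          \<bullet>\<^bsub>C\<^esub> (idt C (pmor F X) \<star>\<^bsub>C\<^esub> punit F (src B X)) = ru C (pmor F X))"

definition ps_id :: "('o, 'm, 'c) bicat \<Rightarrow> ('o, 'm, 'c, 'o, 'm, 'c) psftr" where
  "ps_id B = \<lparr>pobj = (\<lambda>a. a), pftr = ftr_id,
     pcomp = (\<lambda>Y X. idt B (Y \<odot>\<^bsub>B\<^esub> X)), punit = (\<lambda>a. idt B (one B a))\<rparr>"

text \<open>Composition of pseudofunctors; \<open>C\<close> is the target bicategory of \<open>G\<close>.\<close>

definition ps_comp ::
    "('q, 'k, 'd) bicat \<Rightarrow> ('p, 'n, 'e, 'q, 'k, 'd) psftr \<Rightarrow> ('o, 'm, 'c, 'p, 'n, 'e) psftr \<Rightarrow>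
     ('o, 'm, 'c, 'q, 'k, 'd) psftr" where
  "ps_comp C G F = \<lparr>pobj = (\<lambda>a. pobj G (pobj F a)), pftr = pftr G \<circ>\<circ> pftr F,
     pcomp = (\<lambda>Y X. pcell G (pcomp F Y X) \<bullet>\<^bsub>C\<^esub> pcomp G (pmor F Y) (pmor F X)),
     punit = (\<lambda>a. pcell G (punit F a) \<bullet>\<^bsub>C\<^esub> punit G (pobj F a))\<rparr>"

text \<open>The pseudofunctor \<open>op1 B \<rightarrow> op1 C\<close> induced by \<open>F : B \<rightarrow> C\<close>.\<close>

definition ps_op1 ::
    "('o, 'm, 'c, 'p, 'n, 'e) psftr \<Rightarrow> ('o, 'm, 'c, 'p, 'n, 'e) psftr" where
  "ps_op1 F = \<lparr>pobj = pobj F, pftr = pftr F,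
     pcomp = (\<lambda>Y X. pcomp F X Y), punit = punit F\<rparr>"

text \<open>An invertible 2-transformation \<open>F \<rightarrow> G\<close> all of whose 1-morphism components are identities.
  Cancelling the identities by unitors, its 2-morphism components are
  \<open>\<theta> X : F X \<rightarrow> G X\<close>, and the axioms of a 2-transformation become those below
  (an invertible icon).\<close>

definition invertible_icon ::
    "('o, 'm, 'c) bicat \<Rightarrow> ('p, 'n, 'e) bicat \<Rightarrow> ('o, 'm, 'c, 'p, 'n, 'e) psftr \<Rightarrow>
     ('o, 'm, 'c, 'p, 'n, 'e) psftr \<Rightarrow> ('m \<Rightarrow> 'e) \<Rightarrow> bool" where
  "invertible_icon B C F G \<theta> \<longleftrightarrow>
     (\<forall>a\<in>Obj B. pobj F a = pobj G a) \<and>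
     (\<forall>a\<in>Obj B. \<forall>b\<in>Obj B.
        nat_iso (hom B a b) (hom C (pobj F a) (pobj F b)) (pftr F) (pftr G) \<theta>) \<and>
     (\<forall>Y\<in>Mor B. \<forall>X\<in>Mor B. src B Y = trg B X \<longrightarrow>
        \<theta> (Y \<odot>\<^bsub>B\<^esub> X) \<bullet>\<^bsub>C\<^esub> pcomp F Y X = pcomp G Y X \<bullet>\<^bsub>C\<^esub> (\<theta> Y \<star>\<^bsub>C\<^esub> \<theta> X)) \<and>
     (\<forall>a\<in>Obj B. \<theta> (one B a) \<bullet>\<^bsub>C\<^esub> punit F a = punit G a)"

text \<open>In the last clause \<open>d \<eta>\<^sub>X\<close> and \<open>\<eta>\<^sub>d\<^sub>X\<close> are the components \<open>d X \<rightarrow> d (d (d X))\<close> of the two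
  whiskerings of \<open>\<eta>\<close> with \<open>d\<close>; both run in the same direction because \<open>op1\<close> does not
  reverse 2-morphisms.\<close>

definition dagger_bicategory ::
    "('o, 'm, 'c) bicat \<Rightarrow> ('o, 'm, 'c, 'o, 'm, 'c) psftr \<Rightarrow> ('m \<Rightarrow> 'c) \<Rightarrow> bool" where
  "dagger_bicategory B d \<eta> \<longleftrightarrow>
     bicategory B \<and>
     pseudofunctor B (op1 B) d \<and>
     (\<forall>a\<in>Obj B. pobj d a = a) \<and>
     invertible_icon B B (ps_id B) (ps_comp B (ps_op1 d) d) \<eta> \<and>
     (\<forall>X\<in>Mor B. pcell d (\<eta> X) = \<eta> (pmor d X))"


section \<open>1-closed bicategories\<close>

text \<open>Chosen right adjoints \<open>fo (rexp K X) Z = Z\<^sup>X\<close> of \<open>(-) \<odot> X\<close> and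
  \<open>fo (lexp K X) Z = \<^sup>XZ\<close> of \<open>X \<odot> (-)\<close>, with counits \<open>rcounit K X Z\<close> and \<open>lcounit K X Z\<close>.\<close>

record ('m, 'c) closure =
  rexp :: "'m \<Rightarrow> ('m, 'c, 'm, 'c) ftr"
  rcounit :: "'m \<Rightarrow> 'm \<Rightarrow> 'c"
  lexp :: "'m \<Rightarrow> ('m, 'c, 'm, 'c) ftr"
  lcounit :: "'m \<Rightarrow> 'm \<Rightarrow> 'c"

definition one_closed :: "('o, 'm, 'c) bicat \<Rightarrow> ('m, 'c) closure \<Rightarrow> bool" where
  "one_closed B K \<longleftrightarrow>
     (\<forall>a\<in>Obj B. \<forall>b\<in>Obj B. \<forall>c\<in>Obj B. \<forall>X\<in>Ob (hom B a b).
        right_adjoint (hom B b c) (hom B a c) (precomp B X) (rexp K X) (rcounit K X) \<and>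
        right_adjoint (hom B c a) (hom B c b) (postcomp B X) (lexp K X) (lcounit K X))"

text \<open>Adjuncts of \<open>f : W \<odot> X \<rightarrow> Z\<close> and of \<open>f : X \<odot> W \<rightarrow> Z\<close>.\<close>

definition radj ::
    "('o, 'm, 'c) bicat \<Rightarrow> ('m, 'c) closure \<Rightarrow> 'm \<Rightarrow> 'm \<Rightarrow> 'm \<Rightarrow> 'c \<Rightarrow> 'c" where
  "radj B K X W Z f =
     (THE g. g \<in> cells B W (fo (rexp K X) Z) \<and>
             rcounit K X Z \<bullet>\<^bsub>B\<^esub> (g \<star>\<^bsub>B\<^esub> idt B X) = f)"

definition ladj ::
    "('o, 'm, 'c) bicat \<Rightarrow> ('m, 'c) closure \<Rightarrow> 'm \<Rightarrow> 'm \<Rightarrow> 'm \<Rightarrow> 'c \<Rightarrow> 'c" where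
  "ladj B K X W Z f =
     (THE g. g \<in> cells B W (fo (lexp K X) Z) \<and>
             lcounit K X Z \<bullet>\<^bsub>B\<^esub> (idt B X \<star>\<^bsub>B\<^esub> g) = f)"


section \<open>Lax volutive categories\<close>

record ('o, 'a) vcat =
  ucat :: "('o, 'a) cat"
  vd   :: "('o, 'a, 'o, 'a) ftr"
  veta :: "'o \<Rightarrow> 'a"

text \<open>The opposite of a functor has the same object and arrow maps.\<close>

definition lax_volutive_category :: "('o, 'a) vcat \<Rightarrow> bool" where
  "lax_volutive_category V \<longleftrightarrow>
     category (ucat V) \<and>
     is_functor (ucat V) (op_cat (ucat V)) (vd V) \<and>
     nat_trans (ucat V) (ucat V) ftr_id (vd V \<circ>\<circ> vd V) (veta V) \<and>
     (\<forall>x\<in>Ob (ucat V).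
        fa (vd V) (veta V x) \<cdot>\<^bsub>ucat V\<^esub> veta V (fo (vd V) x) = Id (ucat V) (fo (vd V) x))"

text \<open>\<open>vstr F x : F (d x) \<rightarrow> d' (F x)\<close>, hence in \<open>op_cat\<close> an arrow \<open>d' (F x) \<rightarrow> F (d x)\<close>.\<close>

record ('o, 'a, 'p, 'b) vftr =
  uftr :: "('o, 'a, 'p, 'b) ftr"
  vstr :: "'o \<Rightarrow> 'b"

definition lax_volutive_functor ::
    "('o, 'a) vcat \<Rightarrow> ('p, 'b) vcat \<Rightarrow> ('o, 'a, 'p, 'b) vftr \<Rightarrow> bool" where
  "lax_volutive_functor V V' F \<longleftrightarrow>
     is_functor (ucat V) (ucat V') (uftr F) \<and>
     nat_trans (ucat V) (op_cat (ucat V')) (vd V' \<circ>\<circ> uftr F) (uftr F \<circ>\<circ> vd V) (vstr F) \<and>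
     (\<forall>x\<in>Ob (ucat V).
        vstr F (fo (vd V) x) \<cdot>\<^bsub>ucat V'\<^esub> fa (uftr F) (veta V x) =
        fa (vd V') (vstr F x) \<cdot>\<^bsub>ucat V'\<^esub> veta V' (fo (uftr F) x))"

definition lax_volutive_trans ::
    "('o, 'a) vcat \<Rightarrow> ('p, 'b) vcat \<Rightarrow> ('o, 'a, 'p, 'b) vftr \<Rightarrow> ('o, 'a, 'p, 'b) vftr \<Rightarrow>
     ('o \<Rightarrow> 'b) \<Rightarrow> bool" where
  "lax_volutive_trans V V' F G \<xi> \<longleftrightarrow>
     nat_trans (ucat V) (ucat V') (uftr F) (uftr G) \<xi> \<and>
     (\<forall>x\<in>Ob (ucat V).
        fa (vd V') (\<xi> x) \<cdot>\<^bsub>ucat V'\<^esub> vstr G x \<cdot>\<^bsub>ucat V'\<^esub> \<xi> (fo (vd V) x) = vstr F x)"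

definition lax_volutive_iso ::
    "('o, 'a) vcat \<Rightarrow> ('p, 'b) vcat \<Rightarrow> ('o, 'a, 'p, 'b) vftr \<Rightarrow> ('o, 'a, 'p, 'b) vftr \<Rightarrow>
     ('o \<Rightarrow> 'b) \<Rightarrow> bool" where
  "lax_volutive_iso V V' F G \<xi> \<longleftrightarrow>
     lax_volutive_trans V V' F G \<xi> \<and>
     (\<exists>\<zeta>. lax_volutive_trans V V' G F \<zeta> \<and> (\<forall>x\<in>Ob (ucat V). inverses (ucat V') (\<xi> x) (\<zeta> x)))"

definition vprod :: "('o, 'a) vcat \<Rightarrow> ('p, 'b) vcat \<Rightarrow> ('o \<times> 'p, 'a \<times> 'b) vcat" where
  "vprod V V' = \<lparr>ucat = prod_cat (ucat V) (ucat V'), vd = ftr_prod (vd V) (vd V'),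
                 veta = map_prod (veta V) (veta V')\<rparr>"

definition vunit :: "(unit, unit) vcat" where
  "vunit = \<lparr>ucat = unit_cat, vd = ftr_id, veta = (\<lambda>_. ())\<rparr>"

text \<open>A functor that commutes strictly with the structures of \<open>V\<close> and the target.\<close>

definition vstrict ::
    "('o, 'a) vcat \<Rightarrow> ('p, 'b) vcat \<Rightarrow> ('o, 'a, 'p, 'b) ftr \<Rightarrow> ('o, 'a, 'p, 'b) vftr" where
  "vstrict V V' F = \<lparr>uftr = F, vstr = (\<lambda>x. Id (ucat V') (fo F (fo (vd V) x)))\<rparr>"

definition vf_id :: "('o, 'a) vcat \<Rightarrow> ('o, 'a, 'o, 'a) vftr" where
  "vf_id V = vstrict V V ftr_id"

text \<open>\<open>V''\<close> is the target of \<open>G\<close>; the structure of \<open>G F\<close> is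
  \<open>G (F (d x)) \<rightarrow> G (d' (F x)) \<rightarrow> d'' (G (F x))\<close>.\<close>

definition vf_comp ::
    "('q, 'c) vcat \<Rightarrow> ('p, 'b, 'q, 'c) vftr \<Rightarrow> ('o, 'a, 'p, 'b) vftr \<Rightarrow>
     ('o, 'a, 'q, 'c) vftr" where
  "vf_comp V'' G F = \<lparr>uftr = uftr G \<circ>\<circ> uftr F,
     vstr = (\<lambda>x. vstr G (fo (uftr F) x) \<cdot>\<^bsub>ucat V''\<^esub> fa (uftr G) (vstr F x))\<rparr>"

definition vf_prod ::
    "('o, 'a, 'p, 'b) vftr \<Rightarrow> ('o', 'a', 'p', 'b') vftr \<Rightarrow>
     ('o \<times> 'o', 'a \<times> 'a', 'p \<times> 'p', 'b \<times> 'b') vftr" where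
  "vf_prod F G = \<lparr>uftr = ftr_prod (uftr F) (uftr G), vstr = map_prod (vstr F) (vstr G)\<rparr>"

definition unit_left :: "('o, 'a, unit \<times> 'o, unit \<times> 'a) ftr" where
  "unit_left = \<lparr>fo = (\<lambda>x. ((), x)), fa = (\<lambda>f. ((), f))\<rparr>"

definition unit_right :: "('o, 'a, 'o \<times> unit, 'a \<times> unit) ftr" where
  "unit_right = \<lparr>fo = (\<lambda>x. (x, ())), fa = (\<lambda>f. (f, ()))\<rparr>"


section \<open>Enrichment in lax volutive categories\<close>

definition comp_vftr ::
    "('o, 'm, 'c) bicat \<Rightarrow> ('o \<Rightarrow> 'o \<Rightarrow> 'o \<Rightarrow> 'm \<times> 'm \<Rightarrow> 'c) \<Rightarrow> 'o \<Rightarrow> 'o \<Rightarrow> 'o \<Rightarrow>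
     ('m \<times> 'm, 'c \<times> 'c, 'm, 'c) vftr" where
  "comp_vftr B \<mu> a b c = \<lparr>uftr = hcomp B, vstr = \<mu> a b c\<rparr>"

definition unit_vftr ::
    "('o, 'm, 'c) bicat \<Rightarrow> ('o \<Rightarrow> 'c) \<Rightarrow> 'o \<Rightarrow> (unit, unit, 'm, 'c) vftr" where
  "unit_vftr B \<iota> a =
     \<lparr>uftr = \<lparr>fo = (\<lambda>_. one B a), fa = (\<lambda>_. idt B (one B a))\<rparr>, vstr = (\<lambda>_. \<iota> a)\<rparr>"

text \<open>An enrichment of \<open>B\<close> in the monoidal 2-category of lax volutive categories whose
  underlying bicategory is \<open>B\<close>: volutive structures \<open>V a b\<close> on the hom-categories, structure
  2-morphisms \<open>\<mu>\<close> and \<open>\<iota>\<close> making composition and units lax volutive functors, and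
  compatibility of these with the associators and unitors of \<open>B\<close>, which must be invertible
  lax volutive transformations. The pentagon and triangle are those of \<open>B\<close>.\<close>

definition lax_volutive_enrichment ::
    "('o, 'm, 'c) bicat \<Rightarrow> ('o \<Rightarrow> 'o \<Rightarrow> ('m, 'c) vcat) \<Rightarrow>
     ('o \<Rightarrow> 'o \<Rightarrow> 'o \<Rightarrow> 'm \<times> 'm \<Rightarrow> 'c) \<Rightarrow> ('o \<Rightarrow> 'c) \<Rightarrow> bool" where
  "lax_volutive_enrichment B V \<mu> \<iota> \<longleftrightarrow>
     bicategory B \<and>
     (\<forall>a\<in>Obj B. \<forall>b\<in>Obj B. ucat (V a b) = hom B a b \<and> lax_volutive_category (V a b)) \<and>
     (\<forall>a\<in>Obj B. \<forall>b\<in>Obj B. \<forall>c\<in>Obj B.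
        lax_volutive_functor (vprod (V b c) (V a b)) (V a c) (comp_vftr B \<mu> a b c)) \<and>
     (\<forall>a\<in>Obj B. lax_volutive_functor vunit (V a a) (unit_vftr B \<iota> a)) \<and>
     (\<forall>a\<in>Obj B. \<forall>b\<in>Obj B. \<forall>c\<in>Obj B. \<forall>e\<in>Obj B.
        lax_volutive_iso (vprod (vprod (V c e) (V b c)) (V a b)) (V a e)
          (vf_comp (V a e) (comp_vftr B \<mu> a b e)
             (vf_prod (comp_vftr B \<mu> b c e) (vf_id (V a b))))
          (vf_comp (V a e) (comp_vftr B \<mu> a c e)
             (vf_comp (vprod (V c e) (V a c)) (vf_prod (vf_id (V c e)) (comp_vftr B \<mu> a b c))
                (vstrict (vprod (vprod (V c e) (V b c)) (V a b))
                   (vprod (V c e) (vprod (V b c) (V a b))) prod_assoc)))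
          (\<lambda>((W, Y), X). asc B W Y X)) \<and>
     (\<forall>a\<in>Obj B. \<forall>b\<in>Obj B.
        lax_volutive_iso (V a b) (V a b)
          (vf_comp (V a b) (comp_vftr B \<mu> a b b)
             (vf_comp (vprod (V b b) (V a b)) (vf_prod (unit_vftr B \<iota> b) (vf_id (V a b)))
                (vstrict (V a b) (vprod vunit (V a b)) unit_left)))
          (vf_id (V a b)) (lu B) \<and>
        lax_volutive_iso (V a b) (V a b)
          (vf_comp (V a b) (comp_vftr B \<mu> a a b)
             (vf_comp (vprod (V a b) (V a a)) (vf_prod (vf_id (V a b)) (unit_vftr B \<iota> a))
                (vstrict (V a b) (vprod (V a b) vunit) unit_right)))
          (vf_id (V a b)) (ru B))"


section \<open>The enrichment of a 1-closed dagger bicategory\<close>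

text \<open>\<open>res B K a X = 1\<^sub>a\<^sup>X\<close> with evaluation \<open>1\<^sub>a\<^sup>X \<odot> X \<rightarrow> 1\<^sub>a\<close>, and its contravariant
  action \<open>1\<^sub>a\<^sup>X\<^sup>' \<rightarrow> 1\<^sub>a\<^sup>X\<close> on \<open>f : X \<rightarrow> X'\<close>.\<close>

definition res :: "('o, 'm, 'c) bicat \<Rightarrow> ('m, 'c) closure \<Rightarrow> 'o \<Rightarrow> 'm \<Rightarrow> 'm" where
  "res B K a X = fo (rexp K X) (one B a)"

definition res_ev :: "('o, 'm, 'c) bicat \<Rightarrow> ('m, 'c) closure \<Rightarrow> 'o \<Rightarrow> 'm \<Rightarrow> 'c" where
  "res_ev B K a X = rcounit K X (one B a)"

definition res2 :: "('o, 'm, 'c) bicat \<Rightarrow> ('m, 'c) closure \<Rightarrow> 'o \<Rightarrow> 'c \<Rightarrow> 'c" where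
  "res2 B K a f =
     radj B K (dm B f) (res B K a (cd B f)) (one B a)
       (res_ev B K a (cd B f) \<bullet>\<^bsub>B\<^esub> (idt B (res B K a (cd B f)) \<star>\<^bsub>B\<^esub> f))"

definition dbar ::
    "('o, 'm, 'c) bicat \<Rightarrow> ('o, 'm, 'c, 'o, 'm, 'c) psftr \<Rightarrow> ('m, 'c) closure \<Rightarrow> 'o \<Rightarrow>
     ('m, 'c, 'm, 'c) ftr" where
  "dbar B d K a =
     \<lparr>fo = (\<lambda>X. pmor d (res B K a X)), fa = (\<lambda>f. pcell d (res2 B K a f))\<rparr>"

text \<open>For \<open>Z : b \<rightarrow> a\<close>, the canonical isomorphism \<open>d (1\<^sub>a\<^sup>d\<^sup>Z) \<rightarrow> \<^sup>Z1\<^sub>a\<close>: since \<open>d\<close> exchanges the two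
  closures, \<open>d (1\<^sub>a\<^sup>d\<^sup>Z)\<close> carries the pairing
  \<open>Z \<odot> d (1\<^sub>a\<^sup>d\<^sup>Z) \<rightarrow> d (d Z) \<odot> d (1\<^sub>a\<^sup>d\<^sup>Z) \<rightarrow> d (1\<^sub>a\<^sup>d\<^sup>Z \<odot> d Z) \<rightarrow> d 1\<^sub>a \<rightarrow> 1\<^sub>a\<close>, and the map is its
  adjunct.\<close>

definition dual_pairing ::
    "('o, 'm, 'c) bicat \<Rightarrow> ('o, 'm, 'c, 'o, 'm, 'c) psftr \<Rightarrow> ('m \<Rightarrow> 'c) \<Rightarrow> ('m, 'c) closure \<Rightarrow>
     'o \<Rightarrow> 'm \<Rightarrow> 'c" where
  "dual_pairing B d \<eta> K a Z =
     inv2 B (punit d a) \<bullet>\<^bsub>B\<^esub> pcell d (res_ev B K a (pmor d Z))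
       \<bullet>\<^bsub>B\<^esub> pcomp d (res B K a (pmor d Z)) (pmor d Z)
       \<bullet>\<^bsub>B\<^esub> (\<eta> Z \<star>\<^bsub>B\<^esub> idt B (pmor d (res B K a (pmor d Z))))"

definition dual_comparison ::
    "('o, 'm, 'c) bicat \<Rightarrow> ('o, 'm, 'c, 'o, 'm, 'c) psftr \<Rightarrow> ('m \<Rightarrow> 'c) \<Rightarrow> ('m, 'c) closure \<Rightarrow>
     'o \<Rightarrow> 'm \<Rightarrow> 'c" where
  "dual_comparison B d \<eta> K a Z =
     ladj B K Z (pmor d (res B K a (pmor d Z))) (one B a) (dual_pairing B d \<eta> K a Z)"

text \<open>The adjunct \<open>X \<rightarrow> \<^sup>Z1\<^sub>a\<close> of the evaluation of \<open>X\<close>, where \<open>Z = 1\<^sub>a\<^sup>X\<close>, followed by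
  \<open>\<^sup>Z1\<^sub>a \<cong> d (1\<^sub>a\<^sup>d\<^sup>Z)\<close>.\<close>

definition etabar ::
    "('o, 'm, 'c) bicat \<Rightarrow> ('o, 'm, 'c, 'o, 'm, 'c) psftr \<Rightarrow> ('m \<Rightarrow> 'c) \<Rightarrow> ('m, 'c) closure \<Rightarrow>
     'o \<Rightarrow> 'm \<Rightarrow> 'c" where
  "etabar B d \<eta> K a X =
     inv2 B (dual_comparison B d \<eta> K a (res B K a X)) \<bullet>\<^bsub>B\<^esub>
     ladj B K (res B K a X) X (one B a) (res_ev B K a X)"

definition hom_volutive ::
    "('o, 'm, 'c) bicat \<Rightarrow> ('o, 'm, 'c, 'o, 'm, 'c) psftr \<Rightarrow> ('m \<Rightarrow> 'c) \<Rightarrow> ('m, 'c) closure \<Rightarrow>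
     'o \<Rightarrow> 'o \<Rightarrow> ('m, 'c) vcat" where
  "hom_volutive B d \<eta> K a b =
     \<lparr>ucat = hom B a b, vd = dbar B d K a, veta = etabar B d \<eta> K a\<rparr>"

text \<open>For \<open>X : a \<rightarrow> b\<close>, \<open>Y : b \<rightarrow> c\<close>, the canonical map \<open>1\<^sub>a\<^sup>X \<odot> 1\<^sub>b\<^sup>Y \<rightarrow> 1\<^sub>a\<^sup>Y\<^sup>\<odot>\<^sup>X\<close> is the adjunct of
  \<open>(1\<^sub>a\<^sup>X \<odot> 1\<^sub>b\<^sup>Y) \<odot> (Y \<odot> X) \<rightarrow> 1\<^sub>a\<^sup>X \<odot> (1\<^sub>b\<^sup>Y \<odot> (Y \<odot> X)) \<rightarrow> 1\<^sub>a\<^sup>X \<odot> ((1\<^sub>b\<^sup>Y \<odot> Y) \<odot> X)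
  \<rightarrow> 1\<^sub>a\<^sup>X \<odot> (1\<^sub>b \<odot> X) \<rightarrow> 1\<^sub>a\<^sup>X \<odot> X \<rightarrow> 1\<^sub>a\<close>.\<close>

definition res_comp ::
    "('o, 'm, 'c) bicat \<Rightarrow> ('m, 'c) closure \<Rightarrow> 'o \<Rightarrow> 'o \<Rightarrow> 'm \<Rightarrow> 'm \<Rightarrow> 'c" where
  "res_comp B K a b Y X =
     radj B K (Y \<odot>\<^bsub>B\<^esub> X) (res B K a X \<odot>\<^bsub>B\<^esub> res B K b Y) (one B a)
       (res_ev B K a X
        \<bullet>\<^bsub>B\<^esub> (idt B (res B K a X) \<star>\<^bsub>B\<^esub>
             (lu B X \<bullet>\<^bsub>B\<^esub> (res_ev B K b Y \<star>\<^bsub>B\<^esub> idt B X)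
                     \<bullet>\<^bsub>B\<^esub> inv2 B (asc B (res B K b Y) Y X)))
        \<bullet>\<^bsub>B\<^esub> asc B (res B K a X) (res B K b Y) (Y \<odot>\<^bsub>B\<^esub> X))"

definition comp_str ::
    "('o, 'm, 'c) bicat \<Rightarrow> ('o, 'm, 'c, 'o, 'm, 'c) psftr \<Rightarrow> ('m, 'c) closure \<Rightarrow>
     'o \<Rightarrow> 'o \<Rightarrow> 'o \<Rightarrow> 'm \<times> 'm \<Rightarrow> 'c" where
  "comp_str B d K a b c =
     (\<lambda>(Y, X). pcell d (res_comp B K a b Y X) \<bullet>\<^bsub>B\<^esub> pcomp d (res B K a X) (res B K b Y))"

text \<open>\<open>1\<^sub>a \<rightarrow> d 1\<^sub>a \<rightarrow> d (1\<^sub>a\<^sup>1\<^sup>a)\<close>, the second map being induced by the adjunct of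
  the unitor \<open>1\<^sub>a \<odot> 1\<^sub>a \<rightarrow> 1\<^sub>a\<close>.\<close>

definition unit_str ::
    "('o, 'm, 'c) bicat \<Rightarrow> ('o, 'm, 'c, 'o, 'm, 'c) psftr \<Rightarrow> ('m, 'c) closure \<Rightarrow> 'o \<Rightarrow> 'c" where
  "unit_str B d K a =
     pcell d (radj B K (one B a) (one B a) (one B a) (ru B (one B a))) \<bullet>\<^bsub>B\<^esub> punit d a"

end

theory Submission
  imports Defs
begin

text \<open>A lax volutive structure on a category is the same as a symmetric representable form: sets
  \<open>\<Phi>(x, y)\<close>, contravariant in both variables, with an involution \<open>\<Phi>(x, y) \<cong> \<Phi>(y, x)\<close> and universal
  elements representing \<open>\<Phi>(-, y)\<close> by \<open>d y\<close>. Lax volutive functors come from maps of forms, and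
  transformations are volutive when they respect these maps, so that no equation between adjuncts
  is left to check.

  On \<open>Hom(a, b)\<close> the form is \<open>\<Phi>(X', X) = {\<phi> : d X' \<odot> X \<rightarrow> 1\<^sub>a}\<close>. It is represented by \<open>d (1\<^sub>a\<^sup>X)\<close>
  because \<open>d\<close> is an equivalence, and the involution applies \<open>d\<close> to a pairing. Composition nests one
  pairing inside another; this is associative and unital up to the structure 2-morphisms of the
  bicategory, and \<open>d\<close> preserves it because \<open>d\<close> is a pseudofunctor.\<close>

section \<open>Representable symmetric forms\<close>

text \<open>The arrows of the enrichment are adjuncts given by definite descriptions, and
  \<open>etabar\<close> even contains the inverse of an adjunct. Checking the volutive laws on them
  directly would mean composing mates of mates. Each such arrow is instead characterised by what it
  does to a universal element, and equality of arrows is tested there, by \<open>uni_inj\<close>.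

  The first variable of the form passes through \<open>d\<close> for two reasons. Since
  \<open>d\<close> reverses 1-morphisms, \<open>D X'\<close> runs from \<open>b\<close> to
  \<open>a\<close> and can be composed with \<open>X\<close>; since \<open>d\<close> keeps the
  direction of 2-morphisms, precomposition is contravariant in both variables. The price is that the
  universal element at \<open>X\<close> lives on \<open>D (D (res_a a X)) \<odot> X\<close>, so
  \<open>\<eta>\<close> has to be inverted before evaluating. Coherence of \<open>\<eta>\<close>
  with \<open>d\<close> makes the involution square to the identity, and this in turn gives the
  triangle law of a volutive category.\<close>

lemma homset_Ob:
  assumes "category C" "f \<in> homset C x y"
  shows "x \<in> Ob C" "y \<in> Ob C"
  using assms unfolding category_def homset_def by auto

lemma Id_homset: "category C \<Longrightarrow> x \<in> Ob C \<Longrightarrow> Id C x \<in> homset C x x"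
  by (simp add: category_def)

lemma Comp_homset:
  assumes "category C" "f \<in> homset C x y" "g \<in> homset C y z"
  shows "g \<cdot>\<^bsub>C\<^esub> f \<in> homset C x z"
  using assms homset_Ob[OF assms(1,2)] homset_Ob[OF assms(1,3)] unfolding category_def by blast

lemma Comp_Id:
  assumes "category C" "f \<in> homset C x y"
  shows "f \<cdot>\<^bsub>C\<^esub> Id C x = f" "Id C y \<cdot>\<^bsub>C\<^esub> f = f"
  using assms homset_Ob[OF assms(1,2)] unfolding category_def by blast+

lemma Comp_assoc:
  assumes "category C" "f \<in> homset C w x" "g \<in> homset C x y" "h \<in> homset C y z"
  shows "(h \<cdot>\<^bsub>C\<^esub> g) \<cdot>\<^bsub>C\<^esub> f = h \<cdot>\<^bsub>C\<^esub> (g \<cdot>\<^bsub>C\<^esub> f)"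
  using assms homset_Ob[OF assms(1,2)] homset_Ob[OF assms(1,3)] homset_Ob[OF assms(1,4)]
  unfolding category_def by blast

lemma homset_op [simp]: "homset (op_cat C) x y = homset C y x"
  by (auto simp: homset_def op_cat_def)

lemma op_cat_simps [simp]:
  "Ob (op_cat C) = Ob C" "Id (op_cat C) = Id C" "Comp (op_cat C) g f = f \<cdot>\<^bsub>C\<^esub> g"
  "Arr (op_cat C) = Arr C" "Dom (op_cat C) = Cod C" "Cod (op_cat C) = Dom C"
  by (simp_all add: op_cat_def)

lemma category_op:
  assumes C: "category C" shows "category (op_cat C)"
  using C unfolding category_def by (simp add: Comp_assoc[OF C])

lemma prod_cat_simps [simp]:
  "Ob (prod_cat C D) = Ob C \<times> Ob D"
  "Id (prod_cat C D) (x, y) = (Id C x, Id D y)"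
  "Comp (prod_cat C D) (g, g') (f, f') = (g \<cdot>\<^bsub>C\<^esub> f, g' \<cdot>\<^bsub>D\<^esub> f')"
  "homset (prod_cat C D) (x, y) (x', y') = homset C x x' \<times> homset D y y'"
  by (auto simp: homset_def prod_cat_def)

lemma category_prod:
  assumes C: "category C" and D: "category D" shows "category (prod_cat C D)"
  unfolding category_def
proof (intro conjI)
  show "\<forall>f\<in>Arr (prod_cat C D). Dom (prod_cat C D) f \<in> Ob (prod_cat C D) \<and>
      Cod (prod_cat C D) f \<in> Ob (prod_cat C D)"
    using C D by (auto simp: category_def prod_cat_def)
qed (auto simp: Id_homset[OF C] Id_homset[OF D] Comp_Id[OF C] Comp_Id[OF D]
    Comp_assoc[OF C] Comp_assoc[OF D] intro: Comp_homset[OF C] Comp_homset[OF D])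

lemma unit_cat_simps [simp]:
  "Ob unit_cat = {()}" "Id unit_cat x = ()" "Comp unit_cat g f = ()" "homset unit_cat x y = {()}"
  by (auto simp: homset_def unit_cat_def)

lemma category_unit: "category unit_cat"
  by (simp add: category_def)

lemma ftr_simps [simp]:
  "fo (G \<circ>\<circ> F) x = fo G (fo F x)" "fa (G \<circ>\<circ> F) f = fa G (fa F f)"
  "fo ftr_id x = x" "fa ftr_id f = f"
  by (simp_all add: ftr_comp_def ftr_id_def)

lemma ftr_prod_simps [simp]:
  "fo (ftr_prod F' G') (x', y') = (fo F' x', fo G' y')"
  "fa (ftr_prod F' G') (f', g') = (fa F' f', fa G' g')"
  by (simp_all add: ftr_prod_def)

lemma is_functor_id: "category C \<Longrightarrow> is_functor C C ftr_id"
  by (simp add: is_functor_def)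

lemma is_functor_comp:
  assumes "is_functor C D F" "is_functor D E G"
  shows "is_functor C E (G \<circ>\<circ> F)"
  using assms unfolding is_functor_def by simp metis

lemma is_functor_op:
  assumes "is_functor C (op_cat D) F" and D: "category D"
  shows "is_functor (op_cat C) D F"
  using assms category_op[of C] unfolding is_functor_def by simp

lemma is_functor_op2:
  assumes "is_functor C D F"
  shows "is_functor (op_cat C) (op_cat D) F"
  using assms category_op[of C] category_op[of D] unfolding is_functor_def by simp

lemma is_functor_prod:
  assumes F: "is_functor C D F" and F': "is_functor C' D' F'"
  shows "is_functor (prod_cat C C') (prod_cat D D') (ftr_prod F F')"
  using assms category_prod[of C C'] category_prod[of D D'] unfolding is_functor_def by auto

lemma functor_homset:
  assumes "is_functor C D F" "f \<in> homset C x y"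
  shows "fa F f \<in> homset D (fo F x) (fo F y)"
proof -
  have C: "category C" using assms(1) by (simp add: is_functor_def)
  show ?thesis
    using assms homset_Ob[OF C assms(2)] unfolding is_functor_def by blast
qed

lemma functor_Comp:
  assumes "is_functor C D F" "f \<in> homset C x y" "g \<in> homset C y z"
  shows "fa F (g \<cdot>\<^bsub>C\<^esub> f) = fa F g \<cdot>\<^bsub>D\<^esub> fa F f"
proof -
  have C: "category C" using assms(1) by (simp add: is_functor_def)
  show ?thesis
    using assms homset_Ob[OF C assms(2)] homset_Ob[OF C assms(3)] unfolding is_functor_def by blast
qed

lemma functor_simps:
  assumes "is_functor C D F"
  shows "category C" "category D" "x \<in> Ob C \<Longrightarrow> fo F x \<in> Ob D"
    "x \<in> Ob C \<Longrightarrow> fa F (Id C x) = Id D (fo F x)"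
  using assms by (auto simp: is_functor_def)

text \<open>A form pairs two objects contravariantly; \<open>act f g \<phi>\<close> is the pullback of \<open>\<phi>\<close> along \<open>f\<close>
  and \<open>g\<close>, and \<open>uni y\<close> is a universal element of the forms with second argument \<open>y\<close>.\<close>

record ('o, 'a, 'p) form =
  Frm :: "'o \<Rightarrow> 'o \<Rightarrow> 'p set"
  act :: "'a \<Rightarrow> 'a \<Rightarrow> 'p \<Rightarrow> 'p"
  flip :: "'o \<Rightarrow> 'o \<Rightarrow> 'p \<Rightarrow> 'p"
  uni :: "'o \<Rightarrow> 'p"

text \<open>The values of \<open>vd V\<close> on arrows and of \<open>veta V\<close> are prescribed
  by equations on universal elements, and \<open>uni_inj\<close> says that such an equation has at
  most one solution. Functoriality of \<open>vd V\<close>, naturality of \<open>veta V\<close> and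
  the triangle law are therefore consequences, not axioms.\<close>

locale volutive_form =
  fixes V :: "('o, 'a) vcat" and S :: "('o, 'a, 'p) form"
  assumes cat: "category (ucat V)"
    and act_in: "\<And>f g x x' y y' \<phi>. f \<in> homset (ucat V) x' x \<Longrightarrow> g \<in> homset (ucat V) y' y \<Longrightarrow>
      \<phi> \<in> Frm S x y \<Longrightarrow> act S f g \<phi> \<in> Frm S x' y'"
    and act_Id: "\<And>x y \<phi>. x \<in> Ob (ucat V) \<Longrightarrow> y \<in> Ob (ucat V) \<Longrightarrow> \<phi> \<in> Frm S x y \<Longrightarrow>
      act S (Id (ucat V) x) (Id (ucat V) y) \<phi> = \<phi>"
    and act_Comp: "\<And>f g f' g' x x' x'' y y' y'' \<phi>.
      f \<in> homset (ucat V) x' x \<Longrightarrow> g \<in> homset (ucat V) y' y \<Longrightarrow>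
      f' \<in> homset (ucat V) x'' x' \<Longrightarrow> g' \<in> homset (ucat V) y'' y' \<Longrightarrow> \<phi> \<in> Frm S x y \<Longrightarrow>
      act S f' g' (act S f g \<phi>) = act S (f \<cdot>\<^bsub>ucat V\<^esub> f') (g \<cdot>\<^bsub>ucat V\<^esub> g') \<phi>"
    and flip_in: "\<And>x y \<phi>. x \<in> Ob (ucat V) \<Longrightarrow> y \<in> Ob (ucat V) \<Longrightarrow> \<phi> \<in> Frm S x y \<Longrightarrow>
      flip S x y \<phi> \<in> Frm S y x"
    and flip_flip: "\<And>x y \<phi>. x \<in> Ob (ucat V) \<Longrightarrow> y \<in> Ob (ucat V) \<Longrightarrow> \<phi> \<in> Frm S x y \<Longrightarrow>
      flip S y x (flip S x y \<phi>) = \<phi>"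
    and flip_act: "\<And>f g x x' y y' \<phi>. f \<in> homset (ucat V) x' x \<Longrightarrow> g \<in> homset (ucat V) y' y \<Longrightarrow>
      \<phi> \<in> Frm S x y \<Longrightarrow> flip S x' y' (act S f g \<phi>) = act S g f (flip S x y \<phi>)"
    and d_Ob: "\<And>x. x \<in> Ob (ucat V) \<Longrightarrow> fo (vd V) x \<in> Ob (ucat V)"
    and uni_in: "\<And>x. x \<in> Ob (ucat V) \<Longrightarrow> uni S x \<in> Frm S (fo (vd V) x) x"
    and uni_inj: "\<And>x y f g. f \<in> homset (ucat V) x (fo (vd V) y) \<Longrightarrow>
      g \<in> homset (ucat V) x (fo (vd V) y) \<Longrightarrow> y \<in> Ob (ucat V) \<Longrightarrow>
      act S f (Id (ucat V) y) (uni S y) = act S g (Id (ucat V) y) (uni S y) \<Longrightarrow> f = g"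
    and d_in: "\<And>f x y. f \<in> homset (ucat V) x y \<Longrightarrow>
      fa (vd V) f \<in> homset (ucat V) (fo (vd V) y) (fo (vd V) x)"
    and d_char: "\<And>f x y. f \<in> homset (ucat V) x y \<Longrightarrow>
      act S (fa (vd V) f) (Id (ucat V) x) (uni S x) =
      act S (Id (ucat V) (fo (vd V) y)) f (uni S y)"
    and eta_in: "\<And>x. x \<in> Ob (ucat V) \<Longrightarrow>
      veta V x \<in> homset (ucat V) x (fo (vd V) (fo (vd V) x))"
    and eta_char: "\<And>x. x \<in> Ob (ucat V) \<Longrightarrow>
      act S (veta V x) (Id (ucat V) (fo (vd V) x)) (uni S (fo (vd V) x)) =
      flip S (fo (vd V) x) x (uni S x)"
begin

abbreviation C where "C \<equiv> ucat V"
abbreviation D where "D \<equiv> fo (vd V)"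

lemmas cat_simps = Id_homset[OF cat] Comp_homset[OF cat] Comp_Id[OF cat] d_Ob d_in eta_in
  uni_in flip_in act_in

lemma act_Comp_left:
  assumes "f \<in> homset C x (D y)" "f' \<in> homset C x' x" "y \<in> Ob C"
  shows "act S (f \<cdot>\<^bsub>C\<^esub> f') (Id C y) (uni S y) = act S f' (Id C y) (act S f (Id C y) (uni S y))"
  using act_Comp[OF assms(1) Id_homset[OF cat assms(3)] assms(2) Id_homset[OF cat assms(3)]
      uni_in[OF assms(3)]] Comp_Id[OF cat Id_homset[OF cat assms(3)]] by simp

text \<open>Pullbacks in the two slots commute. Together with \<open>d_char\<close> this carries an
  arrow from one slot of a universal element to the other, past an arrow that already acts
  there.\<close>

lemma act_swap:
  assumes f: "f \<in> homset C x' x" and g: "g \<in> homset C y' y" and \<phi>: "\<phi> \<in> Frm S x y"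
  shows "act S f (Id C y') (act S (Id C x) g \<phi>) = act S f g \<phi>"
    "act S (Id C x') g (act S f (Id C y) \<phi>) = act S f g \<phi>"
  using act_Comp[OF Id_homset[OF cat] g f Id_homset[OF cat] \<phi>]
    act_Comp[OF f Id_homset[OF cat] Id_homset[OF cat] g \<phi>]
    homset_Ob[OF cat f] homset_Ob[OF cat g] Comp_Id[OF cat f] Comp_Id[OF cat g]
  by simp_all

text \<open>\<open>d_char\<close> exchanges \<open>fa (vd V) f\<close> in the first slot for
  \<open>f\<close> in the second. Both slots are contravariant, and moving two arrows across one
  after the other reverses their order, whence the opposite category.\<close>

lemma functor_d: "is_functor C (op_cat C) (vd V)"
proof -
  have 1: "fa (vd V) (Id C x) = Id C (D x)" if x: "x \<in> Ob C" for x
    by (rule uni_inj[of _ "D x" x])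
      (use x in \<open>auto simp: cat_simps intro!: d_char Id_homset[OF cat]\<close>)
  have 2: "fa (vd V) (g \<cdot>\<^bsub>C\<^esub> f) = fa (vd V) f \<cdot>\<^bsub>C\<^esub> fa (vd V) g"
    if f: "f \<in> homset C x y" and g: "g \<in> homset C y z" for f g x y z
  proof -
    have [simp]: "x \<in> Ob C" "y \<in> Ob C" "z \<in> Ob C"
      using homset_Ob[OF cat f] homset_Ob[OF cat g] by auto
    have gf: "g \<cdot>\<^bsub>C\<^esub> f \<in> homset C x z" by (rule Comp_homset[OF cat f g])
    show ?thesis
    proof (rule uni_inj[of _ "D z" x])
      have "act S (fa (vd V) f \<cdot>\<^bsub>C\<^esub> fa (vd V) g) (Id C x) (uni S x) =
        act S (fa (vd V) g) (Id C x) (act S (Id C (D y)) f (uni S y))"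
        by (subst act_Comp_left[of _ "D y" _ _ "D z"]) (use f g in \<open>auto simp: d_in d_char\<close>)
      also have "\<dots> = act S (Id C (D z)) f (act S (fa (vd V) g) (Id C y) (uni S y))"
        using act_swap[OF d_in[OF g] f uni_in] by simp
      also have "\<dots> = act S (Id C (D z)) f (act S (Id C (D z)) g (uni S z))"
        by (simp add: d_char[OF g])
      also have "\<dots> = act S (Id C (D z)) (g \<cdot>\<^bsub>C\<^esub> f) (uni S z)"
        by (subst act_Comp[of _ "D z" "D z" _ y z _ "D z" _ x])
          (use f g Comp_Id(1)[OF cat Id_homset[OF cat, of "D z"]] in \<open>auto simp: cat_simps\<close>)
      finally show "act S (fa (vd V) (g \<cdot>\<^bsub>C\<^esub> f)) (Id C x) (uni S x) =
        act S (fa (vd V) f \<cdot>\<^bsub>C\<^esub> fa (vd V) g) (Id C x) (uni S x)"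
        by (simp add: d_char[OF gf])
    qed (use d_in[OF gf] Comp_homset[OF cat d_in[OF g] d_in[OF f]] in auto)
  qed
  show ?thesis
    unfolding is_functor_def using 1 2 cat category_op[OF cat] d_Ob d_in by simp
qed

text \<open>\<open>veta V x\<close> classifies the flipped universal element. Naturality uses
  \<open>d_char\<close> once for \<open>f\<close> inside a flip and once for
  \<open>fa (vd V) f\<close> outside it; the triangle law holds because flipping twice is the
  identity.\<close>

theorem lax_volutive: "lax_volutive_category V"
proof -
  have nat: "veta V y \<cdot>\<^bsub>C\<^esub> f = fa (vd V) (fa (vd V) f) \<cdot>\<^bsub>C\<^esub> veta V x"
    if f: "f \<in> homset C x y" for f x y
  proof -
    have [simp]: "x \<in> Ob C" "y \<in> Ob C" using homset_Ob[OF cat f] by auto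
    note df = d_in[OF f] and ddf = d_in[OF d_in[OF f]]
    show ?thesis
    proof (rule uni_inj[of _ x "D y"])
      have "act S (veta V y \<cdot>\<^bsub>C\<^esub> f) (Id C (D y)) (uni S (D y)) =
        act S f (Id C (D y)) (flip S (D y) y (uni S y))"
        by (subst act_Comp_left[of _ y _ _ x]) (use f in \<open>auto simp: eta_in eta_char d_Ob\<close>)
      also have "\<dots> = flip S (D y) x (act S (Id C (D y)) f (uni S y))"
        by (rule flip_act[symmetric]) (use f in \<open>auto simp: cat_simps\<close>)
      also have "\<dots> = flip S (D y) x (act S (fa (vd V) f) (Id C x) (uni S x))"
        by (simp add: d_char[OF f])
      also have "\<dots> = act S (Id C x) (fa (vd V) f) (flip S (D x) x (uni S x))"
        by (rule flip_act) (use f in \<open>auto simp: cat_simps\<close>)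
      also have "\<dots> = act S (Id C x) (fa (vd V) f) (act S (veta V x) (Id C (D x)) (uni S (D x)))"
        by (simp add: eta_char)
      also have "\<dots> = act S (veta V x) (Id C (D y))
          (act S (Id C (D (D x))) (fa (vd V) f) (uni S (D x)))"
        using act_swap[OF eta_in df uni_in] by (simp add: d_Ob)
      also have "\<dots> = act S (veta V x) (Id C (D y))
          (act S (fa (vd V) (fa (vd V) f)) (Id C (D y)) (uni S (D y)))"
        by (simp add: d_char[OF df])
      also have "\<dots> = act S (fa (vd V) (fa (vd V) f) \<cdot>\<^bsub>C\<^esub> veta V x) (Id C (D y)) (uni S (D y))"
        by (subst act_Comp_left[of _ "D (D x)" _ _ x]) (use ddf in \<open>auto simp: cat_simps\<close>)
      finally show "act S (veta V y \<cdot>\<^bsub>C\<^esub> f) (Id C (D y)) (uni S (D y)) =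
        act S (fa (vd V) (fa (vd V) f) \<cdot>\<^bsub>C\<^esub> veta V x) (Id C (D y)) (uni S (D y))" .
    qed (use f ddf Comp_homset[OF cat f eta_in] Comp_homset[OF cat eta_in ddf] in \<open>auto simp: d_Ob\<close>)
  qed
  have tri: "fa (vd V) (veta V x) \<cdot>\<^bsub>C\<^esub> veta V (D x) = Id C (D x)" if [simp]: "x \<in> Ob C" for x
  proof (rule uni_inj[of _ "D x" x])
    have "act S (fa (vd V) (veta V x) \<cdot>\<^bsub>C\<^esub> veta V (D x)) (Id C x) (uni S x) =
      act S (veta V (D x)) (Id C x) (act S (Id C (D (D (D x)))) (veta V x) (uni S (D (D x))))"
      using d_char[OF eta_in, of x]
      by (subst act_Comp_left[of _ "D (D (D x))" _ _ "D x"]) (auto simp: cat_simps)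
    also have "\<dots> = act S (Id C (D x)) (veta V x)
        (act S (veta V (D x)) (Id C (D (D x))) (uni S (D (D x))))"
      using act_swap[OF eta_in[of "D x"] eta_in[of x] uni_in] by (simp add: d_Ob)
    also have "\<dots> = act S (Id C (D x)) (veta V x) (flip S (D (D x)) (D x) (uni S (D x)))"
      by (simp add: eta_char d_Ob)
    \<comment> \<open>Pulling out the flip puts \<open>veta V x\<close> into the first slot, where
      \<open>eta_char\<close> produces a second flip; the two cancel.\<close>
    also have "\<dots> = flip S x (D x) (act S (veta V x) (Id C (D x)) (uni S (D x)))"
      by (rule flip_act[symmetric]) (auto simp: cat_simps)
    also have "\<dots> = uni S x"
      by (simp add: eta_char flip_flip d_Ob uni_in)
    finally show "act S (fa (vd V) (veta V x) \<cdot>\<^bsub>C\<^esub> veta V (D x)) (Id C x) (uni S x) =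
      act S (Id C (D x)) (Id C x) (uni S x)"
      by (simp add: act_Id uni_in d_Ob)
  qed (auto simp: d_Ob Id_homset[OF cat] intro!: Comp_homset[OF cat eta_in d_in] eta_in)
  have "is_functor C C (vd V \<circ>\<circ> vd V)"
    using is_functor_comp[OF functor_d is_functor_op[OF functor_d cat]] .
  then show ?thesis
    unfolding lax_volutive_category_def nat_trans_def
    using cat functor_d nat tri eta_in is_functor_id[OF cat] by simp
qed

end

section \<open>Maps of forms and the lax volutive functors they represent\<close>

definition represents_map ::
  "('o, 'a) vcat \<Rightarrow> ('o, 'a, 'p) form \<Rightarrow> ('o2, 'a2) vcat \<Rightarrow> ('o2, 'a2, 'p2) form \<Rightarrow>
    ('o, 'a, 'o2, 'a2) vftr \<Rightarrow> ('o \<Rightarrow> 'o \<Rightarrow> 'p \<Rightarrow> 'p2) \<Rightarrow> bool" where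
  "represents_map V S V' S' F T \<longleftrightarrow>
     is_functor (ucat V) (ucat V') (uftr F) \<and>
     (\<forall>x\<in>Ob (ucat V). \<forall>y\<in>Ob (ucat V). \<forall>\<phi>\<in>Frm S x y.
        T x y \<phi> \<in> Frm S' (fo (uftr F) x) (fo (uftr F) y)) \<and>
     (\<forall>x x' y y' f g \<phi>. f \<in> homset (ucat V) x' x \<longrightarrow> g \<in> homset (ucat V) y' y \<longrightarrow>
        \<phi> \<in> Frm S x y \<longrightarrow>
        T x' y' (act S f g \<phi>) = act S' (fa (uftr F) f) (fa (uftr F) g) (T x y \<phi>)) \<and>
     (\<forall>x\<in>Ob (ucat V).
        vstr F x \<in> homset (ucat V') (fo (uftr F) (fo (vd V) x)) (fo (vd V') (fo (uftr F) x)) \<and>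
        act S' (vstr F x) (Id (ucat V') (fo (uftr F) x)) (uni S' (fo (uftr F) x)) =
          T (fo (vd V) x) x (uni S x))"

text \<open>Symmetry is kept apart from \<open>represents_map\<close> because it serves the
  compatibility with \<open>veta\<close>, whereas products, composites and transformations are
  handled through \<open>represents_map\<close>.\<close>

definition flip_map ::
  "('o, 'a) vcat \<Rightarrow> ('o, 'a, 'p) form \<Rightarrow> ('o2, 'a2, 'p2) form \<Rightarrow>
    ('o, 'a, 'o2, 'a2) vftr \<Rightarrow> ('o \<Rightarrow> 'o \<Rightarrow> 'p \<Rightarrow> 'p2) \<Rightarrow> bool" where
  "flip_map V S S' F T \<longleftrightarrow>
     (\<forall>x\<in>Ob (ucat V). \<forall>y\<in>Ob (ucat V). \<forall>\<phi>\<in>Frm S x y.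
        T y x (flip S x y \<phi>) = flip S' (fo (uftr F) x) (fo (uftr F) y) (T x y \<phi>))"

lemma represents_mapD:
  assumes "represents_map V S V' S' F T"
  shows "is_functor (ucat V) (ucat V') (uftr F)"
    "x \<in> Ob (ucat V) \<Longrightarrow> y \<in> Ob (ucat V) \<Longrightarrow> \<phi> \<in> Frm S x y \<Longrightarrow>
      T x y \<phi> \<in> Frm S' (fo (uftr F) x) (fo (uftr F) y)"
    "f \<in> homset (ucat V) x' x \<Longrightarrow> g \<in> homset (ucat V) y' y \<Longrightarrow> \<phi> \<in> Frm S x y \<Longrightarrow>
      T x' y' (act S f g \<phi>) = act S' (fa (uftr F) f) (fa (uftr F) g) (T x y \<phi>)"
    "x \<in> Ob (ucat V) \<Longrightarrow>
      vstr F x \<in> homset (ucat V') (fo (uftr F) (fo (vd V) x)) (fo (vd V') (fo (uftr F) x))"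
    "x \<in> Ob (ucat V) \<Longrightarrow>
      act S' (vstr F x) (Id (ucat V') (fo (uftr F) x)) (uni S' (fo (uftr F) x)) =
        T (fo (vd V) x) x (uni S x)"
  using assms unfolding represents_map_def by blast+

text \<open>The last clause of \<open>represents_map\<close> says that \<open>vstr F x\<close>
  classifies the image under \<open>T\<close> of the universal element. Naturality of
  \<open>vstr F\<close> is then naturality of \<open>T\<close>, and its compatibility with
  \<open>veta\<close> is compatibility of \<open>T\<close> with \<open>flip\<close>.\<close>

theorem represents_map_lax_volutive:
  assumes V: "volutive_form V S" and V': "volutive_form V' S'"
    and R: "represents_map V S V' S' F T" and fl: "flip_map V S S' F T"
  shows "lax_volutive_functor V V' F"
proof -
  interpret V: volutive_form V S by (rule V)
  interpret V': volutive_form V' S' by (rule V')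
  note F = represents_mapD(1)[OF R] and T = represents_mapD(2)[OF R]
    and Tact = represents_mapD(3)[OF R] and str = represents_mapD(4)[OF R]
    and str_char = represents_mapD(5)[OF R]
  let ?F = "fo (uftr F)" and ?Fa = "fa (uftr F)"
  note Fob [simp] = functor_simps(3)[OF F]
  have nat: "fa (vd V') (?Fa f) \<cdot>\<^bsub>V'.C\<^esub> vstr F y = vstr F x \<cdot>\<^bsub>V'.C\<^esub> ?Fa (fa (vd V) f)"
    if f: "f \<in> homset V.C x y" for f x y
  proof -
    have xy [simp]: "x \<in> Ob V.C" "y \<in> Ob V.C" using homset_Ob[OF V.cat f] by auto
    note Ff = functor_homset[OF F f] and Fdf = functor_homset[OF F V.d_in[OF f]]
    show ?thesis
    proof (rule V'.uni_inj[of _ "?F (V.D y)" "?F x"])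
      have "act S' (fa (vd V') (?Fa f) \<cdot>\<^bsub>V'.C\<^esub> vstr F y) (Id V'.C (?F x)) (uni S' (?F x)) =
        act S' (vstr F y) (Id V'.C (?F x)) (act S' (Id V'.C (V'.D (?F y))) (?Fa f) (uni S' (?F y)))"
        by (subst V'.act_Comp_left[of _ "V'.D (?F y)" _ _ "?F (V.D y)"])
          (use Ff in \<open>auto simp: V'.d_in str V'.d_char\<close>)
      also have "\<dots> = act S' (Id V'.C (?F (V.D y))) (?Fa f) (T (V.D y) y (uni S y))"
        using V'.act_swap[OF str[of y] Ff V'.uni_in] by (simp add: str_char)
      also have "\<dots> = T (V.D y) x (act S (Id V.C (V.D y)) f (uni S y))"
        using Tact[OF Id_homset[OF V.cat, of "V.D y"] f V.uni_in] functor_simps(4)[OF F]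
        by (simp add: V.d_Ob)
      also have "\<dots> = T (V.D y) x (act S (fa (vd V) f) (Id V.C x) (uni S x))"
        by (simp add: V.d_char[OF f])
      also have "\<dots> = act S' (?Fa (fa (vd V) f)) (Id V'.C (?F x)) (T (V.D x) x (uni S x))"
        using Tact[OF V.d_in[OF f] Id_homset[OF V.cat] V.uni_in] functor_simps(4)[OF F] by simp
      also have "\<dots> = act S' (vstr F x \<cdot>\<^bsub>V'.C\<^esub> ?Fa (fa (vd V) f)) (Id V'.C (?F x)) (uni S' (?F x))"
        by (subst V'.act_Comp_left[of _ "?F (V.D x)" _ _ "?F (V.D y)"])
          (use Fdf in \<open>auto simp: str str_char\<close>)
      finally show "act S' (fa (vd V') (?Fa f) \<cdot>\<^bsub>V'.C\<^esub> vstr F y) (Id V'.C (?F x)) (uni S' (?F x)) =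
        act S' (vstr F x \<cdot>\<^bsub>V'.C\<^esub> ?Fa (fa (vd V) f)) (Id V'.C (?F x)) (uni S' (?F x))" .
    qed (use Comp_homset[OF V'.cat str V'.d_in[OF Ff]] Comp_homset[OF V'.cat Fdf str] in auto)
  qed
  have eta: "vstr F (V.D x) \<cdot>\<^bsub>V'.C\<^esub> ?Fa (veta V x) = fa (vd V') (vstr F x) \<cdot>\<^bsub>V'.C\<^esub> veta V' (?F x)"
    if x [simp]: "x \<in> Ob V.C" for x
  proof -
    have [simp]: "V.D x \<in> Ob V.C" "V'.D (?F x) \<in> Ob V'.C" by (simp_all add: V.d_Ob V'.d_Ob)
    note Feta = functor_homset[OF F V.eta_in[OF x]]
    show ?thesis
    proof (rule V'.uni_inj[of _ "?F x" "?F (V.D x)"])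
      have "act S' (vstr F (V.D x) \<cdot>\<^bsub>V'.C\<^esub> ?Fa (veta V x)) (Id V'.C (?F (V.D x)))
          (uni S' (?F (V.D x))) =
        act S' (?Fa (veta V x)) (Id V'.C (?F (V.D x))) (T (V.D (V.D x)) (V.D x) (uni S (V.D x)))"
        by (subst V'.act_Comp_left[of _ "?F (V.D (V.D x))" _ _ "?F x"])
          (use Feta in \<open>auto simp: str str_char\<close>)
      also have "\<dots> = T x (V.D x) (act S (veta V x) (Id V.C (V.D x)) (uni S (V.D x)))"
        using Tact[OF V.eta_in[OF x] Id_homset[OF V.cat] V.uni_in] functor_simps(4)[OF F]
        by simp
      \<comment> \<open>Symmetry of \<open>T\<close> turns the image of a flipped universal element
        into a flip in the target, where it can be compared with \<open>veta V'\<close>.\<close>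
      also have "\<dots> = flip S' (?F (V.D x)) (?F x) (T (V.D x) x (uni S x))"
        using fl by (simp add: V.eta_char flip_map_def V.uni_in)
      also have "\<dots> = flip S' (?F (V.D x)) (?F x)
          (act S' (vstr F x) (Id V'.C (?F x)) (uni S' (?F x)))"
        by (simp add: str_char)
      also have "\<dots> = act S' (Id V'.C (?F x)) (vstr F x) (flip S' (V'.D (?F x)) (?F x) (uni S' (?F x)))"
        by (rule V'.flip_act) (auto simp: V'.cat_simps str)
      also have "\<dots> = act S' (veta V' (?F x)) (Id V'.C (?F (V.D x)))
          (act S' (Id V'.C (V'.D (V'.D (?F x)))) (vstr F x) (uni S' (V'.D (?F x))))"
        using V'.act_swap[OF V'.eta_in[of "?F x"] str[of x] V'.uni_in]
        by (simp add: V'.eta_char)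
      also have "\<dots> = act S' (fa (vd V') (vstr F x) \<cdot>\<^bsub>V'.C\<^esub> veta V' (?F x))
          (Id V'.C (?F (V.D x))) (uni S' (?F (V.D x)))"
        using V'.d_char[OF str[of x]]
        by (subst V'.act_Comp_left[of _ "V'.D (V'.D (?F x))" _ _ "?F x"])
          (auto simp: V'.eta_in V'.d_in[OF str])
      finally show "act S' (vstr F (V.D x) \<cdot>\<^bsub>V'.C\<^esub> ?Fa (veta V x)) (Id V'.C (?F (V.D x)))
          (uni S' (?F (V.D x))) = act S' (fa (vd V') (vstr F x) \<cdot>\<^bsub>V'.C\<^esub> veta V' (?F x))
          (Id V'.C (?F (V.D x))) (uni S' (?F (V.D x)))" .
    qed (use Comp_homset[OF V'.cat Feta str]
        Comp_homset[OF V'.cat V'.eta_in V'.d_in[OF str]] in auto)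
  qed
  have "is_functor V.C (op_cat V'.C) (vd V' \<circ>\<circ> uftr F)" "is_functor V.C (op_cat V'.C) (uftr F \<circ>\<circ> vd V)"
    using is_functor_comp[OF F V'.functor_d]
      is_functor_comp[OF V.functor_d is_functor_op2[OF F]] by auto
  then show ?thesis
    unfolding lax_volutive_functor_def nat_trans_def using F nat eta str by simp
qed

text \<open>When the universal element is pulled back along the composite, \<open>d_char\<close>
  moves \<open>\<xi> x\<close> to the second slot, and what remains is \<open>\<xi>\<close> acting
  in both slots on the image under \<open>U\<close>. By \<open>comp\<close> this is the image under
  \<open>T\<close>, which \<open>vstr F x\<close> classifies.\<close>

lemma represents_map_trans:
  assumes V: "volutive_form V S" and V': "volutive_form V' S'"
    and F: "represents_map V S V' S' F T" and G: "represents_map V S V' S' G U"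
    and nat: "nat_trans (ucat V) (ucat V') (uftr F) (uftr G) \<xi>"
    and comp: "\<And>x y \<phi>. x \<in> Ob (ucat V) \<Longrightarrow> y \<in> Ob (ucat V) \<Longrightarrow> \<phi> \<in> Frm S x y \<Longrightarrow>
      act S' (\<xi> x) (\<xi> y) (U x y \<phi>) = T x y \<phi>"
  shows "lax_volutive_trans V V' F G \<xi>"
proof -
  interpret V: volutive_form V S by (rule V)
  interpret V': volutive_form V' S' by (rule V')
  note Fstr = represents_mapD(4)[OF F] and Gstr = represents_mapD(4)[OF G]
  let ?F = "fo (uftr F)" and ?G = "fo (uftr G)"
  note [simp] = functor_simps(3)[OF represents_mapD(1)[OF F]]
    functor_simps(3)[OF represents_mapD(1)[OF G]]
  have \<xi>: "\<xi> x \<in> homset V'.C (?F x) (?G x)" if "x \<in> Ob V.C" for x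
    using nat that by (simp add: nat_trans_def)
  have "fa (vd V') (\<xi> x) \<cdot>\<^bsub>V'.C\<^esub> vstr G x \<cdot>\<^bsub>V'.C\<^esub> \<xi> (V.D x) = vstr F x" if x [simp]: "x \<in> Ob V.C" for x
  proof (rule V'.uni_inj[of _ "?F (V.D x)" "?F x"])
    have [simp]: "V.D x \<in> Ob V.C" "V'.D (?F x) \<in> Ob V'.C" by (simp_all add: V.d_Ob V'.d_Ob)
    note dGs = Comp_homset[OF V'.cat Gstr[OF x] V'.d_in[OF \<xi>[OF x]]]
    show "fa (vd V') (\<xi> x) \<cdot>\<^bsub>V'.C\<^esub> vstr G x \<cdot>\<^bsub>V'.C\<^esub> \<xi> (V.D x) \<in> homset V'.C (?F (V.D x)) (V'.D (?F x))"
      by (rule Comp_homset[OF V'.cat \<xi> dGs]) simp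
    have "act S' (fa (vd V') (\<xi> x) \<cdot>\<^bsub>V'.C\<^esub> vstr G x \<cdot>\<^bsub>V'.C\<^esub> \<xi> (V.D x)) (Id V'.C (?F x)) (uni S' (?F x)) =
      act S' (\<xi> (V.D x)) (Id V'.C (?F x)) (act S' (vstr G x) (Id V'.C (?F x))
        (act S' (fa (vd V') (\<xi> x)) (Id V'.C (?F x)) (uni S' (?F x))))"
      using V'.act_Comp_left[OF dGs \<xi>[of "V.D x"]]
        V'.act_Comp_left[OF V'.d_in[OF \<xi>[OF x]] Gstr[OF x]] by simp
    also have "\<dots> = act S' (\<xi> (V.D x)) (Id V'.C (?F x)) (act S' (vstr G x) (Id V'.C (?F x))
        (act S' (Id V'.C (V'.D (?G x))) (\<xi> x) (uni S' (?G x))))"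
      using V'.d_char[OF \<xi>[OF x]] by simp
    also have "\<dots> = act S' (\<xi> (V.D x)) (Id V'.C (?F x))
        (act S' (Id V'.C (?G (V.D x))) (\<xi> x) (U (V.D x) x (uni S x)))"
      using V'.act_swap[OF Gstr[OF x] \<xi>[OF x] V'.uni_in] represents_mapD(5)[OF G x] by simp
    also have "\<dots> = act S' (\<xi> (V.D x)) (\<xi> x) (U (V.D x) x (uni S x))"
      using V'.act_swap[OF \<xi>[of "V.D x"] \<xi>[OF x] represents_mapD(2)[OF G]] V.uni_in by simp
    also have "\<dots> = T (V.D x) x (uni S x)"
      by (rule comp) (auto simp: V.uni_in)
    finally show "act S' (fa (vd V') (\<xi> x) \<cdot>\<^bsub>V'.C\<^esub> vstr G x \<cdot>\<^bsub>V'.C\<^esub> \<xi> (V.D x)) (Id V'.C (?F x))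
        (uni S' (?F x)) = act S' (vstr F x) (Id V'.C (?F x)) (uni S' (?F x))"
      using represents_mapD(5)[OF F x] by simp
  qed (use Fstr in auto)
  then show ?thesis
    using nat by (simp add: lax_volutive_trans_def)
qed

lemma nat_trans_inverse:
  assumes nat: "nat_trans C D F G \<xi>" and inv: "\<And>x. x \<in> Ob C \<Longrightarrow> inverses D (\<xi> x) (\<zeta> x)"
  shows "nat_trans C D G F \<zeta>"
proof -
  have F: "is_functor C D F" and G: "is_functor C D G" using nat by (auto simp: nat_trans_def)
  have C: "category C" and D: "category D" using F by (auto simp: is_functor_def)
  have \<xi>: "\<xi> x \<in> homset D (fo F x) (fo G x)" if "x \<in> Ob C" for x
    using nat that by (simp add: nat_trans_def)
  have \<zeta>: "\<zeta> x \<in> homset D (fo G x) (fo F x)" "\<zeta> x \<cdot>\<^bsub>D\<^esub> \<xi> x = Id D (fo F x)"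
    "\<xi> x \<cdot>\<^bsub>D\<^esub> \<zeta> x = Id D (fo G x)" if "x \<in> Ob C" for x
    using inv[OF that] \<xi>[OF that] by (auto simp: inverses_def homset_def)
  have "\<zeta> y \<cdot>\<^bsub>D\<^esub> fa G f = fa F f \<cdot>\<^bsub>D\<^esub> \<zeta> x"
    if xy: "x \<in> Ob C" "y \<in> Ob C" and f: "f \<in> homset C x y" for x y f
  proof -
    note Ff = functor_homset[OF F f] and Gf = functor_homset[OF G f]
    have "\<zeta> y \<cdot>\<^bsub>D\<^esub> fa G f = \<zeta> y \<cdot>\<^bsub>D\<^esub> (fa G f \<cdot>\<^bsub>D\<^esub> (\<xi> x \<cdot>\<^bsub>D\<^esub> \<zeta> x))"
      using \<zeta>(3)[OF xy(1)] Comp_Id[OF D Gf] by simp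
    also have "\<dots> = \<zeta> y \<cdot>\<^bsub>D\<^esub> ((fa G f \<cdot>\<^bsub>D\<^esub> \<xi> x) \<cdot>\<^bsub>D\<^esub> \<zeta> x)"
      by (simp add: Comp_assoc[OF D \<zeta>(1)[OF xy(1)] \<xi>[OF xy(1)] Gf])
    also have "fa G f \<cdot>\<^bsub>D\<^esub> \<xi> x = \<xi> y \<cdot>\<^bsub>D\<^esub> fa F f"
      using nat xy f by (simp add: nat_trans_def)
    also have "\<zeta> y \<cdot>\<^bsub>D\<^esub> (\<xi> y \<cdot>\<^bsub>D\<^esub> fa F f \<cdot>\<^bsub>D\<^esub> \<zeta> x) = (\<zeta> y \<cdot>\<^bsub>D\<^esub> \<xi> y) \<cdot>\<^bsub>D\<^esub> (fa F f \<cdot>\<^bsub>D\<^esub> \<zeta> x)"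
      using Comp_assoc[OF D \<zeta>(1)[OF xy(1)] Ff \<xi>[OF xy(2)]]
        Comp_assoc[OF D Comp_homset[OF D \<zeta>(1)[OF xy(1)] Ff] \<xi>[OF xy(2)] \<zeta>(1)[OF xy(2)]] by simp
    also have "\<dots> = fa F f \<cdot>\<^bsub>D\<^esub> \<zeta> x"
      using \<zeta>(2)[OF xy(2)] Comp_Id(2)[OF D Comp_homset[OF D \<zeta>(1)[OF xy(1)] Ff]] by simp
    finally show ?thesis .
  qed
  then show ?thesis
    using F G \<zeta> by (simp add: nat_trans_def)
qed

text \<open>\<open>comp\<close> passes to the pointwise inverse: letting \<open>\<zeta>\<close> act
  on both sides and composing with \<open>\<xi>\<close> leaves the action of identities. Both
  directions are then instances of \<open>represents_map_trans\<close>.\<close>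

theorem represents_map_iso:
  assumes V: "volutive_form V S" and V': "volutive_form V' S'"
    and F: "represents_map V S V' S' F T" and G: "represents_map V S V' S' G U"
    and nat: "nat_iso (ucat V) (ucat V') (uftr F) (uftr G) \<xi>"
    and comp: "\<And>x y \<phi>. x \<in> Ob (ucat V) \<Longrightarrow> y \<in> Ob (ucat V) \<Longrightarrow> \<phi> \<in> Frm S x y \<Longrightarrow>
      act S' (\<xi> x) (\<xi> y) (U x y \<phi>) = T x y \<phi>"
  shows "lax_volutive_iso V V' F G \<xi>"
proof -
  interpret V: volutive_form V S by (rule V)
  interpret V': volutive_form V' S' by (rule V')
  have nt: "nat_trans V.C V'.C (uftr F) (uftr G) \<xi>" using nat by (simp add: nat_iso_def)
  have "\<forall>x\<in>Ob V.C. \<exists>z. inverses V'.C (\<xi> x) z"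
    using nat by (simp add: nat_iso_def iso_def)
  then obtain \<zeta> where inv: "\<And>x. x \<in> Ob V.C \<Longrightarrow> inverses V'.C (\<xi> x) (\<zeta> x)" by metis
  have \<xi>: "\<xi> x \<in> homset V'.C (fo (uftr F) x) (fo (uftr G) x)" if "x \<in> Ob V.C" for x
    using nt that by (simp add: nat_trans_def)
  have \<zeta>: "\<zeta> x \<in> homset V'.C (fo (uftr G) x) (fo (uftr F) x)"
    "\<xi> x \<cdot>\<^bsub>V'.C\<^esub> \<zeta> x = Id V'.C (fo (uftr G) x)" if "x \<in> Ob V.C" for x
    using inv[OF that] \<xi>[OF that] by (auto simp: inverses_def homset_def)
  note nt' = nat_trans_inverse[OF nt inv]
  have "act S' (\<zeta> x) (\<zeta> y) (T x y \<phi>) = U x y \<phi>"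
    if xy: "x \<in> Ob V.C" "y \<in> Ob V.C" and \<phi>: "\<phi> \<in> Frm S x y" for x y \<phi>
  proof -
    note U = represents_mapD(2)[OF G xy \<phi>]
    have "act S' (\<zeta> x) (\<zeta> y) (T x y \<phi>) = act S' (\<zeta> x) (\<zeta> y) (act S' (\<xi> x) (\<xi> y) (U x y \<phi>))"
      by (simp add: comp xy \<phi>)
    also have "\<dots> = U x y \<phi>"
      using V'.act_Comp[OF \<xi>[OF xy(1)] \<xi>[OF xy(2)] \<zeta>(1)[OF xy(1)] \<zeta>(1)[OF xy(2)] U] \<zeta>(2) xy U
        functor_simps(3)[OF represents_mapD(1)[OF G]]
      by (simp add: V'.act_Id)
    finally show ?thesis .
  qed
  then have "lax_volutive_trans V V' G F \<zeta>"
    by (intro represents_map_trans[OF V V' G F nt'])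
  moreover have "lax_volutive_trans V V' F G \<xi>"
    by (rule represents_map_trans[OF V V' F G nt comp])
  ultimately show ?thesis
    unfolding lax_volutive_iso_def using inv by blast
qed

section \<open>Products, units and composites of forms and of their maps\<close>

definition form_prod :: "('o, 'a, 'p) form \<Rightarrow> ('o2, 'a2, 'p2) form \<Rightarrow>
    ('o \<times> 'o2, 'a \<times> 'a2, 'p \<times> 'p2) form" where
  "form_prod S S' = \<lparr>Frm = (\<lambda>(x, x') (y, y'). Frm S x y \<times> Frm S' x' y'),
     act = (\<lambda>(f, f') (g, g') (\<phi>, \<phi>'). (act S f g \<phi>, act S' f' g' \<phi>')),
     flip = (\<lambda>(x, x') (y, y') (\<phi>, \<phi>'). (flip S x y \<phi>, flip S' x' y' \<phi>')),
     uni = map_prod (uni S) (uni S')\<rparr>"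

definition form_unit :: "(unit, unit, unit) form" where
  "form_unit = \<lparr>Frm = (\<lambda>_ _. {()}), act = (\<lambda>_ _ _. ()), flip = (\<lambda>_ _ _. ()), uni = (\<lambda>_. ())\<rparr>"

lemma form_prod_simps [simp]:
  "Frm (form_prod S S') (x, x') (y, y') = Frm S x y \<times> Frm S' x' y'"
  "act (form_prod S S') (f, f') (g, g') (\<phi>, \<phi>') = (act S f g \<phi>, act S' f' g' \<phi>')"
  "flip (form_prod S S') (x, x') (y, y') (\<phi>, \<phi>') = (flip S x y \<phi>, flip S' x' y' \<phi>')"
  "uni (form_prod S S') (x, x') = (uni S x, uni S' x')"
  by (simp_all add: form_prod_def)

lemma vprod_simps [simp]:
  "ucat (vprod V V') = prod_cat (ucat V) (ucat V')"
  "vd (vprod V V') = ftr_prod (vd V) (vd V')"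
  "veta (vprod V V') (x, y) = (veta V x, veta V' y)"
  by (simp_all add: vprod_def)

lemma vunit_simps [simp]:
  "ucat vunit = unit_cat" "vd vunit = ftr_id" "veta vunit x = ()"
  by (simp_all add: vunit_def)

lemma form_unit_simps [simp]:
  "Frm form_unit x y = {()}"
  by (simp_all add: form_unit_def)

lemma volutive_form_prod:
  assumes "volutive_form V S" "volutive_form V' S'"
  shows "volutive_form (vprod V V') (form_prod S S')"
proof -
  interpret V: volutive_form V S by (rule assms)
  interpret V': volutive_form V' S' by (rule assms)
  show ?thesis
    by unfold_locales
      (clarsimp simp: category_prod V.cat V'.cat V.act_Id V'.act_Id V.flip_flip V'.flip_flip
        V.cat_simps V'.cat_simps V.eta_char V'.eta_char V.d_char V'.d_char;
        fastforce intro: V.act_in V'.act_in V.act_Comp V'.act_Comp V.flip_act V'.flip_act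
          V.uni_inj V'.uni_inj)+
qed

lemma volutive_form_unit: "volutive_form vunit form_unit"
  by unfold_locales (simp_all add: category_unit)

text \<open>The composite structure arrow acts in two stages: \<open>vstr G\<close> turns the
  universal element into a value of \<open>U\<close>, and naturality of \<open>U\<close> moves the
  pullback along \<open>vstr F x\<close> inside, where it produces \<open>T\<close>.\<close>

lemma represents_map_comp:
  assumes V': "volutive_form V' S'" and V'': "volutive_form V'' S''"
    and V: "volutive_form V S"
    and F: "represents_map V S V' S' F T" and G: "represents_map V' S' V'' S'' G U"
  shows "represents_map V S V'' S'' (vf_comp V'' G F)
    (\<lambda>x y \<phi>. U (fo (uftr F) x) (fo (uftr F) y) (T x y \<phi>))"
proof -
  interpret V: volutive_form V S by (rule V)
  interpret V': volutive_form V' S' by (rule V')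
  interpret V'': volutive_form V'' S'' by (rule V'')
  note F1 = represents_mapD(1)[OF F] and G1 = represents_mapD(1)[OF G]
  note [simp] = functor_simps(3)[OF F1] functor_simps(3)[OF G1]
  have "act S'' (vstr G (fo (uftr F) x) \<cdot>\<^bsub>V''.C\<^esub> fa (uftr G) (vstr F x))
      (Id V''.C (fo (uftr G) (fo (uftr F) x))) (uni S'' (fo (uftr G) (fo (uftr F) x))) =
    U (fo (uftr F) (V.D x)) (fo (uftr F) x) (T (V.D x) x (uni S x))"
    (is "?l = _") if x [simp]: "x \<in> Ob V.C" for x
  proof -
    note Fs = represents_mapD(4)[OF F x] and Gs = represents_mapD(4)[OF G, of "fo (uftr F) x"]
    have "?l = act S'' (fa (uftr G) (vstr F x)) (fa (uftr G) (Id V'.C (fo (uftr F) x)))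
        (U (V'.D (fo (uftr F) x)) (fo (uftr F) x) (uni S' (fo (uftr F) x)))"
      using functor_homset[OF G1 Fs] Gs represents_mapD(5)[OF G, of "fo (uftr F) x"]
        functor_simps(4)[OF G1, of "fo (uftr F) x"]
      by (subst V''.act_Comp_left) simp_all
    also have "\<dots> = U (fo (uftr F) (V.D x)) (fo (uftr F) x)
        (act S' (vstr F x) (Id V'.C (fo (uftr F) x)) (uni S' (fo (uftr F) x)))"
      by (rule represents_mapD(3)[OF G, symmetric])
        (use Fs in \<open>auto simp: V'.uni_in Id_homset[OF V'.cat]\<close>)
    finally show ?thesis
      using represents_mapD(5)[OF F x] by simp
  qed
  moreover have "vstr G (fo (uftr F) x) \<cdot>\<^bsub>V''.C\<^esub> fa (uftr G) (vstr F x) \<in>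
     homset V''.C (fo (uftr G) (fo (uftr F) (V.D x))) (V''.D (fo (uftr G) (fo (uftr F) x)))"
    if x [simp]: "x \<in> Ob V.C" for x
    using Comp_homset[OF V''.cat functor_homset[OF G1 represents_mapD(4)[OF F x]]
        represents_mapD(4)[OF G, of "fo (uftr F) x"]] by simp
  moreover have "U (fo (uftr F) x') (fo (uftr F) y') (T x' y' (act S f g \<phi>)) =
      act S'' (fa (uftr G) (fa (uftr F) f)) (fa (uftr G) (fa (uftr F) g))
       (U (fo (uftr F) x) (fo (uftr F) y) (T x y \<phi>))"
    if f: "f \<in> homset V.C x' x" and g: "g \<in> homset V.C y' y" and \<phi>: "\<phi> \<in> Frm S x y"
    for f g x x' y y' \<phi>
    using represents_mapD(3)[OF F f g \<phi>] homset_Ob[OF V.cat f] homset_Ob[OF V.cat g]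
      represents_mapD(3)[OF G functor_homset[OF F1 f] functor_homset[OF F1 g]
        represents_mapD(2)[OF F _ _ \<phi>]] by simp
  ultimately show ?thesis
    unfolding represents_map_def vf_comp_def
    using is_functor_comp[OF F1 G1] represents_mapD(2)[OF F] represents_mapD(2)[OF G] by simp
qed

lemma represents_map_prod:
  assumes F: "represents_map V S V' S' F T" and F2: "represents_map V2 S2 V2' S2' F2 T2"
  shows "represents_map (vprod V V2) (form_prod S S2) (vprod V' V2') (form_prod S' S2')
    (vf_prod F F2) (\<lambda>(x, x2) (y, y2). map_prod (T x y) (T2 x2 y2))"
  unfolding represents_map_def vf_prod_def
  using is_functor_prod[OF represents_mapD(1)[OF F] represents_mapD(1)[OF F2]]
    represents_mapD(2-5)[OF F] represents_mapD(2-5)[OF F2]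
  by auto

text \<open>For functors that only regroup tuples, dualities and universal elements correspond on
  the nose, so identity arrows represent the map. This covers identities, the reassociation of a
  product and the insertion of the unit category.\<close>

lemma represents_map_strict:
  assumes "volutive_form V' S'" "is_functor (ucat V) (ucat V') F"
    and "\<And>x y \<phi>. x \<in> Ob (ucat V) \<Longrightarrow> y \<in> Ob (ucat V) \<Longrightarrow> \<phi> \<in> Frm S x y \<Longrightarrow>
      T \<phi> \<in> Frm S' (fo F x) (fo F y)"
    and "\<And>f g \<phi>. T (act S f g \<phi>) = act S' (fa F f) (fa F g) (T \<phi>)"
    and "\<And>x. x \<in> Ob (ucat V) \<Longrightarrow> fo (vd V') (fo F x) = fo F (fo (vd V) x)"
    and "\<And>x. x \<in> Ob (ucat V) \<Longrightarrow> uni S' (fo F x) = T (uni S x)"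
  shows "represents_map V S V' S' (vstrict V V' F) (\<lambda>x y. T)"
proof -
  interpret V': volutive_form V' S' by (rule assms)
  note [simp] = functor_simps(3)[OF assms(2)]
  have "fo F (fo (vd V) x) \<in> Ob V'.C" if "x \<in> Ob (ucat V)" for x
    using assms(5)[OF that] V'.d_Ob[of "fo F x"] that by auto
  moreover have "T (uni S x) \<in> Frm S' (fo F (fo (vd V) x)) (fo F x)" if "x \<in> Ob (ucat V)" for x
    using assms(5)[OF that] assms(6)[OF that] V'.uni_in[of "fo F x"] that by auto
  ultimately show ?thesis
    unfolding represents_map_def vstrict_def
    using assms V'.act_Id by (simp add: Id_homset[OF V'.cat])
qed

lemma represents_map_id:
  assumes "volutive_form V S"
  shows "represents_map V S V S (vf_id V) (\<lambda>x y \<phi>. \<phi>)"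
  unfolding vf_id_def
  by (rule represents_map_strict[OF assms is_functor_id])
    (use volutive_form.cat[OF assms] in auto)

section \<open>Calculus in a bicategory\<close>

lemma cellsD:
  assumes "f \<in> cells B X Y" shows "f \<in> Cell B" "dm B f = X" "cd B f = Y"
  using assms by (auto simp: cells_def)

lemma cellsI: "f \<in> Cell B \<Longrightarrow> dm B f = X \<Longrightarrow> cd B f = Y \<Longrightarrow> f \<in> cells B X Y"
  by (simp add: cells_def)

lemma hom_simps [simp]:
  "Dom (hom B a b) = dm B" "Cod (hom B a b) = cd B" "Id (hom B a b) = idt B"
  "Comp (hom B a b) = vc B"
  "X \<in> Ob (hom B a b) \<longleftrightarrow> X \<in> Mor B \<and> src B X = a \<and> trg B X = b"
  "f \<in> Arr (hom B a b) \<longleftrightarrow> f \<in> Cell B \<and> src B (dm B f) = a \<and> trg B (dm B f) = b"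
  "f \<in> homset (hom B a b) X Y \<longleftrightarrow> f \<in> cells B X Y \<and> src B X = a \<and> trg B X = b"
  by (auto simp: hom_def homset_def cells_def)

locale bicat =
  fixes B :: "('o, 'm, 'c) bicat" (structure)
  assumes bicategory: "bicategory B"
begin

lemma src_trg_Obj [simp]: "X \<in> Mor B \<Longrightarrow> src B X \<in> Obj B" "X \<in> Mor B \<Longrightarrow> trg B X \<in> Obj B"
  using bicategory unfolding bicategory_def by blast+

lemma Cell_simps [simp]:
  assumes "f \<in> Cell B"
  shows "dm B f \<in> Mor B" "cd B f \<in> Mor B" "src B (cd B f) = src B (dm B f)"
    "trg B (cd B f) = trg B (dm B f)"
  using bicategory assms unfolding bicategory_def by metis+

lemma category_hom: "a \<in> Obj B \<Longrightarrow> b \<in> Obj B \<Longrightarrow> category (hom B a b)"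
  using bicategory unfolding bicategory_def by blast

lemma functor_hcomp: "a \<in> Obj B \<Longrightarrow> b \<in> Obj B \<Longrightarrow> c \<in> Obj B \<Longrightarrow>
    is_functor (prod_cat (hom B b c) (hom B a b)) (hom B a c) (hcomp B)"
  using bicategory unfolding bicategory_def by blast

lemma one_simps [simp]:
  assumes "a \<in> Obj B" shows "one B a \<in> Mor B" "src B (one B a) = a" "trg B (one B a) = a"
  using bicategory assms unfolding bicategory_def by simp_all

lemma idt_simps [simp]:
  assumes "X \<in> Mor B" shows "idt B X \<in> Cell B" "dm B (idt B X) = X" "cd B (idt B X) = X"
  using Id_homset[OF category_hom, of "src B X" "trg B X" X] assms by (auto dest: cellsD)

lemma vc_simps [simp]:
  assumes "f \<in> Cell B" "g \<in> Cell B" "dm B g = cd B f"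
  shows "g \<bullet> f \<in> Cell B" "dm B (g \<bullet> f) = dm B f" "cd B (g \<bullet> f) = cd B g"
  using Comp_homset[OF category_hom, of "src B (dm B f)" "trg B (dm B f)" f "dm B f" "cd B f" g "cd B g"]
    assms by (auto dest: cellsD intro: cellsI)

lemma vc_idt [simp]:
  assumes "f \<in> Cell B" shows "dm B f = X \<Longrightarrow> f \<bullet> idt B X = f" "cd B f = X \<Longrightarrow> idt B X \<bullet> f = f"
proof -
  have "f \<bullet> idt B (dm B f) = f" "idt B (cd B f) \<bullet> f = f"
    using Comp_Id[OF category_hom, of "src B (dm B f)" "trg B (dm B f)" f "dm B f" "cd B f"]
      assms by (simp_all add: cellsI)
  then show "dm B f = X \<Longrightarrow> f \<bullet> idt B X = f" "cd B f = X \<Longrightarrow> idt B X \<bullet> f = f" by auto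
qed

lemma vc_assoc [simp]:
  assumes "f \<in> Cell B" "g \<in> Cell B" "h \<in> Cell B" "dm B g = cd B f" "dm B h = cd B g"
  shows "(h \<bullet> g) \<bullet> f = h \<bullet> (g \<bullet> f)"
  using Comp_assoc[OF category_hom, of "src B (dm B f)" "trg B (dm B f)" f "dm B f" "cd B f" g
      "cd B g" h "cd B h"] assms by (simp add: cellsI)

text \<open>Composites are kept nested to the right, so a rule for two adjacent cells must also be
  available with a tail \<open>h\<close> behind it; this lemma derives the second version from the
  first.\<close>

lemma vc_ext:
  assumes "g \<bullet> f = k" "f \<in> Cell B" "g \<in> Cell B" "h \<in> Cell B" "dm B g = cd B f" "dm B f = cd B h"
  shows "g \<bullet> (f \<bullet> h) = k \<bullet> h"
  using vc_assoc[of h f g] assms by simp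

lemma h1_simps [simp]:
  assumes "X \<in> Mor B" "Y \<in> Mor B" "src B Y = trg B X"
  shows "Y \<odot> X \<in> Mor B" "src B (Y \<odot> X) = src B X" "trg B (Y \<odot> X) = trg B Y"
  using functor_simps(3)[OF functor_hcomp, of "src B X" "trg B X" "trg B Y" "(Y, X)"] assms
  by (simp_all add: hcomp_def)

lemma h2_simps [simp]:
  assumes "f \<in> Cell B" "g \<in> Cell B" "src B (dm B g) = trg B (dm B f)"
  shows "g \<star> f \<in> Cell B" "dm B (g \<star> f) = dm B g \<odot> dm B f" "cd B (g \<star> f) = cd B g \<odot> cd B f"
  using functor_homset[OF functor_hcomp, of "src B (dm B f)" "trg B (dm B f)" "trg B (dm B g)"
      "(g, f)" "(dm B g, dm B f)" "(cd B g, cd B f)"] assms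
  by (auto simp: hcomp_def dest: cellsD intro: cellsI)

lemma h2_idt [simp]:
  assumes "X \<in> Mor B" "Y \<in> Mor B" "src B Y = trg B X"
  shows "idt B Y \<star> idt B X = idt B (Y \<odot> X)"
  using functor_simps(4)[OF functor_hcomp, of "src B X" "trg B X" "trg B Y" "(Y, X)"] assms
  by (simp add: hcomp_def)

lemma interchange:
  assumes "f \<in> Cell B" "g \<in> Cell B" "f' \<in> Cell B" "g' \<in> Cell B"
    "src B (dm B g) = trg B (dm B f)" "dm B f' = cd B f" "dm B g' = cd B g"
  shows "(g' \<star> f') \<bullet> (g \<star> f) = (g' \<bullet> g) \<star> (f' \<bullet> f)"
  using functor_Comp[OF functor_hcomp, of "src B (dm B f)" "trg B (dm B f)" "trg B (dm B g)"
      "(g, f)" "(dm B g, dm B f)" "(cd B g, cd B f)" "(g', f')" "(cd B g', cd B f')"] assms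
  by (simp add: hcomp_def cellsI)

lemma interchange_ext:
  assumes "f \<in> Cell B" "g \<in> Cell B" "f' \<in> Cell B" "g' \<in> Cell B"
    "src B (dm B g) = trg B (dm B f)" "dm B f' = cd B f" "dm B g' = cd B g"
    "h \<in> Cell B" "cd B h = dm B g \<odot> dm B f"
  shows "(g' \<star> f') \<bullet> ((g \<star> f) \<bullet> h) = ((g' \<bullet> g) \<star> (f' \<bullet> f)) \<bullet> h"
  by (rule vc_ext[OF interchange]) (use assms in simp_all)

lemmas xchg = interchange interchange_ext

lemma whisker_vc:
  assumes "f \<in> Cell B" "g \<in> Cell B" "dm B g = cd B f" "X \<in> Mor B"
  shows "src B X = trg B (dm B f) \<Longrightarrow> idt B X \<star> (g \<bullet> f) = (idt B X \<star> g) \<bullet> (idt B X \<star> f)"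
    "src B (dm B f) = trg B X \<Longrightarrow> (g \<bullet> f) \<star> idt B X = (g \<star> idt B X) \<bullet> (f \<star> idt B X)"
  using assms by (simp_all add: interchange)

section \<open>Invertible 2-morphisms and cancellation\<close>

definition iso2 :: "'c \<Rightarrow> bool" where
  "iso2 f \<longleftrightarrow> f \<in> Cell B \<and> iso (hom B (src B (dm B f)) (trg B (dm B f))) f"

lemma iso2_Cell: "iso2 f \<Longrightarrow> f \<in> Cell B"
  by (simp add: iso2_def)

lemma iso2I: "iso (hom B a b) f \<Longrightarrow> iso2 f"
  by (auto simp: iso2_def iso_def inverses_def)

lemma inverses_unique:
  assumes g: "inverses (hom B a b) f g" and h: "inverses (hom B a b) f h"
  shows "g = h"
proof -
  have *: "f \<in> Cell B" "g \<in> Cell B" "h \<in> Cell B" "dm B g = cd B f" "cd B g = dm B f"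
    "dm B h = cd B f" "cd B h = dm B f" "h \<bullet> f = idt B (dm B f)" "f \<bullet> g = idt B (cd B f)"
    using g h by (auto simp: inverses_def dest: cellsD)
  have "g = (h \<bullet> f) \<bullet> g" using * by (simp del: vc_assoc)
  also have "\<dots> = h" using *(1-7,9) by simp
  finally show ?thesis .
qed

lemma inverses_inv2:
  assumes "iso2 f"
  shows "inverses (hom B (src B (dm B f)) (trg B (dm B f))) f (inv2 B f)"
proof -
  obtain g where "inverses (hom B (src B (dm B f)) (trg B (dm B f))) f g"
    using assms by (auto simp: iso2_def iso_def)
  then show ?thesis
    unfolding inv2_def inv_arr_def using theI[of "inverses _ f" g] inverses_unique by metis
qed

lemma inv2_simps [simp]:
  assumes "iso2 f"
  shows "inv2 B f \<in> Cell B" "dm B (inv2 B f) = cd B f" "cd B (inv2 B f) = dm B f"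
    "inv2 B f \<bullet> f = idt B (dm B f)" "f \<bullet> inv2 B f = idt B (cd B f)"
  using inverses_inv2[OF assms] by (auto simp: inverses_def dest: cellsD)

lemma inv2_cancel [simp]:
  assumes "iso2 f" "g \<in> Cell B"
  shows "cd B g = dm B f \<Longrightarrow> inv2 B f \<bullet> (f \<bullet> g) = g" "cd B g = cd B f \<Longrightarrow> f \<bullet> (inv2 B f \<bullet> g) = g"
proof -
  note [simp] = iso2_Cell[OF assms(1)] assms(2)
  show "inv2 B f \<bullet> (f \<bullet> g) = g" if "cd B g = dm B f"
    using vc_ext[OF inv2_simps(4)[OF assms(1)], of g] that assms(1) by simp
  show "f \<bullet> (inv2 B f \<bullet> g) = g" if "cd B g = cd B f"
    using vc_ext[OF inv2_simps(5)[OF assms(1)], of g] that assms(1) by simp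
qed

lemma iso2_inverse:
  assumes "f \<in> Cell B" "g \<in> Cell B" "dm B g = cd B f" "cd B g = dm B f"
    "g \<bullet> f = idt B (dm B f)" "f \<bullet> g = idt B (cd B f)"
  shows "iso2 f" "inv2 B f = g"
proof -
  have *: "inverses (hom B (src B (dm B f)) (trg B (dm B f))) f g"
    using assms by (simp add: inverses_def cellsI)
  show "iso2 f" unfolding iso2_def iso_def using assms(1) * by blast
  then show "inv2 B f = g"
    by (rule inverses_unique[OF inverses_inv2 *])
qed

lemma iso2_idt: "X \<in> Mor B \<Longrightarrow> iso2 (idt B X)"
  by (rule iso2_inverse(1)[of _ "idt B X"]) simp_all

lemma iso2_h2:
  assumes "iso2 f" "iso2 g" "src B (dm B g) = trg B (dm B f)"
  shows "iso2 (g \<star> f)" "inv2 B (g \<star> f) = inv2 B g \<star> inv2 B f"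
  using assms iso2_inverse[of "g \<star> f" "inv2 B g \<star> inv2 B f"]
  by (simp_all add: iso2_Cell interchange)

lemma iso2_vc:
  assumes "iso2 f" "iso2 g" "dm B g = cd B f"
  shows "iso2 (g \<bullet> f)" "inv2 B (g \<bullet> f) = inv2 B f \<bullet> inv2 B g"
  using assms iso2_inverse[of "g \<bullet> f" "inv2 B f \<bullet> inv2 B g"] by (simp_all add: iso2_Cell)

lemma iso2_inv2:
  assumes "iso2 f" shows "iso2 (inv2 B f)" "inv2 B (inv2 B f) = f"
  using assms iso2_inverse[of "inv2 B f" f] by (simp_all add: iso2_Cell)

lemma iso2_epi:
  assumes "g \<bullet> f = h \<bullet> f" "iso2 f" "g \<in> Cell B" "h \<in> Cell B" "dm B g = cd B f" "dm B h = cd B f"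
  shows "g = h"
proof -
  have "g = (g \<bullet> f) \<bullet> inv2 B f" using assms(2-) by (simp add: iso2_Cell)
  also have "\<dots> = h" unfolding assms(1) using assms(2-) by (simp add: iso2_Cell)
  finally show ?thesis .
qed

lemma iso2_mono:
  assumes "f \<bullet> g = f \<bullet> h" "iso2 f" "g \<in> Cell B" "h \<in> Cell B" "dm B f = cd B g" "dm B f = cd B h"
  shows "g = h"
proof -
  have "g = inv2 B f \<bullet> (f \<bullet> g)" using assms(2-) by simp
  also have "\<dots> = h" unfolding assms(1) using assms(2-) by simp
  finally show ?thesis .
qed

section \<open>Associators, unitors and the unit laws that follow from the axioms\<close>

lemma nat_iso_asc:
  "a \<in> Obj B \<Longrightarrow> b \<in> Obj B \<Longrightarrow> c \<in> Obj B \<Longrightarrow> e \<in> Obj B \<Longrightarrow>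
    nat_iso (prod_cat (prod_cat (hom B c e) (hom B b c)) (hom B a b)) (hom B a e)
          (hcomp B \<circ>\<circ> ftr_prod (hcomp B) ftr_id)
          (hcomp B \<circ>\<circ> ftr_prod ftr_id (hcomp B) \<circ>\<circ> prod_assoc)
          (\<lambda>((W, Y), X). asc B W Y X)"
  using bicategory unfolding bicategory_def by blast

lemma nat_iso_lu_ru:
  assumes "a \<in> Obj B" "b \<in> Obj B"
  shows "nat_iso (hom B a b) (hom B a b) (postcomp B (one B b)) ftr_id (lu B)"
    "nat_iso (hom B a b) (hom B a b) (precomp B (one B a)) ftr_id (ru B)"
  using bicategory assms unfolding bicategory_def by blast+

lemma asc_simps [simp]:
  assumes "W \<in> Mor B" "Y \<in> Mor B" "X \<in> Mor B" "src B W = trg B Y" "src B Y = trg B X"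
  shows "asc B W Y X \<in> Cell B" "dm B (asc B W Y X) = (W \<odot> Y) \<odot> X"
    "cd B (asc B W Y X) = W \<odot> (Y \<odot> X)" "iso2 (asc B W Y X)"
proof -
  have "asc B W Y X \<in> cells B ((W \<odot> Y) \<odot> X) (W \<odot> (Y \<odot> X))"
    and *: "iso (hom B (src B X) (trg B W)) (asc B W Y X)"
    using nat_iso_asc[of "src B X" "trg B X" "trg B Y" "trg B W"] assms
    unfolding nat_iso_def nat_trans_def by (auto simp: hcomp_def prod_assoc_def)
  then show "asc B W Y X \<in> Cell B" "dm B (asc B W Y X) = (W \<odot> Y) \<odot> X"
    "cd B (asc B W Y X) = W \<odot> (Y \<odot> X)" by (auto dest: cellsD)
  show "iso2 (asc B W Y X)" by (rule iso2I[OF *])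
qed

lemma asc_nat:
  assumes "f \<in> Cell B" "g \<in> Cell B" "h \<in> Cell B"
    "src B (dm B h) = trg B (dm B g)" "src B (dm B g) = trg B (dm B f)"
    "cd B h = W" "cd B g = Y" "cd B f = X"
  shows "asc B W Y X \<bullet> ((h \<star> g) \<star> f) = (h \<star> (g \<star> f)) \<bullet> asc B (dm B h) (dm B g) (dm B f)"
proof -
  have "\<forall>k\<in>homset (prod_cat (prod_cat (hom B (trg B (dm B g)) (trg B (dm B h)))
      (hom B (trg B (dm B f)) (trg B (dm B g)))) (hom B (src B (dm B f)) (trg B (dm B f))))
      ((dm B h, dm B g), dm B f) ((cd B h, cd B g), cd B f).
      (\<lambda>((W, Y), X). asc B W Y X) ((cd B h, cd B g), cd B f)
        \<bullet> fa (hcomp B \<circ>\<circ> ftr_prod (hcomp B) ftr_id) k =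
      fa (hcomp B \<circ>\<circ> ftr_prod ftr_id (hcomp B) \<circ>\<circ> prod_assoc) k
        \<bullet> (\<lambda>((W, Y), X). asc B W Y X) ((dm B h, dm B g), dm B f)"
    using nat_iso_asc[of "src B (dm B f)" "trg B (dm B f)" "trg B (dm B g)" "trg B (dm B h)"] assms(1-5)
    unfolding nat_iso_def nat_trans_def by simp
  then show ?thesis
    using assms by (auto simp: hcomp_def prod_assoc_def cellsI)
qed

lemma lu_simps [simp]:
  assumes "X \<in> Mor B"
  shows "lu B X \<in> Cell B" "dm B (lu B X) = one B (trg B X) \<odot> X" "cd B (lu B X) = X" "iso2 (lu B X)"
    "ru B X \<in> Cell B" "dm B (ru B X) = X \<odot> one B (src B X)" "cd B (ru B X) = X" "iso2 (ru B X)"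
proof -
  have *: "lu B X \<in> cells B (one B (trg B X) \<odot> X) X" "iso (hom B (src B X) (trg B X)) (lu B X)"
    "ru B X \<in> cells B (X \<odot> one B (src B X)) X" "iso (hom B (src B X) (trg B X)) (ru B X)"
    using nat_iso_lu_ru[of "src B X" "trg B X"] assms
    unfolding nat_iso_def nat_trans_def by (auto simp: postcomp_def precomp_def)
  show "lu B X \<in> Cell B" "dm B (lu B X) = one B (trg B X) \<odot> X" "cd B (lu B X) = X"
    "ru B X \<in> Cell B" "dm B (ru B X) = X \<odot> one B (src B X)" "cd B (ru B X) = X"
    using *(1,3) by (auto dest: cellsD)
  show "iso2 (lu B X)" "iso2 (ru B X)" using *(2,4) by (auto intro: iso2I)
qed

lemma lu_nat:
  assumes "f \<in> Cell B" "cd B f = X"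
  shows "trg B (dm B f) = b \<Longrightarrow> lu B X \<bullet> (idt B (one B b) \<star> f) = f \<bullet> lu B (dm B f)"
    "src B (dm B f) = a \<Longrightarrow> ru B X \<bullet> (f \<star> idt B (one B a)) = f \<bullet> ru B (dm B f)"
  using nat_iso_lu_ru[of "src B (dm B f)" "trg B (dm B f)"] assms
  unfolding nat_iso_def nat_trans_def by (auto simp: cellsI postcomp_def precomp_def)

lemma pentagon:
  assumes "V \<in> Mor B" "W \<in> Mor B" "X \<in> Mor B" "Y \<in> Mor B"
    "src B V = trg B W" "src B W = trg B X" "src B X = trg B Y"
  shows "asc B V W (X \<odot> Y) \<bullet> asc B (V \<odot> W) X Y =
    (idt B V \<star> asc B W X Y) \<bullet> (asc B V (W \<odot> X) Y \<bullet> (asc B V W X \<star> idt B Y))"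
proof -
  have "asc B V W (X \<odot> Y) \<bullet> asc B (V \<odot> W) X Y =
    (idt B V \<star> asc B W X Y) \<bullet> asc B V (W \<odot> X) Y \<bullet> (asc B V W X \<star> idt B Y)"
    using bicategory assms unfolding bicategory_def by blast
  then show ?thesis using assms by simp
qed

lemma triangle:
  assumes "X \<in> Mor B" "Y \<in> Mor B" "src B Y = trg B X" "trg B X = b"
  shows "(idt B Y \<star> lu B X) \<bullet> asc B Y (one B b) X = ru B Y \<star> idt B X"
  using bicategory assms unfolding bicategory_def by blast

lemma inv_asc_nat:
  assumes "f \<in> Cell B" "g \<in> Cell B" "h \<in> Cell B"
    "src B (dm B h) = trg B (dm B g)" "src B (dm B g) = trg B (dm B f)"
    "cd B h = W" "cd B g = Y" "cd B f = X"
  shows "inv2 B (asc B W Y X) \<bullet> (h \<star> (g \<star> f)) =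
    ((h \<star> g) \<star> f) \<bullet> inv2 B (asc B (dm B h) (dm B g) (dm B f))"
proof (rule iso2_mono[of "asc B W Y X"])
  show "asc B W Y X \<bullet> (inv2 B (asc B W Y X) \<bullet> (h \<star> (g \<star> f))) =
    asc B W Y X \<bullet> (((h \<star> g) \<star> f) \<bullet> inv2 B (asc B (dm B h) (dm B g) (dm B f)))"
    using assms vc_ext[OF asc_nat[OF assms], of "inv2 B (asc B (dm B h) (dm B g) (dm B f))"]
    by auto
qed (use assms in auto)

text \<open>Naturality of the unitors makes whiskering with a unit isomorphic to the identity
  functor, and an invertible unitor can be cancelled on the right.\<close>

lemma one_faithful:
  assumes fg: "f \<in> Cell B" "g \<in> Cell B" "dm B g = dm B f" "cd B g = cd B f"
  shows "idt B (one B (trg B (dm B f))) \<star> f = idt B (one B (trg B (dm B f))) \<star> g \<Longrightarrow> f = g"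
    "f \<star> idt B (one B (src B (dm B f))) = g \<star> idt B (one B (src B (dm B f))) \<Longrightarrow> f = g"
proof -
  have g: "src B (dm B g) = src B (dm B f)" "trg B (dm B g) = trg B (dm B f)" using fg by simp_all
  show "f = g" if eq: "idt B (one B (trg B (dm B f))) \<star> f = idt B (one B (trg B (dm B f))) \<star> g"
  proof (rule iso2_epi)
    show "f \<bullet> lu B (dm B f) = g \<bullet> lu B (dm B f)"
      using lu_nat(1)[OF fg(1) refl refl] lu_nat(1)[OF fg(2) refl g(2)] eq fg(3,4) by metis
  qed (use fg in auto)
  show "f = g" if eq: "f \<star> idt B (one B (src B (dm B f))) = g \<star> idt B (one B (src B (dm B f)))"
  proof (rule iso2_epi)
    show "f \<bullet> ru B (dm B f) = g \<bullet> ru B (dm B f)"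
      using lu_nat(2)[OF fg(1) refl refl] lu_nat(2)[OF fg(2) refl g(1)] eq fg(3,4) by metis
  qed (use fg in auto)
qed

text \<open>Kelly's argument: after whiskering with a unit, which is faithful, the remaining unitor laws
  reduce to the pentagon and the triangle.\<close>

lemma lu_h1:
  assumes [simp]: "X \<in> Mor B" "Y \<in> Mor B" "src B Y = trg B X" "trg B Y = c"
  shows "lu B (Y \<odot> X) \<bullet> asc B (one B c) Y X = lu B Y \<star> idt B X"
proof -
  have [simp]: "c \<in> Obj B" using src_trg_Obj(2)[of Y] assms by simp
  let ?I = "one B c"
  \<comment> \<open>Whiskered by \<open>?I\<close> and precomposed with two invertible cells, the
    left side contains one path of the pentagon for \<open>?I\<close>, \<open>?I\<close>,
    \<open>Y\<close>, \<open>X\<close>; on the other path the triangle replaces \<open>lu\<close> by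
    \<open>ru\<close>.\<close>
  have "(idt B ?I \<star> (lu B (Y \<odot> X) \<bullet> asc B ?I Y X)) \<bullet> (asc B ?I (?I \<odot> Y) X \<bullet> (asc B ?I ?I Y \<star> idt B X))
    = (idt B ?I \<star> lu B (Y \<odot> X)) \<bullet> (asc B ?I ?I (Y \<odot> X) \<bullet> asc B (?I \<odot> ?I) Y X)"
    by (simp add: pentagon whisker_vc)
  also have "\<dots> = (ru B ?I \<star> (idt B Y \<star> idt B X)) \<bullet> asc B (?I \<odot> ?I) Y X"
    using vc_ext[OF triangle[of "Y \<odot> X" ?I c]] by simp
  also have "\<dots> = asc B ?I Y X \<bullet> (((idt B ?I \<star> lu B Y) \<bullet> asc B ?I ?I Y) \<star> idt B X)"
    using asc_nat[of "idt B X" "idt B Y" "ru B ?I" ?I Y X] triangle[of Y ?I c] by simp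
  also have "\<dots> = (asc B ?I Y X \<bullet> ((idt B ?I \<star> lu B Y) \<star> idt B X)) \<bullet> (asc B ?I ?I Y \<star> idt B X)"
    by (simp add: whisker_vc)
  also have "\<dots> = (idt B ?I \<star> (lu B Y \<star> idt B X)) \<bullet> (asc B ?I (?I \<odot> Y) X \<bullet> (asc B ?I ?I Y \<star> idt B X))"
    using asc_nat[of "idt B X" "lu B Y" "idt B ?I" ?I Y X] by simp
  finally have "idt B ?I \<star> (lu B (Y \<odot> X) \<bullet> asc B ?I Y X) = idt B ?I \<star> (lu B Y \<star> idt B X)"
    by (rule iso2_epi) (simp_all add: iso2_vc iso2_h2 iso2_idt)
  then show ?thesis
    using one_faithful(1)[of "lu B (Y \<odot> X) \<bullet> asc B ?I Y X" "lu B Y \<star> idt B X"] by simp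
qed

text \<open>Naturality of \<open>lu\<close> at the cell \<open>lu B ?I\<close> itself identifies
  \<open>idt B ?I \<star> lu B ?I\<close> with the unitor of \<open>?I \<odot> ?I\<close>;
  \<open>lu_h1\<close> and the triangle then describe \<open>lu \<star> idt\<close> and
  \<open>ru \<star> idt\<close> by the same composite.\<close>

lemma lu_ru_one:
  assumes [simp]: "a \<in> Obj B"
  shows "lu B (one B a) = ru B (one B a)"
proof -
  let ?I = "one B a"
  have "lu B ?I \<bullet> (idt B ?I \<star> lu B ?I) = lu B ?I \<bullet> lu B (?I \<odot> ?I)"
    using lu_nat(1)[of "lu B ?I" ?I a] by simp
  then have "idt B ?I \<star> lu B ?I = lu B (?I \<odot> ?I)"
    by (rule iso2_mono) simp_all
  then have "lu B ?I \<star> idt B ?I = ru B ?I \<star> idt B ?I"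
    using lu_h1[of ?I ?I a] triangle[of ?I ?I a] by simp
  then show ?thesis
    using one_faithful(2)[of "lu B ?I" "ru B ?I"] by simp
qed

text \<open>The mirror argument: an associator composed in front supplies the pentagon for
  \<open>Y\<close>, \<open>X\<close> and two units, and the triangle is used once at
  \<open>X\<close> and once at \<open>Y \<odot> X\<close>.\<close>

lemma ru_h1:
  assumes [simp]: "X \<in> Mor B" "Y \<in> Mor B" "src B Y = trg B X" "src B X = a"
  shows "(idt B Y \<star> ru B X) \<bullet> asc B Y X (one B a) = ru B (Y \<odot> X)"
proof -
  have [simp]: "a \<in> Obj B" using src_trg_Obj(1)[of X] assms by simp
  let ?I = "one B a"
  have "asc B Y X ?I \<bullet> (((idt B Y \<star> ru B X) \<bullet> asc B Y X ?I) \<star> idt B ?I) =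
    (asc B Y X ?I \<bullet> ((idt B Y \<star> ru B X) \<star> idt B ?I)) \<bullet> (asc B Y X ?I \<star> idt B ?I)"
    by (simp add: whisker_vc)
  also have "\<dots> = (idt B Y \<star> (ru B X \<star> idt B ?I)) \<bullet> (asc B Y (X \<odot> ?I) ?I \<bullet> (asc B Y X ?I \<star> idt B ?I))"
    using asc_nat[of "idt B ?I" "ru B X" "idt B Y" Y X ?I] by simp
  also have "\<dots> = (idt B Y \<star> (idt B X \<star> lu B ?I)) \<bullet> ((idt B Y \<star> asc B X ?I ?I) \<bullet>
      (asc B Y (X \<odot> ?I) ?I \<bullet> (asc B Y X ?I \<star> idt B ?I)))"
    using triangle[of ?I X a, symmetric] by (simp add: whisker_vc)
  also have "\<dots> = ((idt B Y \<star> (idt B X \<star> lu B ?I)) \<bullet> asc B Y X (?I \<odot> ?I)) \<bullet> asc B (Y \<odot> X) ?I ?I"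
    using pentagon[of Y X ?I ?I] by simp
  also have "\<dots> = asc B Y X ?I \<bullet> ((idt B (Y \<odot> X) \<star> lu B ?I) \<bullet> asc B (Y \<odot> X) ?I ?I)"
    using asc_nat[of "lu B ?I" "idt B X" "idt B Y" Y X ?I, symmetric] by simp
  also have "\<dots> = asc B Y X ?I \<bullet> (ru B (Y \<odot> X) \<star> idt B ?I)"
    using triangle[of ?I "Y \<odot> X" a] by simp
  finally have "((idt B Y \<star> ru B X) \<bullet> asc B Y X ?I) \<star> idt B ?I = ru B (Y \<odot> X) \<star> idt B ?I"
    by (rule iso2_mono) simp_all
  then show ?thesis
    using one_faithful(2)[of "(idt B Y \<star> ru B X) \<bullet> asc B Y X ?I" "ru B (Y \<odot> X)"] by simp
qed

section \<open>Composition of pairings\<close>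

text \<open>A pairing \<open>f : C \<odot> Y \<rightarrow> 1\<close> cancels \<open>C \<odot> Y\<close> in front of any \<open>X\<close>, and two pairings
  \<open>e : A \<odot> X \<rightarrow> 1\<close>, \<open>f : C \<odot> Y \<rightarrow> 1\<close> compose to \<open>(A \<odot> C) \<odot> (Y \<odot> X) \<rightarrow> 1\<close> by cancelling
  from the inside.\<close>

definition cancel :: "'m \<Rightarrow> 'm \<Rightarrow> 'm \<Rightarrow> 'c \<Rightarrow> 'c" where
  "cancel C Y X f = lu B X \<bullet> ((f \<star> idt B X) \<bullet> inv2 B (asc B C Y X))"

definition pairing_comp :: "'m \<Rightarrow> 'm \<Rightarrow> 'm \<Rightarrow> 'm \<Rightarrow> 'c \<Rightarrow> 'c \<Rightarrow> 'c" where
  "pairing_comp A X C Y e f = e \<bullet> ((idt B A \<star> cancel C Y X f) \<bullet> asc B A C (Y \<odot> X))"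

lemma cancel_simps [simp]:
  assumes "X \<in> Mor B" "Y \<in> Mor B" "C \<in> Mor B"
    "src B Y = trg B X" "src B C = trg B Y" "trg B C = trg B X"
    "f \<in> Cell B" "dm B f = C \<odot> Y" "cd B f = one B (trg B X)"
  shows "cancel C Y X f \<in> Cell B" "dm B (cancel C Y X f) = C \<odot> (Y \<odot> X)"
    "cd B (cancel C Y X f) = X"
  using assms by (simp_all add: cancel_def)

lemma pairing_comp_simps [simp]:
  assumes "A \<in> Mor B" "X \<in> Mor B" "Y \<in> Mor B" "C \<in> Mor B"
    "src B A = trg B X" "trg B A = src B X"
    "src B Y = trg B X" "src B C = trg B Y" "trg B C = trg B X"
    "e \<in> Cell B" "dm B e = A \<odot> X" "cd B e = one B (src B X)"
    "f \<in> Cell B" "dm B f = C \<odot> Y" "cd B f = one B (trg B X)"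
  shows "pairing_comp A X C Y e f \<in> Cell B"
    "dm B (pairing_comp A X C Y e f) = (A \<odot> C) \<odot> (Y \<odot> X)"
    "cd B (pairing_comp A X C Y e f) = one B (src B X)"
  using assms by (simp_all add: pairing_comp_def)

lemma cancel_nat:
  assumes [simp]: "b \<in> Obj B" "X \<in> Mor B" "Y \<in> Mor B" "C \<in> Mor B"
    "trg B X = b" "src B Y = b" "src B C = trg B Y" "trg B C = b"
    and f: "f \<in> cells B (C \<odot> Y) (one B b)"
    and \<xi>: "\<xi> \<in> cells B X' X" and \<upsilon>: "\<upsilon> \<in> cells B Y' Y" and \<gamma>: "\<gamma> \<in> cells B C' C"
  shows "\<xi> \<bullet> cancel C' Y' X' (f \<bullet> (\<gamma> \<star> \<upsilon>)) = cancel C Y X f \<bullet> (\<gamma> \<star> (\<upsilon> \<star> \<xi>))"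
proof -
  note [simp] = cellsD[OF f] cellsD[OF \<xi>] cellsD[OF \<upsilon>] cellsD[OF \<gamma>]
  have [simp]: "X' \<in> Mor B" "src B X' = src B X" "trg B X' = b"
    "Y' \<in> Mor B" "src B Y' = b" "trg B Y' = trg B Y"
    "C' \<in> Mor B" "src B C' = trg B Y" "trg B C' = b"
    using Cell_simps[of \<xi>] Cell_simps[of \<upsilon>] Cell_simps[of \<gamma>] by auto
  have "\<xi> \<bullet> cancel C' Y' X' (f \<bullet> (\<gamma> \<star> \<upsilon>)) =
    lu B X \<bullet> ((idt B (one B b) \<star> \<xi>) \<bullet> (((f \<bullet> (\<gamma> \<star> \<upsilon>)) \<star> idt B X') \<bullet> inv2 B (asc B C' Y' X')))"
    using vc_ext[OF lu_nat(1)[of \<xi> X b]] by (simp add: cancel_def)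
  also have "\<dots> = lu B X \<bullet> ((f \<star> idt B X) \<bullet> (((\<gamma> \<star> \<upsilon>) \<star> \<xi>) \<bullet> inv2 B (asc B C' Y' X')))"
    by (simp add: xchg)
  also have "\<dots> = cancel C Y X f \<bullet> (\<gamma> \<star> (\<upsilon> \<star> \<xi>))"
    using inv_asc_nat[of \<xi> \<upsilon> \<gamma> C Y X, symmetric] by (simp add: cancel_def)
  finally show ?thesis .
qed

text \<open>All four 1-morphisms vary at once, so that moving \<open>\<eta>\<close>,
  \<open>pcomp\<close> or \<open>punit\<close> out of a single argument is the case of identities in
  the others.\<close>

lemma pairing_comp_nat:
  assumes [simp]: "a \<in> Obj B" "b \<in> Obj B" "A \<in> Mor B" "X \<in> Mor B" "Y \<in> Mor B" "C \<in> Mor B"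
    "src B X = a" "trg B X = b" "src B A = b" "trg B A = a"
    "src B Y = b" "src B C = trg B Y" "trg B C = b"
    and e: "e \<in> cells B (A \<odot> X) (one B a)" and f: "f \<in> cells B (C \<odot> Y) (one B b)"
    and \<xi>: "\<xi> \<in> cells B X' X" and \<upsilon>: "\<upsilon> \<in> cells B Y' Y"
    and \<gamma>: "\<gamma> \<in> cells B C' C" and \<alpha>: "\<alpha> \<in> cells B A' A"
  shows "pairing_comp A' X' C' Y' (e \<bullet> (\<alpha> \<star> \<xi>)) (f \<bullet> (\<gamma> \<star> \<upsilon>)) =
    pairing_comp A X C Y e f \<bullet> ((\<alpha> \<star> \<gamma>) \<star> (\<upsilon> \<star> \<xi>))"
proof -
  note [simp] = cellsD[OF e] cellsD[OF f] cellsD[OF \<xi>] cellsD[OF \<upsilon>] cellsD[OF \<gamma>] cellsD[OF \<alpha>]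
  have [simp]: "X' \<in> Mor B" "src B X' = a" "trg B X' = b"
    "Y' \<in> Mor B" "src B Y' = b" "trg B Y' = trg B Y"
    "C' \<in> Mor B" "src B C' = trg B Y" "trg B C' = b"
    "A' \<in> Mor B" "src B A' = b" "trg B A' = a"
    using Cell_simps[of \<xi>] Cell_simps[of \<upsilon>] Cell_simps[of \<gamma>] Cell_simps[of \<alpha>] by auto
  have [simp]: "f \<bullet> (\<gamma> \<star> \<upsilon>) \<in> cells B (C' \<odot> Y') (one B b)" by (simp add: cellsI)
  have "pairing_comp A' X' C' Y' (e \<bullet> (\<alpha> \<star> \<xi>)) (f \<bullet> (\<gamma> \<star> \<upsilon>)) =
    e \<bullet> ((\<alpha> \<star> (\<xi> \<bullet> cancel C' Y' X' (f \<bullet> (\<gamma> \<star> \<upsilon>)))) \<bullet> asc B A' C' (Y' \<odot> X'))"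
    by (simp add: pairing_comp_def xchg)
  also have "\<dots> = e \<bullet> ((idt B A \<star> cancel C Y X f) \<bullet> ((\<alpha> \<star> (\<gamma> \<star> (\<upsilon> \<star> \<xi>))) \<bullet> asc B A' C' (Y' \<odot> X')))"
    using cancel_nat[OF assms(2,4,5,6,8,11-13) f \<xi> \<upsilon> \<gamma>] f by (simp add: xchg)
  also have "\<dots> = pairing_comp A X C Y e f \<bullet> ((\<alpha> \<star> \<gamma>) \<star> (\<upsilon> \<star> \<xi>))"
    using asc_nat[of "\<upsilon> \<star> \<xi>" \<gamma> \<alpha> A C "Y \<odot> X", symmetric] f by (simp add: pairing_comp_def)
  finally show ?thesis .
qed

text \<open>The same pairing arises by absorbing the inner pairing into \<open>A\<close> with a
  right unitor instead of into \<open>X\<close> with a left one. As \<open>d\<close> reverses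
  composition, it is in this shape that the dual of a nested pairing appears.\<close>

lemma pairing_comp_left:
  assumes [simp]: "a \<in> Obj B" "b \<in> Obj B" "A \<in> Mor B" "X \<in> Mor B" "Y \<in> Mor B" "C \<in> Mor B"
    "src B X = a" "trg B X = b" "src B A = b" "trg B A = a"
    "src B Y = b" "src B C = trg B Y" "trg B C = b"
    and e: "e \<in> cells B (A \<odot> X) (one B a)" and f: "f \<in> cells B (C \<odot> Y) (one B b)"
  shows "pairing_comp A X C Y e f =
    e \<bullet> (((ru B A \<bullet> ((idt B A \<star> f) \<bullet> asc B A C Y)) \<star> idt B X) \<bullet> inv2 B (asc B (A \<odot> C) Y X))"
proof -
  note [simp] = cellsD[OF e] cellsD[OF f]
  have "((ru B A \<bullet> ((idt B A \<star> f) \<bullet> asc B A C Y)) \<star> idt B X) =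
    (ru B A \<star> idt B X) \<bullet> (((idt B A \<star> f) \<star> idt B X) \<bullet> (asc B A C Y \<star> idt B X))"
    by (simp add: whisker_vc)
  also have "\<dots> = (idt B A \<star> lu B X) \<bullet> (asc B A (one B b) X \<bullet>
      (((idt B A \<star> f) \<star> idt B X) \<bullet> (asc B A C Y \<star> idt B X)))"
    using triangle[of X A b, symmetric] by simp
  also have "\<dots> = (idt B A \<star> lu B X) \<bullet> ((idt B A \<star> (f \<star> idt B X)) \<bullet>
      (asc B A (C \<odot> Y) X \<bullet> (asc B A C Y \<star> idt B X)))"
    using vc_ext[OF asc_nat[of "idt B X" f "idt B A" A "one B b" X]] by simp
  \<comment> \<open>An associator and its inverse are inserted to complete one side of the pentagon
    for \<open>A\<close>, \<open>C\<close>, \<open>Y\<close>, \<open>X\<close>; the inverse is the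
    one contained in \<open>cancel\<close>.\<close>
  also have "\<dots> = (idt B A \<star> lu B X) \<bullet> ((idt B A \<star> (f \<star> idt B X)) \<bullet>
      ((idt B A \<star> inv2 B (asc B C Y X)) \<bullet> ((idt B A \<star> asc B C Y X) \<bullet>
        (asc B A (C \<odot> Y) X \<bullet> (asc B A C Y \<star> idt B X)))))"
    by (simp add: interchange_ext)
  also have "\<dots> = (idt B A \<star> cancel C Y X f) \<bullet> (asc B A C (Y \<odot> X) \<bullet> asc B (A \<odot> C) Y X)"
    using pentagon[of A C Y X] by (simp add: cancel_def whisker_vc)
  finally show ?thesis
    using f by (simp add: pairing_comp_def)
qed

text \<open>Cancelling in front of \<open>X\<close> ignores a factor \<open>U\<close> behind it.
  Besides a pentagon this takes \<open>lu_h1\<close>, since the left unitor of \<open>X\<close> has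
  to become that of \<open>X \<odot> U\<close>.\<close>

lemma cancel_h1:
  assumes [simp]: "b \<in> Obj B" "X \<in> Mor B" "Y \<in> Mor B" "C \<in> Mor B" "U \<in> Mor B"
    "trg B X = b" "src B Y = b" "src B C = trg B Y" "trg B C = b" "trg B U = src B X"
    and f: "f \<in> cells B (C \<odot> Y) (one B b)"
  shows "(cancel C Y X f \<star> idt B U) =
    cancel C Y (X \<odot> U) f \<bullet> ((idt B C \<star> asc B Y X U) \<bullet> asc B C (Y \<odot> X) U)"
proof -
  note [simp] = cellsD[OF f]
  have 1: "inv2 B (asc B C Y (X \<odot> U)) \<bullet> ((idt B C \<star> asc B Y X U) \<bullet> asc B C (Y \<odot> X) U) =
    asc B (C \<odot> Y) X U \<bullet> (inv2 B (asc B C Y X) \<star> idt B U)"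
  proof (rule iso2_mono[of "asc B C Y (X \<odot> U)"])
    have "asc B C Y (X \<odot> U) \<bullet> (asc B (C \<odot> Y) X U \<bullet> (inv2 B (asc B C Y X) \<star> idt B U)) =
      (idt B C \<star> asc B Y X U) \<bullet> asc B C (Y \<odot> X) U"
      using vc_ext[OF pentagon[of C Y X U], of "inv2 B (asc B C Y X) \<star> idt B U"]
      by (simp add: xchg)
    then show "asc B C Y (X \<odot> U) \<bullet> (inv2 B (asc B C Y (X \<odot> U)) \<bullet> ((idt B C \<star> asc B Y X U) \<bullet> asc B C (Y \<odot> X) U)) =
      asc B C Y (X \<odot> U) \<bullet> (asc B (C \<odot> Y) X U \<bullet> (inv2 B (asc B C Y X) \<star> idt B U))" by simp
  qed simp_all
  have "cancel C Y (X \<odot> U) f \<bullet> ((idt B C \<star> asc B Y X U) \<bullet> asc B C (Y \<odot> X) U) =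
    lu B (X \<odot> U) \<bullet> ((f \<star> (idt B X \<star> idt B U)) \<bullet> (asc B (C \<odot> Y) X U \<bullet> (inv2 B (asc B C Y X) \<star> idt B U)))"
    using 1 by (simp add: cancel_def)
  also have "\<dots> = (lu B (X \<odot> U) \<bullet> asc B (one B b) X U) \<bullet>
      (((f \<star> idt B X) \<star> idt B U) \<bullet> (inv2 B (asc B C Y X) \<star> idt B U))"
    using vc_ext[OF asc_nat[of "idt B U" "idt B X" f "one B b" X U]] by (simp del: h2_idt)
  also have "\<dots> = cancel C Y X f \<star> idt B U"
    by (simp only: lu_h1[OF assms(5,2) assms(10)[symmetric] assms(6)])
      (simp add: cancel_def whisker_vc)
  finally show ?thesis by simp
qed

text \<open>Cancelling a nested pairing in front of \<open>U\<close> means cancelling the inner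
  pairing and then the outer one. Associativity rests on this, as it unfolds a nested pairing that
  is itself used as an inner one.\<close>

lemma cancel_pairing_comp:
  assumes [simp]: "a \<in> Obj B" "b \<in> Obj B" "A \<in> Mor B" "X \<in> Mor B" "Y \<in> Mor B" "C \<in> Mor B"
    "src B X = a" "trg B X = b" "src B A = b" "trg B A = a"
    "src B Y = b" "src B C = trg B Y" "trg B C = b" "U \<in> Mor B" "trg B U = a"
    and e: "e \<in> cells B (A \<odot> X) (one B a)" and f: "f \<in> cells B (C \<odot> Y) (one B b)"
  shows "cancel (A \<odot> C) (Y \<odot> X) U (pairing_comp A X C Y e f) \<bullet> (idt B (A \<odot> C) \<star> inv2 B (asc B Y X U)) =
    cancel A X U e \<bullet> ((idt B A \<star> cancel C Y (X \<odot> U) f) \<bullet> asc B A C (Y \<odot> (X \<odot> U)))"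
proof -
  note [simp] = cellsD[OF e] cellsD[OF f]
  have 1: "(asc B A C (Y \<odot> X) \<star> idt B U) \<bullet> (inv2 B (asc B (A \<odot> C) (Y \<odot> X) U) \<bullet>
      (idt B (A \<odot> C) \<star> inv2 B (asc B Y X U))) =
    inv2 B (asc B A (C \<odot> (Y \<odot> X)) U) \<bullet> ((idt B A \<star> inv2 B (asc B C (Y \<odot> X) U)) \<bullet>
      ((idt B A \<star> (idt B C \<star> inv2 B (asc B Y X U))) \<bullet> asc B A C (Y \<odot> (X \<odot> U))))"
    (is "?l = ?r")
  \<comment> \<open>Both sides contain inverse associators. Two associators are composed in front,
    so that the left side meets the pentagon for \<open>A\<close>, \<open>C\<close>,
    \<open>Y \<odot> X\<close>, \<open>U\<close> and the right side collapses.\<close>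
  proof (rule iso2_mono[of "asc B A (C \<odot> (Y \<odot> X)) U"], rule iso2_mono[of "idt B A \<star> asc B C (Y \<odot> X) U"])
    have "(idt B A \<star> asc B C (Y \<odot> X) U) \<bullet> (asc B A (C \<odot> (Y \<odot> X)) U \<bullet> ?l) =
      asc B A C ((Y \<odot> X) \<odot> U) \<bullet> (asc B (A \<odot> C) (Y \<odot> X) U \<bullet> (inv2 B (asc B (A \<odot> C) (Y \<odot> X) U) \<bullet>
      (idt B (A \<odot> C) \<star> inv2 B (asc B Y X U))))"
      using vc_ext[OF pentagon[of A C "Y \<odot> X" U], of "inv2 B (asc B (A \<odot> C) (Y \<odot> X) U) \<bullet>
      (idt B (A \<odot> C) \<star> inv2 B (asc B Y X U))"] by simp
    also have "\<dots> = (idt B A \<star> (idt B C \<star> inv2 B (asc B Y X U))) \<bullet> asc B A C (Y \<odot> (X \<odot> U))"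
      using asc_nat[of "inv2 B (asc B Y X U)" "idt B C" "idt B A" A C "(Y \<odot> X) \<odot> U"] by simp
    also have "\<dots> = (idt B A \<star> asc B C (Y \<odot> X) U) \<bullet> (asc B A (C \<odot> (Y \<odot> X)) U \<bullet> ?r)"
      by (simp add: interchange_ext)
    finally show "(idt B A \<star> asc B C (Y \<odot> X) U) \<bullet> (asc B A (C \<odot> (Y \<odot> X)) U \<bullet> ?l) =
      (idt B A \<star> asc B C (Y \<odot> X) U) \<bullet> (asc B A (C \<odot> (Y \<odot> X)) U \<bullet> ?r)" .
  qed (simp_all add: iso2_h2 iso2_idt)
  have 2: "(cancel C Y X f \<star> idt B U) \<bullet> (inv2 B (asc B C (Y \<odot> X) U) \<bullet> (idt B C \<star> inv2 B (asc B Y X U)))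
    = cancel C Y (X \<odot> U) f"
    using f by (simp add: cancel_h1[where f=f and b=b] xchg)
  have "cancel (A \<odot> C) (Y \<odot> X) U (pairing_comp A X C Y e f) \<bullet> (idt B (A \<odot> C) \<star> inv2 B (asc B Y X U)) =
    lu B U \<bullet> ((e \<star> idt B U) \<bullet> (((idt B A \<star> cancel C Y X f) \<star> idt B U) \<bullet> ?l))"
    using f e by (simp add: cancel_def[of "A \<odot> C"] pairing_comp_def whisker_vc)
  also have "\<dots> = lu B U \<bullet> ((e \<star> idt B U) \<bullet> (inv2 B (asc B A X U) \<bullet>
      ((idt B A \<star> (cancel C Y X f \<star> idt B U)) \<bullet> ((idt B A \<star> inv2 B (asc B C (Y \<odot> X) U)) \<bullet>
      ((idt B A \<star> (idt B C \<star> inv2 B (asc B Y X U))) \<bullet> asc B A C (Y \<odot> (X \<odot> U)))))))"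
    using f vc_ext[OF inv_asc_nat[of "idt B U" "cancel C Y X f" "idt B A" A X U], symmetric]
    unfolding 1 by simp
  also have "\<dots> = lu B U \<bullet> ((e \<star> idt B U) \<bullet> (inv2 B (asc B A X U) \<bullet>
      ((idt B A \<star> cancel C Y (X \<odot> U) f) \<bullet> asc B A C (Y \<odot> (X \<odot> U)))))"
    unfolding 2[symmetric] using f by (simp add: whisker_vc)
  also have "\<dots> = cancel A X U e \<bullet> ((idt B A \<star> cancel C Y (X \<odot> U) f) \<bullet> asc B A C (Y \<odot> (X \<odot> U)))"
    using f by (simp add: cancel_def[of A])
  finally show ?thesis .
qed

text \<open>By \<open>cancel_pairing_comp\<close> both sides cancel \<open>g\<close>, then
  \<open>f\<close>, and finally evaluate \<open>e\<close>; the bracketings differ by the pentagon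
  for \<open>A\<close>, \<open>C\<close>, \<open>E\<close> and the remaining word
  \<open>Z \<odot> (Y \<odot> X)\<close>.\<close>

lemma pairing_comp_assoc:
  assumes [simp]: "a \<in> Obj B" "b \<in> Obj B" "c \<in> Obj B" "A \<in> Mor B" "X \<in> Mor B" "Y \<in> Mor B" "C \<in> Mor B"
    "Z \<in> Mor B" "E \<in> Mor B" "src B X = a" "trg B X = b" "src B A = b" "trg B A = a"
    "src B Y = b" "trg B Y = c" "src B C = c" "trg B C = b"
    "src B Z = c" "src B E = trg B Z" "trg B E = c"
    and e: "e \<in> cells B (A \<odot> X) (one B a)" and f: "f \<in> cells B (C \<odot> Y) (one B b)"
    and g: "g \<in> cells B (E \<odot> Z) (one B c)"
  shows "pairing_comp A X (C \<odot> E) (Z \<odot> Y) e (pairing_comp C Y E Z f g) \<bullet>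
      (asc B A C E \<star> inv2 B (asc B Z Y X)) =
    pairing_comp (A \<odot> C) (Y \<odot> X) E Z (pairing_comp A X C Y e f) g"
proof -
  note [simp] = cellsD[OF e] cellsD[OF f] cellsD[OF g]
  have fg [simp]: "pairing_comp C Y E Z f g \<in> cells B ((C \<odot> E) \<odot> (Z \<odot> Y)) (one B b)"
    using f g by (simp add: cellsI)
  let ?K = "cancel (C \<odot> E) (Z \<odot> Y) X (pairing_comp C Y E Z f g)"
  have 1: "asc B A (C \<odot> E) ((Z \<odot> Y) \<odot> X) \<bullet> (asc B A C E \<star> inv2 B (asc B Z Y X)) =
    (idt B A \<star> (idt B (C \<odot> E) \<star> inv2 B (asc B Z Y X))) \<bullet> (asc B A (C \<odot> E) (Z \<odot> (Y \<odot> X)) \<bullet>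
      (asc B A C E \<star> idt B (Z \<odot> (Y \<odot> X))))"
    using vc_ext[OF asc_nat[of "inv2 B (asc B Z Y X)" "idt B (C \<odot> E)" "idt B A" A "C \<odot> E" "(Z \<odot> Y) \<odot> X"],
        of "asc B A C E \<star> idt B (Z \<odot> (Y \<odot> X))"] by (simp add: xchg)
  have "pairing_comp A X (C \<odot> E) (Z \<odot> Y) e (pairing_comp C Y E Z f g) \<bullet>
      (asc B A C E \<star> inv2 B (asc B Z Y X)) =
    e \<bullet> ((idt B A \<star> (?K \<bullet> (idt B (C \<odot> E) \<star> inv2 B (asc B Z Y X)))) \<bullet>
      (asc B A (C \<odot> E) (Z \<odot> (Y \<odot> X)) \<bullet> (asc B A C E \<star> idt B (Z \<odot> (Y \<odot> X)))))"
    by (simp add: pairing_comp_def[of A X "C \<odot> E"] 1 whisker_vc)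
  also have "\<dots> = e \<bullet> ((idt B A \<star> cancel C Y X f) \<bullet> ((idt B A \<star> (idt B C \<star> cancel E Z (Y \<odot> X) g)) \<bullet>
      ((idt B A \<star> asc B C E (Z \<odot> (Y \<odot> X))) \<bullet>
      (asc B A (C \<odot> E) (Z \<odot> (Y \<odot> X)) \<bullet> (asc B A C E \<star> idt B (Z \<odot> (Y \<odot> X)))))))"
    using f g by (simp add: cancel_pairing_comp[where a=b and b=c] whisker_vc)
  also have "\<dots> = e \<bullet> ((idt B A \<star> cancel C Y X f) \<bullet> ((idt B A \<star> (idt B C \<star> cancel E Z (Y \<odot> X) g)) \<bullet>
      (asc B A C (E \<odot> (Z \<odot> (Y \<odot> X))) \<bullet> asc B (A \<odot> C) E (Z \<odot> (Y \<odot> X)))))"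
    using pentagon[of A C E "Z \<odot> (Y \<odot> X)"] by simp
  also have "\<dots> = e \<bullet> ((idt B A \<star> cancel C Y X f) \<bullet> (asc B A C (Y \<odot> X) \<bullet>
     ((idt B (A \<odot> C) \<star> cancel E Z (Y \<odot> X) g) \<bullet> asc B (A \<odot> C) E (Z \<odot> (Y \<odot> X)))))"
    using vc_ext[OF asc_nat[of "cancel E Z (Y \<odot> X) g" "idt B C" "idt B A" A C "Y \<odot> X"],
        of "asc B (A \<odot> C) E (Z \<odot> (Y \<odot> X))"] f g by simp
  also have "\<dots> = pairing_comp (A \<odot> C) (Y \<odot> X) E Z (pairing_comp A X C Y e f) g"
    using f g by (simp add: pairing_comp_def)
  finally show ?thesis .
qed

text \<open>The unitor of the unit serves as unit pairing. By the triangle, cancelling it in front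
  of \<open>X\<close> strips two left unitors, and a second use turns one of them into the right
  unitor of \<open>A\<close>.\<close>

lemma pairing_comp_one_right:
  assumes [simp]: "a \<in> Obj B" "b \<in> Obj B" "A \<in> Mor B" "X \<in> Mor B"
    "src B X = a" "trg B X = b" "src B A = b" "trg B A = a"
    and e: "e \<in> cells B (A \<odot> X) (one B a)"
  shows "pairing_comp A X (one B b) (one B b) e (ru B (one B b)) = e \<bullet> (ru B A \<star> lu B X)"
proof -
  let ?I = "one B b"
  note [simp] = cellsD[OF e]
  have "cancel ?I ?I X (ru B ?I) = lu B X \<bullet> (idt B ?I \<star> lu B X)"
    using triangle[of X ?I b, symmetric] by (simp add: cancel_def)
  then have "pairing_comp A X ?I ?I e (ru B ?I) =
    e \<bullet> ((idt B A \<star> lu B X) \<bullet> ((idt B A \<star> (idt B ?I \<star> lu B X)) \<bullet> asc B A ?I (?I \<odot> X)))"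
    by (simp add: pairing_comp_def whisker_vc)
  also have "\<dots> = e \<bullet> (((idt B A \<star> lu B X) \<bullet> asc B A ?I X) \<bullet> (idt B (A \<odot> ?I) \<star> lu B X))"
    using asc_nat[of "lu B X" "idt B ?I" "idt B A" A ?I X] by simp
  also have "\<dots> = e \<bullet> (ru B A \<star> lu B X)"
    using triangle[of X A b] by (simp add: interchange)
  finally show ?thesis .
qed

text \<open>\<open>ru_h1\<close> reduces cancelling \<open>e\<close> in front of the unit to
  \<open>e\<close> itself, \<open>lu_h1\<close> treats the unit on the left, and
  \<open>lu_ru_one\<close> lets the unitor of the unit be read from either side.\<close>

lemma pairing_comp_one_left:
  assumes [simp]: "a \<in> Obj B" "b \<in> Obj B" "A \<in> Mor B" "X \<in> Mor B"
    "src B X = a" "trg B X = b" "src B A = b" "trg B A = a"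
    and e: "e \<in> cells B (A \<odot> X) (one B a)"
  shows "pairing_comp (one B a) (one B a) A X (ru B (one B a)) e = e \<bullet> (lu B A \<star> ru B X)"
proof -
  let ?I = "one B a"
  note [simp] = cellsD[OF e]
  have "cancel A X ?I e = e \<bullet> (ru B (A \<odot> X) \<bullet> inv2 B (asc B A X ?I))"
    using vc_ext[OF lu_nat(2)[of e ?I a], of "inv2 B (asc B A X ?I)"]
    by (simp add: cancel_def lu_ru_one)
  also have "\<dots> = e \<bullet> (idt B A \<star> ru B X)"
    using ru_h1[of X A a, symmetric] by simp
  finally have "pairing_comp ?I ?I A X (ru B ?I) e =
      lu B ?I \<bullet> ((idt B ?I \<star> (e \<bullet> (idt B A \<star> ru B X))) \<bullet> asc B ?I A (X \<odot> ?I))"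
    by (simp add: pairing_comp_def lu_ru_one)
  also have "\<dots> = (e \<bullet> (idt B A \<star> ru B X)) \<bullet> (lu B (A \<odot> (X \<odot> ?I)) \<bullet> asc B ?I A (X \<odot> ?I))"
    using vc_ext[OF lu_nat(1)[of "e \<bullet> (idt B A \<star> ru B X)" ?I a], of "asc B ?I A (X \<odot> ?I)"] by simp
  also have "\<dots> = e \<bullet> (lu B A \<star> ru B X)"
    using lu_h1[of "X \<odot> ?I" A a] by (simp add: interchange)
  finally show ?thesis .
qed

end

section \<open>Duals of pairings in a dagger bicategory\<close>

lemma op1_simps [simp]:
  "Obj (op1 B) = Obj B" "Mor (op1 B) = Mor B" "dm (op1 B) = dm B" "cd (op1 B) = cd B"
  "src (op1 B) = trg B" "trg (op1 B) = src B" "idt (op1 B) = idt B" "vc (op1 B) = vc B"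
  "h1 (op1 B) Y X = X \<odot>\<^bsub>B\<^esub> Y" "h2 (op1 B) g f = f \<star>\<^bsub>B\<^esub> g" "one (op1 B) = one B"
  "asc (op1 B) W Y X = inv2 B (asc B X Y W)" "lu (op1 B) = ru B" "ru (op1 B) = lu B"
  "hom (op1 B) a b = hom B b a" "cells (op1 B) X Y = cells B X Y"
  by (auto simp: op1_def hom_def cells_def)

locale dagger_bicat = bicat B for B :: "('o, 'm, 'c) bicat" (structure) +
  fixes d :: "('o, 'm, 'c, 'o, 'm, 'c) psftr" and \<eta> :: "'m \<Rightarrow> 'c"
  assumes dagger: "dagger_bicategory B d \<eta>"
begin

abbreviation D where "D \<equiv> pmor d"
abbreviation dc where "dc \<equiv> pcell d"

lemma pobj_d [simp]: "a \<in> Obj B \<Longrightarrow> pobj d a = a"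
  using dagger unfolding dagger_bicategory_def by blast

lemma pseudofunctor_d: "pseudofunctor B (op1 B) d"
  using dagger unfolding dagger_bicategory_def by blast

lemma functor_d: "a \<in> Obj B \<Longrightarrow> b \<in> Obj B \<Longrightarrow> is_functor (hom B a b) (hom B b a) (pftr d)"
  using pseudofunctor_d unfolding pseudofunctor_def by (metis op1_simps(15) pobj_d)

lemma D_simps [simp]:
  assumes "X \<in> Mor B" shows "D X \<in> Mor B" "src B (D X) = trg B X" "trg B (D X) = src B X"
  using functor_simps(3)[OF functor_d, of "src B X" "trg B X" X] assms by simp_all

lemma dc_simps [simp]:
  assumes "f \<in> Cell B" shows "dc f \<in> Cell B" "dm B (dc f) = D (dm B f)" "cd B (dc f) = D (cd B f)"
  using functor_homset[OF functor_d, of "src B (dm B f)" "trg B (dm B f)" f "dm B f" "cd B f"] assms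
  by (auto intro: cellsI dest: cellsD)

lemma dc_idt [simp]: "X \<in> Mor B \<Longrightarrow> dc (idt B X) = idt B (D X)"
  using functor_simps(4)[OF functor_d, of "src B X" "trg B X" X] by simp

lemma dc_vc [simp]:
  "f \<in> Cell B \<Longrightarrow> g \<in> Cell B \<Longrightarrow> dm B g = cd B f \<Longrightarrow> dc (g \<bullet> f) = dc g \<bullet> dc f"
  using functor_Comp[OF functor_d, of "src B (dm B f)" "trg B (dm B f)" f "dm B f" "cd B f" g "cd B g"]
  by (simp add: cellsI)

lemma dc_inv2:
  assumes "iso2 f" shows "iso2 (dc f)" "dc (inv2 B f) = inv2 B (dc f)"
proof -
  have *: "dc (inv2 B f) \<bullet> dc f = idt B (dm B (dc f))" "dc f \<bullet> dc (inv2 B f) = idt B (cd B (dc f))"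
    using dc_vc[of f "inv2 B f"] dc_vc[of "inv2 B f" f] assms by (simp_all add: iso2_Cell del: dc_vc)
  show "iso2 (dc f)" "dc (inv2 B f) = inv2 B (dc f)"
    using iso2_inverse[OF _ _ _ _ *] assms by (simp_all add: iso2_Cell)
qed

lemma nat_iso_pcomp:
  assumes "a \<in> Obj B" "b \<in> Obj B" "c \<in> Obj B"
  shows "nat_iso (prod_cat (hom B b c) (hom B a b)) (hom B c a)
      (hcomp (op1 B) \<circ>\<circ> ftr_prod (pftr d) (pftr d)) (pftr d \<circ>\<circ> hcomp B) (\<lambda>(Y, X). pcomp d Y X)"
proof -
  have "nat_iso (prod_cat (hom B b c) (hom B a b)) (hom (op1 B) (pobj d a) (pobj d c))
      (hcomp (op1 B) \<circ>\<circ> ftr_prod (pftr d) (pftr d)) (pftr d \<circ>\<circ> hcomp B) (\<lambda>(Y, X). pcomp d Y X)"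
    using pseudofunctor_d assms unfolding pseudofunctor_def by blast
  then show ?thesis using assms by simp
qed

lemma pcomp_simps [simp]:
  assumes "X \<in> Mor B" "Y \<in> Mor B" "src B Y = trg B X"
  shows "pcomp d Y X \<in> Cell B" "dm B (pcomp d Y X) = D X \<odot> D Y" "cd B (pcomp d Y X) = D (Y \<odot> X)"
    "iso2 (pcomp d Y X)"
proof -
  have *: "pcomp d Y X \<in> cells B (D X \<odot> D Y) (D (Y \<odot> X))" "iso (hom B (trg B Y) (src B X)) (pcomp d Y X)"
    using nat_iso_pcomp[of "src B X" "trg B X" "trg B Y"] assms
    unfolding nat_iso_def nat_trans_def by (auto simp: hcomp_def)
  show "pcomp d Y X \<in> Cell B" "dm B (pcomp d Y X) = D X \<odot> D Y" "cd B (pcomp d Y X) = D (Y \<odot> X)"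
    using *(1) by (auto dest: cellsD)
  show "iso2 (pcomp d Y X)" using *(2) by (rule iso2I)
qed

lemma pcomp_nat:
  assumes "f \<in> Cell B" "g \<in> Cell B" "src B (dm B g) = trg B (dm B f)" "cd B g = Y" "cd B f = X"
  shows "pcomp d Y X \<bullet> (dc f \<star> dc g) = dc (g \<star> f) \<bullet> pcomp d (dm B g) (dm B f)"
proof -
  have "\<forall>k\<in>homset (prod_cat (hom B (trg B (dm B f)) (trg B (dm B g)))
      (hom B (src B (dm B f)) (trg B (dm B f)))) (dm B g, dm B f) (cd B g, cd B f).
    (\<lambda>(Y, X). pcomp d Y X) (cd B g, cd B f) \<bullet> fa (hcomp (op1 B) \<circ>\<circ> ftr_prod (pftr d) (pftr d)) k =
    fa (pftr d \<circ>\<circ> hcomp B) k \<bullet> (\<lambda>(Y, X). pcomp d Y X) (dm B g, dm B f)"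
    using nat_iso_pcomp[of "src B (dm B f)" "trg B (dm B f)" "trg B (dm B g)"] assms(1-3)
    unfolding nat_iso_def nat_trans_def by simp
  then show ?thesis
    using assms by (auto simp: hcomp_def cellsI)
qed

lemma punit_simps [simp]:
  assumes a: "a \<in> Obj B"
  shows "punit d a \<in> Cell B" "dm B (punit d a) = one B a" "cd B (punit d a) = D (one B a)"
    "iso2 (punit d a)"
proof -
  have *: "punit d a \<in> cells B (one B a) (D (one B a)) \<and> iso (hom B a a) (punit d a)"
    using pseudofunctor_d a unfolding pseudofunctor_def by (metis op1_simps(11,15,16) pobj_d)
  then show "punit d a \<in> Cell B" "dm B (punit d a) = one B a" "cd B (punit d a) = D (one B a)"
    by (auto dest: cellsD)
  show "iso2 (punit d a)" using * by (auto intro: iso2I)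
qed

lemma pcomp_asc:
  assumes "W \<in> Mor B" "Y \<in> Mor B" "X \<in> Mor B" "src B W = trg B Y" "src B Y = trg B X"
  shows "dc (asc B W Y X) \<bullet> (pcomp d (W \<odot> Y) X \<bullet> (idt B (D X) \<star> pcomp d W Y)) =
    pcomp d W (Y \<odot> X) \<bullet> ((pcomp d Y X \<star> idt B (D W)) \<bullet> inv2 B (asc B (D X) (D Y) (D W)))"
proof -
  have "\<forall>W\<in>Mor B. \<forall>Y\<in>Mor B. \<forall>X\<in>Mor B. src B W = trg B Y \<longrightarrow> src B Y = trg B X \<longrightarrow>
        pcell d (asc B W Y X) \<bullet>\<^bsub>op1 B\<^esub> pcomp d (W \<odot>\<^bsub>B\<^esub> Y) X
          \<bullet>\<^bsub>op1 B\<^esub> (pcomp d W Y \<star>\<^bsub>op1 B\<^esub> idt (op1 B) (pmor d X)) =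
        pcomp d W (Y \<odot>\<^bsub>B\<^esub> X) \<bullet>\<^bsub>op1 B\<^esub> (idt (op1 B) (pmor d W) \<star>\<^bsub>op1 B\<^esub> pcomp d Y X)
          \<bullet>\<^bsub>op1 B\<^esub> asc (op1 B) (pmor d W) (pmor d Y) (pmor d X)"
    using pseudofunctor_d unfolding pseudofunctor_def by blast
  then have "dc (asc B W Y X) \<bullet> pcomp d (W \<odot> Y) X \<bullet> (idt B (D X) \<star> pcomp d W Y) =
    pcomp d W (Y \<odot> X) \<bullet> (pcomp d Y X \<star> idt B (D W)) \<bullet> inv2 B (asc B (D X) (D Y) (D W))"
    using assms by (simp only: op1_simps)
  then show ?thesis
    using assms by simp
qed

lemma pcomp_unit:
  assumes "X \<in> Mor B"
  shows "trg B X = b \<Longrightarrow>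
      dc (lu B X) \<bullet> (pcomp d (one B b) X \<bullet> (idt B (D X) \<star> punit d b)) = ru B (D X)"
    "src B X = a \<Longrightarrow>
      dc (ru B X) \<bullet> (pcomp d X (one B a) \<bullet> (punit d a \<star> idt B (D X))) = lu B (D X)"
proof -
  have "\<forall>X\<in>Mor B.
        pcell d (lu B X) \<bullet>\<^bsub>op1 B\<^esub> pcomp d (one B (trg B X)) X
          \<bullet>\<^bsub>op1 B\<^esub> (punit d (trg B X) \<star>\<^bsub>op1 B\<^esub> idt (op1 B) (pmor d X)) = lu (op1 B) (pmor d X) \<and>
        pcell d (ru B X) \<bullet>\<^bsub>op1 B\<^esub> pcomp d X (one B (src B X))
          \<bullet>\<^bsub>op1 B\<^esub> (idt (op1 B) (pmor d X) \<star>\<^bsub>op1 B\<^esub> punit d (src B X)) = ru (op1 B) (pmor d X)"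
    using pseudofunctor_d unfolding pseudofunctor_def by blast
  then have "dc (lu B X) \<bullet> pcomp d (one B (trg B X)) X \<bullet> (idt B (D X) \<star> punit d (trg B X)) = ru B (D X)"
    "dc (ru B X) \<bullet> pcomp d X (one B (src B X)) \<bullet> (punit d (src B X) \<star> idt B (D X)) = lu B (D X)"
    using assms by (simp_all only: op1_simps)
  then show "trg B X = b \<Longrightarrow>
      dc (lu B X) \<bullet> (pcomp d (one B b) X \<bullet> (idt B (D X) \<star> punit d b)) = ru B (D X)"
    "src B X = a \<Longrightarrow>
      dc (ru B X) \<bullet> (pcomp d X (one B a) \<bullet> (punit d a \<star> idt B (D X))) = lu B (D X)"
    using assms by auto
qed

lemma icon: "invertible_icon B B (ps_id B) (ps_comp B (ps_op1 d) d) \<eta>"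
  using dagger unfolding dagger_bicategory_def by blast

lemma nat_iso_\<eta>:
  assumes "a \<in> Obj B" "b \<in> Obj B"
  shows "nat_iso (hom B a b) (hom B a b) ftr_id (pftr d \<circ>\<circ> pftr d) \<eta>"
proof -
  have "nat_iso (hom B a b) (hom B (pobj (ps_id B) a) (pobj (ps_id B) b)) (pftr (ps_id B))
      (pftr (ps_comp B (ps_op1 d) d)) \<eta>"
    using icon assms unfolding invertible_icon_def by blast
  then show ?thesis by (simp add: ps_id_def ps_comp_def ps_op1_def)
qed

lemma \<eta>_simps [simp]:
  assumes "X \<in> Mor B"
  shows "\<eta> X \<in> Cell B" "dm B (\<eta> X) = X" "cd B (\<eta> X) = D (D X)" "iso2 (\<eta> X)" "dc (\<eta> X) = \<eta> (D X)"
proof -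
  have *: "\<eta> X \<in> cells B X (D (D X))" "iso (hom B (src B X) (trg B X)) (\<eta> X)"
    using nat_iso_\<eta>[of "src B X" "trg B X"] assms
    unfolding nat_iso_def nat_trans_def by auto
  show "\<eta> X \<in> Cell B" "dm B (\<eta> X) = X" "cd B (\<eta> X) = D (D X)"
    using *(1) by (auto dest: cellsD)
  show "iso2 (\<eta> X)" using *(2) by (rule iso2I)
  show "dc (\<eta> X) = \<eta> (D X)" using dagger assms unfolding dagger_bicategory_def by blast
qed

lemma \<eta>_nat:
  assumes "f \<in> Cell B" "cd B f = X"
  shows "\<eta> X \<bullet> f = dc (dc f) \<bullet> \<eta> (dm B f)"
  using nat_iso_\<eta>[of "src B (dm B f)" "trg B (dm B f)"] assms
  unfolding nat_iso_def nat_trans_def by (auto simp: cellsI)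

lemma inv_\<eta>_nat:
  assumes f: "f \<in> Cell B" and X: "cd B f = X"
  shows "inv2 B (\<eta> X) \<bullet> dc (dc f) = f \<bullet> inv2 B (\<eta> (dm B f))"
proof (rule iso2_mono[of "\<eta> X"])
  have [simp]: "X \<in> Mor B" using assms by auto
  show "\<eta> X \<bullet> (inv2 B (\<eta> X) \<bullet> dc (dc f)) = \<eta> X \<bullet> (f \<bullet> inv2 B (\<eta> (dm B f)))"
    using vc_ext[OF \<eta>_nat[OF assms], of "inv2 B (\<eta> (dm B f))"] assms by simp
qed (use assms in auto)

lemma \<eta>_h1:
  assumes "X \<in> Mor B" "Y \<in> Mor B" "src B Y = trg B X"
  shows "\<eta> (Y \<odot> X) = dc (pcomp d Y X) \<bullet> (pcomp d (D X) (D Y) \<bullet> (\<eta> Y \<star> \<eta> X))"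
proof -
  have "\<eta> (Y \<odot> X) \<bullet> pcomp (ps_id B) Y X = pcomp (ps_comp B (ps_op1 d) d) Y X \<bullet> (\<eta> Y \<star> \<eta> X)"
    using icon assms unfolding invertible_icon_def by blast
  then show ?thesis using assms by (simp add: ps_id_def ps_comp_def ps_op1_def)
qed

lemma \<eta>_one:
  assumes "a \<in> Obj B"
  shows "\<eta> (one B a) = dc (punit d a) \<bullet> punit d a"
proof -
  have "\<eta> (one B a) \<bullet> punit (ps_id B) a = punit (ps_comp B (ps_op1 d) d) a"
    using icon assms unfolding invertible_icon_def by blast
  then show ?thesis using assms by (simp add: ps_id_def ps_comp_def ps_op1_def)
qed

text \<open>Naturality of \<open>\<eta>\<close> recovers \<open>f\<close> from
  \<open>dc (dc f)\<close>.\<close>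

lemma dc_faithful:
  assumes "dc f = dc g" "f \<in> Cell B" "g \<in> Cell B" "dm B f = dm B g" "cd B f = cd B g"
  shows "f = g"
proof (rule iso2_mono[of "\<eta> (cd B f)"])
  show "\<eta> (cd B f) \<bullet> f = \<eta> (cd B f) \<bullet> g"
    using \<eta>_nat[OF assms(2) refl] \<eta>_nat[OF assms(3) refl] assms by simp
qed (use assms in auto)

text \<open>Since \<open>d\<close> reverses 1-morphisms, a pairing of \<open>A\<close> with
  \<open>X\<close> becomes one of \<open>D X\<close> with \<open>D A\<close>. This is the involution
  of forms before \<open>\<eta>\<close> is used to remove a double dual.\<close>

definition pairing_dual :: "'o \<Rightarrow> 'm \<Rightarrow> 'm \<Rightarrow> 'c \<Rightarrow> 'c" where
  "pairing_dual a A X e = inv2 B (punit d a) \<bullet> (dc e \<bullet> pcomp d A X)"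

lemma pairing_dual_simps [simp]:
  assumes "a \<in> Obj B" "A \<in> Mor B" "X \<in> Mor B" "src B A = trg B X"
    "e \<in> Cell B" "dm B e = A \<odot> X" "cd B e = one B a"
  shows "pairing_dual a A X e \<in> Cell B" "dm B (pairing_dual a A X e) = D X \<odot> D A"
    "cd B (pairing_dual a A X e) = one B a"
  using assms by (simp_all add: pairing_dual_def)

lemma pairing_dual_nat:
  assumes [simp]: "a \<in> Obj B" "A \<in> Mor B" "X \<in> Mor B" "src B A = trg B X"
    and e: "e \<in> cells B (A \<odot> X) (one B a)"
    and \<alpha>: "\<alpha> \<in> cells B A' A" and \<xi>: "\<xi> \<in> cells B X' X"
  shows "pairing_dual a A' X' (e \<bullet> (\<alpha> \<star> \<xi>)) = pairing_dual a A X e \<bullet> (dc \<xi> \<star> dc \<alpha>)"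
proof -
  note [simp] = cellsD[OF e] cellsD[OF \<alpha>] cellsD[OF \<xi>]
  have [simp]: "A' \<in> Mor B" "X' \<in> Mor B" "src B A' = trg B X" "trg B X' = trg B X"
    using Cell_simps[of \<alpha>] Cell_simps[of \<xi>] by auto
  show ?thesis
    using pcomp_nat[of \<xi> \<alpha> A X] by (simp add: pairing_dual_def)
qed

text \<open>Compatibility of the icon \<open>\<eta>\<close> with composition collects the
  constraints into \<open>\<eta> (A \<odot> X)\<close>; naturality at \<open>e\<close> moves it to
  the unit, where compatibility with units cancels it against the two inverse unit
  constraints.\<close>

lemma pairing_dual_dual:
  assumes [simp]: "a \<in> Obj B" "A \<in> Mor B" "X \<in> Mor B" "src B A = trg B X"
    and e: "e \<in> cells B (A \<odot> X) (one B a)"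
  shows "pairing_dual a (D X) (D A) (pairing_dual a A X e) \<bullet> (\<eta> A \<star> \<eta> X) = e"
proof -
  note [simp] = cellsD[OF e]
  have "pairing_dual a (D X) (D A) (pairing_dual a A X e) \<bullet> (\<eta> A \<star> \<eta> X) =
    inv2 B (punit d a) \<bullet> (dc (inv2 B (punit d a)) \<bullet> (dc (dc e) \<bullet> \<eta> (A \<odot> X)))"
    by (simp add: pairing_dual_def \<eta>_h1)
  also have "\<dots> = inv2 B (punit d a) \<bullet> (dc (inv2 B (punit d a)) \<bullet> (dc (punit d a) \<bullet> (punit d a \<bullet> e)))"
    using \<eta>_nat[of e "one B a"] by (simp add: \<eta>_one)
  also have "\<dots> = e"
    by (simp add: dc_inv2)
  finally show ?thesis .
qed

text \<open>\<open>d\<close> exchanges the two unitors, and they agree on the unit; hence the unit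
  pairing is its own dual up to \<open>punit\<close>.\<close>

lemma pairing_dual_one:
  assumes [simp]: "a \<in> Obj B"
  shows "pairing_dual a (one B a) (one B a) (ru B (one B a)) \<bullet> (punit d a \<star> punit d a) = ru B (one B a)"
proof -
  let ?I = "one B a"
  have "punit d a \<star> punit d a = (punit d a \<star> idt B (D ?I)) \<bullet> (idt B ?I \<star> punit d a)"
    by (simp add: interchange)
  then have "pairing_dual a ?I ?I (ru B ?I) \<bullet> (punit d a \<star> punit d a) =
    inv2 B (punit d a) \<bullet> ((dc (ru B ?I) \<bullet> (pcomp d ?I ?I \<bullet> (punit d a \<star> idt B (D ?I)))) \<bullet> (idt B ?I \<star> punit d a))"
    by (simp add: pairing_dual_def)
  also have "\<dots> = inv2 B (punit d a) \<bullet> (punit d a \<bullet> lu B ?I)"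
    using lu_nat(1)[of "punit d a" "D ?I" a] by (subst pcomp_unit(2)) simp_all
  finally show ?thesis by (simp add: lu_ru_one)
qed

text \<open>Both constraint laws of \<open>d\<close> enter: the associator is inverted and the left
  unitor becomes a right one, so cancelling in front of \<open>X\<close> is sent to cancelling
  behind \<open>D X\<close>.\<close>

lemma dc_cancel:
  assumes [simp]: "b \<in> Obj B" "X \<in> Mor B" "Y \<in> Mor B" "C \<in> Mor B"
    "trg B X = b" "src B Y = b" "src B C = trg B Y" "trg B C = b"
    and f: "f \<in> cells B (C \<odot> Y) (one B b)"
  shows "dc (cancel C Y X f) \<bullet> (pcomp d C (Y \<odot> X) \<bullet> (pcomp d Y X \<star> idt B (D C))) =
    ru B (D X) \<bullet> ((idt B (D X) \<star> pairing_dual b C Y f) \<bullet> asc B (D X) (D Y) (D C))"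
proof -
  note [simp] = cellsD[OF f]
  let ?i = "inv2 B (asc B C Y X)" and ?a = "asc B (D X) (D Y) (D C)"
  have 1: "dc ?i \<bullet> (pcomp d C (Y \<odot> X) \<bullet> (pcomp d Y X \<star> idt B (D C))) =
    pcomp d (C \<odot> Y) X \<bullet> ((idt B (D X) \<star> pcomp d C Y) \<bullet> ?a)"
  proof (rule iso2_mono[of "dc (asc B C Y X)"])
    show "dc (asc B C Y X) \<bullet> (dc ?i \<bullet> (pcomp d C (Y \<odot> X) \<bullet> (pcomp d Y X \<star> idt B (D C)))) =
      dc (asc B C Y X) \<bullet> (pcomp d (C \<odot> Y) X \<bullet> ((idt B (D X) \<star> pcomp d C Y) \<bullet> ?a))"
      using vc_ext[OF pcomp_asc[of C Y X], of ?a] by (simp add: dc_inv2)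
  qed (simp_all add: dc_inv2)
  have "dc (cancel C Y X f) \<bullet> (pcomp d C (Y \<odot> X) \<bullet> (pcomp d Y X \<star> idt B (D C))) =
    dc (lu B X) \<bullet> ((dc (f \<star> idt B X) \<bullet> pcomp d (C \<odot> Y) X) \<bullet> ((idt B (D X) \<star> pcomp d C Y) \<bullet> ?a))"
    using 1 by (simp add: cancel_def)
  also have "\<dots> = dc (lu B X) \<bullet> (pcomp d (one B b) X \<bullet> ((idt B (D X) \<star> dc f) \<bullet>
      ((idt B (D X) \<star> pcomp d C Y) \<bullet> ?a)))"
    using pcomp_nat[of "idt B X" f "one B b" X, symmetric] by simp
  also have "\<dots> = (dc (lu B X) \<bullet> (pcomp d (one B b) X \<bullet> (idt B (D X) \<star> punit d b))) \<bullet>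
      ((idt B (D X) \<star> pairing_dual b C Y f) \<bullet> ?a)"
    by (simp add: pairing_dual_def xchg)
  also have "\<dots> = ru B (D X) \<bullet> ((idt B (D X) \<star> pairing_dual b C Y f) \<bullet> ?a)"
    using pcomp_unit(1)[of X b] by (simp only: assms)
  finally show ?thesis .
qed

text \<open>\<open>dc_cancel\<close> produces the dual nested from the left, and
  \<open>pairing_comp_left\<close> identifies this with nesting from the inside. Thus the outer
  pairing stays outer, although \<open>d\<close> reverses the composition of 1-morphisms.\<close>

theorem pairing_dual_comp:
  assumes [simp]: "a \<in> Obj B" "b \<in> Obj B" "A \<in> Mor B" "X \<in> Mor B" "Y \<in> Mor B" "C \<in> Mor B"
    "src B X = a" "trg B X = b" "src B A = b" "trg B A = a"
    "src B Y = b" "src B C = trg B Y" "trg B C = b"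
    and e: "e \<in> cells B (A \<odot> X) (one B a)" and f: "f \<in> cells B (C \<odot> Y) (one B b)"
  shows "pairing_dual a (A \<odot> C) (Y \<odot> X) (pairing_comp A X C Y e f) \<bullet> (pcomp d Y X \<star> pcomp d A C) =
    pairing_comp (D X) (D A) (D Y) (D C) (pairing_dual a A X e) (pairing_dual b C Y f)"
proof -
  note [simp] = cellsD[OF e] cellsD[OF f]
  have [simp]: "pairing_dual a A X e \<in> cells B (D X \<odot> D A) (one B a)"
     "pairing_dual b C Y f \<in> cells B (D Y \<odot> D C) (one B b)"
    by (simp_all add: cellsI)
  let ?i = "inv2 B (asc B (D (Y \<odot> X)) (D C) (D A))"
  \<comment> \<open>Splitting the two constraints in this order exposes \<open>pcomp d A C\<close>
    to \<open>pcomp_asc\<close>.\<close>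
  have "pcomp d Y X \<star> pcomp d A C = (idt B (D (Y \<odot> X)) \<star> pcomp d A C) \<bullet> (pcomp d Y X \<star> idt B (D C \<odot> D A))"
    by (simp add: interchange)
  then have "pairing_dual a (A \<odot> C) (Y \<odot> X) (pairing_comp A X C Y e f) \<bullet> (pcomp d Y X \<star> pcomp d A C) =
    inv2 B (punit d a) \<bullet> (dc e \<bullet> (dc (idt B A \<star> cancel C Y X f) \<bullet>
      ((dc (asc B A C (Y \<odot> X)) \<bullet> (pcomp d (A \<odot> C) (Y \<odot> X) \<bullet> (idt B (D (Y \<odot> X)) \<star> pcomp d A C))) \<bullet>
        (pcomp d Y X \<star> idt B (D C \<odot> D A)))))"
    by (simp add: pairing_dual_def pairing_comp_def)
  also have "\<dots> = inv2 B (punit d a) \<bullet> (dc e \<bullet> ((dc (idt B A \<star> cancel C Y X f) \<bullet> pcomp d A (C \<odot> (Y \<odot> X))) \<bullet>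
      ((pcomp d C (Y \<odot> X) \<star> idt B (D A)) \<bullet> (?i \<bullet> (pcomp d Y X \<star> idt B (D C \<odot> D A))))))"
    by (subst pcomp_asc) simp_all
  also have "\<dots> = inv2 B (punit d a) \<bullet> (dc e \<bullet> (pcomp d A X \<bullet> ((dc (cancel C Y X f) \<star> idt B (D A)) \<bullet>
      ((pcomp d C (Y \<odot> X) \<star> idt B (D A)) \<bullet> (?i \<bullet> (pcomp d Y X \<star> idt B (D C \<odot> D A)))))))"
    using pcomp_nat[of "cancel C Y X f" "idt B A" A X, symmetric] by simp
  also have "\<dots> = pairing_dual a A X e \<bullet> (((dc (cancel C Y X f) \<star> idt B (D A)) \<bullet>
      ((pcomp d C (Y \<odot> X) \<star> idt B (D A)) \<bullet> (((pcomp d Y X \<star> idt B (D C)) \<star> idt B (D A)) \<bullet>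
        inv2 B (asc B (D X \<odot> D Y) (D C) (D A))))))"
    using inv_asc_nat[of "idt B (D A)" "idt B (D C)" "pcomp d Y X" "D (Y \<odot> X)" "D C" "D A"]
    by (simp add: pairing_dual_def[of a A X])
  also have "\<dots> = pairing_dual a A X e \<bullet>
      (((dc (cancel C Y X f) \<bullet> (pcomp d C (Y \<odot> X) \<bullet> (pcomp d Y X \<star> idt B (D C)))) \<star> idt B (D A)) \<bullet>
        inv2 B (asc B (D X \<odot> D Y) (D C) (D A)))"
    by (simp add: whisker_vc)
  also have "\<dots> = pairing_comp (D X) (D A) (D Y) (D C) (pairing_dual a A X e) (pairing_dual b C Y f)"
    by (simp add: dc_cancel[OF assms(2,4-6,8,11-13) f] pairing_comp_left[where a=a and b=b])
  finally show ?thesis .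
qed

end

section \<open>The forms of a 1-closed dagger bicategory\<close>

lemma right_adjointD:
  assumes "right_adjoint C D F G \<epsilon>" "y \<in> Ob D"
  shows "fo G y \<in> Ob C" "\<epsilon> y \<in> homset D (fo F (fo G y)) y"
    "x \<in> Ob C \<Longrightarrow>
      bij_betw (\<lambda>g. \<epsilon> y \<cdot>\<^bsub>D\<^esub> fa F g) (homset C x (fo G y)) (homset D (fo F x) y)"
  using assms unfolding right_adjoint_def nat_trans_def is_functor_def by auto

locale closed_dagger_bicat = dagger_bicat B d \<eta>
  for B :: "('o, 'm, 'c) bicat" (structure) and d \<eta> +
  fixes K :: "('m, 'c) closure"
  assumes closed: "one_closed B K"
begin

lemma cells_Mor:
  assumes "f \<in> cells B X Y"
  shows "X \<in> Mor B" "Y \<in> Mor B" "src B Y = src B X" "trg B Y = trg B X"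
  using assms Cell_simps[of f] by (auto simp: cells_def)

abbreviation res_a where "res_a \<equiv> res B K"
abbreviation ev where "ev \<equiv> res_ev B K"

section \<open>The closures at the unit and their universal pairings\<close>

lemma precomp_adjoint:
  assumes "X \<in> Mor B" "src B X = a"
  shows "right_adjoint (hom B (trg B X) a) (hom B a a) (precomp B X) (rexp K X) (rcounit K X)"
  using closed assms src_trg_Obj[of X] unfolding one_closed_def by auto

lemma postcomp_adjoint:
  assumes "Z \<in> Mor B" "trg B Z = a"
  shows "right_adjoint (hom B a (src B Z)) (hom B a a) (postcomp B Z) (lexp K Z) (lcounit K Z)"
  using closed assms src_trg_Obj[of Z] unfolding one_closed_def by auto

lemma res_simps [simp]:
  assumes "X \<in> Mor B" "src B X = a"
  shows "res_a a X \<in> Mor B" "src B (res_a a X) = trg B X" "trg B (res_a a X) = a"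
    "ev a X \<in> Cell B" "dm B (ev a X) = res_a a X \<odot> X" "cd B (ev a X) = one B a"
proof -
  have "one B a \<in> Ob (hom B a a)" using assms src_trg_Obj(1)[of X] by simp
  note * = right_adjointD(1,2)[OF precomp_adjoint[OF assms] this]
  show "res_a a X \<in> Mor B" "src B (res_a a X) = trg B X" "trg B (res_a a X) = a"
    "ev a X \<in> Cell B" "dm B (ev a X) = res_a a X \<odot> X" "cd B (ev a X) = one B a"
    using * by (auto simp: res_def res_ev_def precomp_def dest: cellsD)
qed

lemma res_bij:
  assumes "X \<in> Mor B" "src B X = a" "W \<in> Mor B" "src B W = trg B X" "trg B W = a"
  shows "bij_betw (\<lambda>g. ev a X \<bullet> (g \<star> idt B X)) (cells B W (res_a a X))
    (cells B (W \<odot> X) (one B a))"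
proof -
  have "one B a \<in> Ob (hom B a a)" using assms src_trg_Obj(1)[of X] by simp
  from right_adjointD(3)[OF precomp_adjoint[OF assms(1,2)] this, of W]
  have "bij_betw (\<lambda>g. ev a X \<bullet> (g \<star> idt B X)) (homset (hom B (trg B X) a) W (res_a a X))
    (homset (hom B a a) (W \<odot> X) (one B a))"
    using assms by (simp add: precomp_def res_def res_ev_def)
  moreover have "homset (hom B (trg B X) a) W (res_a a X) = cells B W (res_a a X)"
    "homset (hom B a a) (W \<odot> X) (one B a) = cells B (W \<odot> X) (one B a)"
    using assms by auto
  ultimately show ?thesis by simp
qed

lemma res_inj:
  assumes "X \<in> Mor B" "src B X = a" "W \<in> Mor B" "src B W = trg B X" "trg B W = a"
    "ev a X \<bullet> (g \<star> idt B X) = ev a X \<bullet> (h \<star> idt B X)"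
    "g \<in> cells B W (res_a a X)" "h \<in> cells B W (res_a a X)"
  shows "g = h"
  using res_bij[OF assms(1-5)] assms(6-8) by (auto simp: bij_betw_def inj_on_def)

lemma radj:
  assumes "X \<in> Mor B" "src B X = a" "W \<in> Mor B" "src B W = trg B X" "trg B W = a"
    and f: "f \<in> cells B (W \<odot> X) (one B a)"
  shows "radj B K X W (one B a) f \<in> cells B W (res_a a X)" (is "?g \<in> _")
    "ev a X \<bullet> (radj B K X W (one B a) f \<star> idt B X) = f"
proof -
  obtain g where g: "g \<in> cells B W (res_a a X)" "ev a X \<bullet> (g \<star> idt B X) = f"
    using res_bij[OF assms(1-5)] f unfolding bij_betw_def by (metis (no_types, lifting) imageE)
  have "?g \<in> cells B W (fo (rexp K X) (one B a)) \<and> rcounit K X (one B a) \<bullet> (?g \<star> idt B X) = f"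
    unfolding radj_def
    by (rule theI[of _ g]) (use g res_inj[OF assms(1-5)] in \<open>auto simp: res_def res_ev_def\<close>)
  then show "?g \<in> cells B W (res_a a X)" "ev a X \<bullet> (?g \<star> idt B X) = f"
    by (auto simp: res_def res_ev_def)
qed

definition lres :: "'o \<Rightarrow> 'm \<Rightarrow> 'm" where "lres a Z = fo (lexp K Z) (one B a)"
definition lev :: "'o \<Rightarrow> 'm \<Rightarrow> 'c" where "lev a Z = lcounit K Z (one B a)"

lemma lres_simps [simp]:
  assumes "Z \<in> Mor B" "trg B Z = a"
  shows "lres a Z \<in> Mor B" "src B (lres a Z) = a" "trg B (lres a Z) = src B Z"
    "lev a Z \<in> Cell B" "dm B (lev a Z) = Z \<odot> lres a Z" "cd B (lev a Z) = one B a"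
proof -
  have "one B a \<in> Ob (hom B a a)" using assms src_trg_Obj(2)[of Z] by simp
  note * = right_adjointD(1,2)[OF postcomp_adjoint[OF assms] this]
  show "lres a Z \<in> Mor B" "src B (lres a Z) = a" "trg B (lres a Z) = src B Z"
    "lev a Z \<in> Cell B" "dm B (lev a Z) = Z \<odot> lres a Z" "cd B (lev a Z) = one B a"
    using * by (auto simp: lres_def lev_def postcomp_def dest: cellsD)
qed

lemma lres_bij:
  assumes "Z \<in> Mor B" "trg B Z = a" "W \<in> Mor B" "src B W = a" "trg B W = src B Z"
  shows "bij_betw (\<lambda>g. lev a Z \<bullet> (idt B Z \<star> g)) (cells B W (lres a Z))
    (cells B (Z \<odot> W) (one B a))"
proof -
  have "one B a \<in> Ob (hom B a a)" using assms src_trg_Obj(2)[of Z] by simp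
  from right_adjointD(3)[OF postcomp_adjoint[OF assms(1,2)] this, of W]
  have "bij_betw (\<lambda>g. lev a Z \<bullet> (idt B Z \<star> g)) (homset (hom B a (src B Z)) W (lres a Z))
    (homset (hom B a a) (Z \<odot> W) (one B a))"
    using assms by (simp add: postcomp_def lres_def lev_def)
  moreover have "homset (hom B a (src B Z)) W (lres a Z) = cells B W (lres a Z)"
    "homset (hom B a a) (Z \<odot> W) (one B a) = cells B (Z \<odot> W) (one B a)"
    using assms by auto
  ultimately show ?thesis by simp
qed

lemma lres_inj:
  assumes "Z \<in> Mor B" "trg B Z = a" "W \<in> Mor B" "src B W = a" "trg B W = src B Z"
    "lev a Z \<bullet> (idt B Z \<star> g) = lev a Z \<bullet> (idt B Z \<star> h)"
    "g \<in> cells B W (lres a Z)" "h \<in> cells B W (lres a Z)"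
  shows "g = h"
  using lres_bij[OF assms(1-5)] assms(6-8) by (auto simp: bij_betw_def inj_on_def)

lemma ladj:
  assumes "Z \<in> Mor B" "trg B Z = a" "W \<in> Mor B" "src B W = a" "trg B W = src B Z"
    and f: "f \<in> cells B (Z \<odot> W) (one B a)"
  shows "ladj B K Z W (one B a) f \<in> cells B W (lres a Z)" (is "?g \<in> _")
    "lev a Z \<bullet> (idt B Z \<star> ladj B K Z W (one B a) f) = f"
proof -
  obtain g where g: "g \<in> cells B W (lres a Z)" "lev a Z \<bullet> (idt B Z \<star> g) = f"
    using lres_bij[OF assms(1-5)] f unfolding bij_betw_def by (metis (no_types, lifting) imageE)
  have "?g \<in> cells B W (fo (lexp K Z) (one B a)) \<and> lcounit K Z (one B a) \<bullet> (idt B Z \<star> ?g) = f"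
    unfolding ladj_def
    by (rule theI[of _ g]) (use g lres_inj[OF assms(1-5)] in \<open>auto simp: lres_def lev_def\<close>)
  then show "?g \<in> cells B W (lres a Z)" "lev a Z \<bullet> (idt B Z \<star> ?g) = f"
    by (auto simp: lres_def lev_def)
qed

subsection \<open>The dual pairing is universal\<close>

abbreviation dpair where "dpair \<equiv> dual_pairing B d \<eta> K"

lemma dpair_eq:
  assumes [simp]: "a \<in> Obj B" "Z \<in> Mor B" "trg B Z = a"
  shows "dpair a Z = pairing_dual a (res_a a (D Z)) (D Z) (ev a (D Z)) \<bullet>
    (\<eta> Z \<star> idt B (D (res_a a (D Z))))"
  by (simp add: dual_pairing_def pairing_dual_def)

lemma dpair_simps [simp]:
  assumes "a \<in> Obj B" "Z \<in> Mor B" "trg B Z = a"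
  shows "dpair a Z \<in> Cell B" "dm B (dpair a Z) = Z \<odot> D (res_a a (D Z))"
    "cd B (dpair a Z) = one B a"
  using assms by (simp_all add: dpair_eq)

text \<open>The dual of the dual pairing is the original evaluation up to \<open>\<eta>\<close>.
  Dualising puts \<open>dc (\<eta> Z)\<close> into the second factor; coherence rewrites it as
  \<open>\<eta> (D Z)\<close>, and \<open>pairing_dual_dual\<close> applies.\<close>

lemma pairing_dual_dpair:
  assumes [simp]: "a \<in> Obj B" "Z \<in> Mor B" "trg B Z = a"
  shows "pairing_dual a Z (D (res_a a (D Z))) (dpair a Z) =
    ev a (D Z) \<bullet> (inv2 B (\<eta> (res_a a (D Z))) \<star> idt B (D Z))"
proof -
  let ?R = "res_a a (D Z)" and ?e = "ev a (D Z)"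
  have e: "?e \<in> cells B (?R \<odot> D Z) (one B a)" by (simp add: cellsI)
  have "pairing_dual a Z (D ?R) (dpair a Z) =
    pairing_dual a (D (D Z)) (D ?R) (pairing_dual a ?R (D Z) ?e) \<bullet> (idt B (D (D ?R)) \<star> \<eta> (D Z))"
    unfolding dpair_eq[OF assms] using e
    by (subst pairing_dual_nat[where A="D (D Z)" and X="D ?R"]) (simp_all add: cellsI)
  also have "idt B (D (D ?R)) \<star> \<eta> (D Z) = (\<eta> ?R \<star> \<eta> (D Z)) \<bullet> (inv2 B (\<eta> ?R) \<star> idt B (D Z))"
    by (simp add: interchange)
  finally show ?thesis
    using vc_ext[OF pairing_dual_dual[OF _ _ _ _ e], of "inv2 B (\<eta> ?R) \<star> idt B (D Z)"] by simp
qed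

text \<open>Dualising turns the equation into one about \<open>ev a (D Z)\<close>, where the right
  closure gives uniqueness; \<open>dc\<close> is then cancelled by faithfulness.\<close>

lemma dpair_inj:
  assumes [simp]: "a \<in> Obj B" "Z \<in> Mor B" "trg B Z = a"
    and eq: "dpair a Z \<bullet> (idt B Z \<star> g) = dpair a Z \<bullet> (idt B Z \<star> h)"
    and g: "g \<in> cells B W (D (res_a a (D Z)))" and h: "h \<in> cells B W (D (res_a a (D Z)))"
  shows "g = h"
proof -
  let ?R = "res_a a (D Z)" and ?e = "ev a (D Z)"
  note [simp] = cellsD[OF g] cellsD[OF h]
  have [simp]: "W \<in> Mor B" "trg B W = src B Z" "src B W = a"
    using cells_Mor[OF g] by simp_all
  have *: "pairing_dual a Z W (dpair a Z \<bullet> (idt B Z \<star> k)) =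
    ?e \<bullet> ((inv2 B (\<eta> ?R) \<bullet> dc k) \<star> idt B (D Z))" if k: "k \<in> cells B W (D ?R)" for k
  proof -
    note [simp] = cellsD[OF k]
    have "pairing_dual a Z W (dpair a Z \<bullet> (idt B Z \<star> k)) =
        pairing_dual a Z (D ?R) (dpair a Z) \<bullet> (dc k \<star> idt B (D Z))"
      by (subst pairing_dual_nat[where A=Z and X="D ?R"]) (simp_all add: cellsI)
    then show ?thesis by (simp add: pairing_dual_dpair interchange)
  qed
  have "inv2 B (\<eta> ?R) \<bullet> dc g = inv2 B (\<eta> ?R) \<bullet> dc h"
    by (rule res_inj[of "D Z" a "D W"])
      (use *[OF g] *[OF h] eq in \<open>simp_all add: cellsI\<close>)
  then have "dc g = dc h"
    by (rule iso2_mono) (simp_all add: iso2_inv2)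
  then show ?thesis by (rule dc_faithful) simp_all
qed

lemma dpair_ex:
  assumes [simp]: "a \<in> Obj B" "Z \<in> Mor B" "trg B Z = a" "W \<in> Mor B" "src B W = a" "trg B W = src B Z"
    and f: "f \<in> cells B (Z \<odot> W) (one B a)"
  shows "\<exists>g\<in>cells B W (D (res_a a (D Z))). dpair a Z \<bullet> (idt B Z \<star> g) = f"
proof -
  let ?R = "res_a a (D Z)" and ?e = "ev a (D Z)"
  note [simp] = cellsD[OF f]
  have e: "?e \<in> cells B (?R \<odot> D Z) (one B a)" by (simp add: cellsI)
  \<comment> \<open>The witness is transported through \<open>d\<close>: \<open>h\<close> is the
    adjunct of the dual of \<open>f\<close>, and \<open>dc h \<bullet> \<eta> W\<close> runs from
    \<open>W\<close> over \<open>D (D W)\<close> to \<open>D ?R\<close>.\<close>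
  define h where "h = radj B K (D Z) (D W) (one B a) (pairing_dual a Z W f)"
  have h: "h \<in> cells B (D W) ?R" "?e \<bullet> (h \<star> idt B (D Z)) = pairing_dual a Z W f"
    unfolding h_def by (rule radj; simp add: cellsI)+
  note [simp] = cellsD[OF h(1)]
  have "dpair a Z \<bullet> (idt B Z \<star> (dc h \<bullet> \<eta> W)) =
    pairing_dual a ?R (D Z) ?e \<bullet> ((idt B (D (D Z)) \<star> dc h) \<bullet> (\<eta> Z \<star> \<eta> W))"
    by (simp add: dpair_eq interchange)
  also have "\<dots> = pairing_dual a (D W) (D Z) (?e \<bullet> (h \<star> idt B (D Z))) \<bullet> (\<eta> Z \<star> \<eta> W)"
    by (subst pairing_dual_nat[where A="?R" and X="D Z"]) (simp_all add: e h cellsI)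
  also have "\<dots> = f"
    using h(2) f by (simp add: pairing_dual_dual)
  finally show ?thesis by (intro bexI[of _ "dc h \<bullet> \<eta> W"]) (simp_all add: cellsI)
qed

text \<open>\<open>dpair a Z\<close> and \<open>lev a Z\<close> are both universal among pairings of
  \<open>Z\<close> into the unit, so the comparison and the factorisation \<open>k\<close> of
  \<open>lev a Z\<close> through \<open>dpair a Z\<close> are mutually inverse.\<close>

lemma dual_comparison:
  assumes [simp]: "a \<in> Obj B" "Z \<in> Mor B" "trg B Z = a"
  shows "dual_comparison B d \<eta> K a Z \<in> cells B (D (res_a a (D Z))) (lres a Z)" (is "?c \<in> _")
    "lev a Z \<bullet> (idt B Z \<star> dual_comparison B d \<eta> K a Z) = dpair a Z"
    "iso2 (dual_comparison B d \<eta> K a Z)"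
proof -
  let ?R = "D (res_a a (D Z))"
  show c: "?c \<in> cells B ?R (lres a Z)" and cp: "lev a Z \<bullet> (idt B Z \<star> ?c) = dpair a Z"
    unfolding dual_comparison_def by (rule ladj; simp add: cellsI)+
  obtain k where k: "k \<in> cells B (lres a Z) ?R" "dpair a Z \<bullet> (idt B Z \<star> k) = lev a Z"
    using dpair_ex[of a Z "lres a Z" "lev a Z"] by (auto simp: cellsI)
  note [simp] = cellsD[OF c] cellsD[OF k(1)]
  have "k \<bullet> ?c = idt B ?R"
  proof (rule dpair_inj[of a Z _ _ ?R])
    show "dpair a Z \<bullet> (idt B Z \<star> (k \<bullet> ?c)) = dpair a Z \<bullet> (idt B Z \<star> idt B ?R)"
      using vc_ext[OF k(2), of "idt B Z \<star> ?c"] cp by (simp add: whisker_vc)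
  qed (simp_all add: cellsI)
  moreover have "?c \<bullet> k = idt B (lres a Z)"
  proof (rule lres_inj[of Z a "lres a Z"])
    show "lev a Z \<bullet> (idt B Z \<star> (?c \<bullet> k)) = lev a Z \<bullet> (idt B Z \<star> idt B (lres a Z))"
      using vc_ext[OF cp, of "idt B Z \<star> k"] k(2) by (simp add: whisker_vc)
  qed (simp_all add: cellsI)
  ultimately show "iso2 ?c" by (intro iso2_inverse(1)[of _ k]) simp_all
qed

text \<open>The comparison and its inverse cancel, which leaves an equation free of left adjuncts:
  \<open>etabar\<close> is the factorisation of \<open>ev a X\<close> through the dual pairing of
  \<open>res_a a X\<close>.\<close>

lemma etabar:
  assumes [simp]: "X \<in> Mor B" "src B X = a" "a \<in> Obj B"
  shows "etabar B d \<eta> K a X \<in> cells B X (D (res_a a (D (res_a a X))))" (is "?h \<in> _")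
    "dpair a (res_a a X) \<bullet> (idt B (res_a a X) \<star> etabar B d \<eta> K a X) = ev a X"
proof -
  let ?Z = "res_a a X"
  let ?c = "dual_comparison B d \<eta> K a ?Z" and ?l = "ladj B K ?Z X (one B a) (ev a X)"
  have l: "?l \<in> cells B X (lres a ?Z)" "lev a ?Z \<bullet> (idt B ?Z \<star> ?l) = ev a X"
    by (rule ladj; simp add: cellsI)+
  note c = dual_comparison[of a ?Z, simplified]
  note [simp] = cellsD[OF l(1)] cellsD[OF c(1)] c(3)
  show "?h \<in> cells B X (D (res_a a (D ?Z)))" unfolding etabar_def by (simp add: cellsI)
  have "dpair a ?Z \<bullet> (idt B ?Z \<star> ?h) = lev a ?Z \<bullet> ((idt B ?Z \<star> ?c) \<bullet> (idt B ?Z \<star> ?h))"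
    using c(2)[symmetric] by (simp add: etabar_def)
  also have "\<dots> = ev a X"
    using l(2) by (simp add: etabar_def interchange)
  finally show "dpair a ?Z \<bullet> (idt B ?Z \<star> ?h) = ev a X" .
qed

subsection \<open>The form on a hom-category\<close>

text \<open>Forms at \<open>X\<close> are to be represented by \<open>D (res_a a X)\<close>, which
  the first slot of \<open>hform\<close> dualises once more; the inverse of \<open>\<eta>\<close>
  takes \<open>D (D (res_a a X))\<close> back to \<open>res_a a X\<close>, where \<open>ev\<close>
  is available.\<close>

definition uform :: "'o \<Rightarrow> 'm \<Rightarrow> 'c" where
  "uform a X = ev a X \<bullet> (inv2 B (\<eta> (res_a a X)) \<star> idt B X)"

text \<open>In \<open>flip\<close>, dualising a pairing of \<open>D X'\<close> with \<open>X\<close>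
  gives one of \<open>D X\<close> with \<open>D (D X')\<close>, and \<open>\<eta> X'\<close> returns
  the last factor to \<open>X'\<close>.\<close>

definition hform :: "'o \<Rightarrow> ('m, 'c, 'c) form" where
  "hform a = \<lparr>Frm = (\<lambda>X' X. cells B (D X' \<odot> X) (one B a)),
     act = (\<lambda>f' f \<phi>. \<phi> \<bullet> (dc f' \<star> f)),
     flip = (\<lambda>X' X \<phi>. pairing_dual a (D X') X \<phi> \<bullet> (idt B (D X) \<star> \<eta> X')),
     uni = uform a\<rparr>"

lemma hform_simps [simp]:
  "Frm (hform a) X' X = cells B (D X' \<odot> X) (one B a)"
  "act (hform a) f' f \<phi> = \<phi> \<bullet> (dc f' \<star> f)"
  "flip (hform a) X' X \<phi> = pairing_dual a (D X') X \<phi> \<bullet> (idt B (D X) \<star> \<eta> X')"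
  "uni (hform a) = uform a"
  by (simp_all add: hform_def)

abbreviation HV where "HV \<equiv> hom_volutive B d \<eta> K"

lemma HV_simps [simp]:
  "ucat (HV a b) = hom B a b" "fo (vd (HV a b)) X = D (res_a a X)"
  "fa (vd (HV a b)) f = dc (res2 B K a f)" "veta (HV a b) = etabar B d \<eta> K a"
  by (simp_all add: hom_volutive_def dbar_def)

lemma uform_simps [simp]:
  assumes "X \<in> Mor B" "src B X = a"
  shows "uform a X \<in> Cell B" "dm B (uform a X) = D (D (res_a a X)) \<odot> X"
    "cd B (uform a X) = one B a"
  using assms by (simp_all add: uform_def)

text \<open>\<open>dbar\<close> on cells, \<open>comp_str\<close> and \<open>unit_str\<close> all
  contain \<open>dc\<close> of an adjunct, and \<open>act\<close> applies \<open>dc\<close> once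
  more; naturality of the inverse of \<open>\<eta>\<close> removes the double dual and exposes the
  adjunct to \<open>ev\<close>.\<close>

lemma uform_dc:
  assumes "X \<in> Mor B" "src B X = a" "f \<in> Cell B" "cd B f = res_a a X"
  shows "uform a X \<bullet> (dc (dc f) \<star> idt B X) =
    ev a X \<bullet> ((f \<star> idt B X) \<bullet> (inv2 B (\<eta> (dm B f)) \<star> idt B X))"
  using assms Cell_simps(3,4)[OF assms(3)] by (simp add: uform_def interchange inv_\<eta>_nat)

lemma res2:
  assumes f: "f \<in> cells B X Y" and a [simp]: "src B X = a"
  shows "res2 B K a f \<in> cells B (res_a a Y) (res_a a X)"
    "ev a X \<bullet> (res2 B K a f \<star> idt B X) = ev a Y \<bullet> (idt B (res_a a Y) \<star> f)"
proof -
  note [simp] = cellsD[OF f] cells_Mor[OF f]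
  show "res2 B K a f \<in> cells B (res_a a Y) (res_a a X)"
    "ev a X \<bullet> (res2 B K a f \<star> idt B X) = ev a Y \<bullet> (idt B (res_a a Y) \<star> f)"
    using radj[of X a "res_a a Y" "ev a Y \<bullet> (idt B (res_a a Y) \<star> f)"]
    by (simp_all add: res2_def cellsI)
qed

text \<open>The main axioms have these sources: \<open>flip_act\<close> is
  \<open>pairing_dual_nat\<close>, \<open>flip_flip\<close> is \<open>pairing_dual_dual\<close>,
  \<open>uni_inj\<close> is uniqueness for the right closure, \<open>d_char\<close> is the defining
  equation of \<open>res2\<close>, and \<open>eta_char\<close> is the factorisation of
  \<open>ev\<close> by \<open>etabar\<close>.\<close>

lemma volutive_form_HV:
  assumes [simp]: "a \<in> Obj B" "b \<in> Obj B"
  shows "volutive_form (HV a b) (hform a)"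
proof (rule volutive_form.intro)
  show "category (ucat (HV a b))" by (simp add: category_hom)
next
  fix f g x x' y y' \<phi>
  assume *: "f \<in> homset (ucat (HV a b)) x' x" "g \<in> homset (ucat (HV a b)) y' y"
    "\<phi> \<in> Frm (hform a) x y"
  then have f: "f \<in> cells B x' x" and g: "g \<in> cells B y' y" and \<phi>: "\<phi> \<in> cells B (D x \<odot> y) (one B a)"
    and [simp]: "src B x' = a" "trg B x' = b" "src B y' = a" "trg B y' = b" by auto
  note [simp] = cellsD[OF f] cellsD[OF g] cellsD[OF \<phi>] cells_Mor[OF f] cells_Mor[OF g]
  show "act (hform a) f g \<phi> \<in> Frm (hform a) x' y'" by (simp add: cellsI)
  have "pairing_dual a (D x') y' (\<phi> \<bullet> (dc f \<star> g)) = pairing_dual a (D x) y \<phi> \<bullet> (dc g \<star> dc (dc f))"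
    by (rule pairing_dual_nat) (use \<phi> f g in \<open>simp_all add: cellsI\<close>)
  then show "flip (hform a) x' y' (act (hform a) f g \<phi>) = act (hform a) g f (flip (hform a) x y \<phi>)"
    using \<eta>_nat[of f x] by (simp add: interchange)
next
  fix x y \<phi>
  assume *: "x \<in> Ob (ucat (HV a b))" "y \<in> Ob (ucat (HV a b))" "\<phi> \<in> Frm (hform a) x y"
  then have \<phi>: "\<phi> \<in> cells B (D x \<odot> y) (one B a)" and
    [simp]: "x \<in> Mor B" "src B x = a" "trg B x = b" "y \<in> Mor B" "src B y = a" "trg B y = b" by auto
  note [simp] = cellsD[OF \<phi>]
  show "act (hform a) (Id (ucat (HV a b)) x) (Id (ucat (HV a b)) y) \<phi> = \<phi>" by simp
  show "flip (hform a) x y \<phi> \<in> Frm (hform a) y x" by (simp add: cellsI)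
  \<comment> \<open>Coherence enters here: the dual of \<open>\<eta> x\<close> is
    \<open>\<eta> (D x)\<close>, the cell that \<open>pairing_dual_dual\<close> expects.\<close>
  have "pairing_dual a (D y) x (pairing_dual a (D x) y \<phi> \<bullet> (idt B (D y) \<star> \<eta> x)) =
    pairing_dual a (D y) (D (D x)) (pairing_dual a (D x) y \<phi>) \<bullet> (\<eta> (D x) \<star> idt B (D (D y)))"
    by (subst pairing_dual_nat[where A="D y" and X="D (D x)"]) (simp_all add: cellsI)
  then show "flip (hform a) y x (flip (hform a) x y \<phi>) = \<phi>"
    using pairing_dual_dual[of a "D x" y \<phi>] \<phi> by (simp add: interchange)
next
  fix f g f' g' x x' x'' y y' y'' \<phi>
  assume *: "f \<in> homset (ucat (HV a b)) x' x" "g \<in> homset (ucat (HV a b)) y' y"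
    "f' \<in> homset (ucat (HV a b)) x'' x'" "g' \<in> homset (ucat (HV a b)) y'' y'"
    "\<phi> \<in> Frm (hform a) x y"
  then have f: "f \<in> cells B x' x" and g: "g \<in> cells B y' y" and f': "f' \<in> cells B x'' x'"
    and g': "g' \<in> cells B y'' y'" and \<phi>: "\<phi> \<in> cells B (D x \<odot> y) (one B a)"
    and [simp]: "src B x' = a" "trg B x' = b" "src B y' = a" "trg B y' = b" by auto
  note [simp] = cellsD[OF f] cellsD[OF g] cellsD[OF f'] cellsD[OF g'] cellsD[OF \<phi>]
    cells_Mor(1,2)[OF f] cells_Mor(1,2)[OF g] cells_Mor(1,2)[OF f'] cells_Mor(1,2)[OF g']
    cells_Mor(3,4)[OF f', symmetric] cells_Mor(3,4)[OF g', symmetric]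
    cells_Mor(3,4)[OF f] cells_Mor(3,4)[OF g]
  show "act (hform a) f' g' (act (hform a) f g \<phi>) =
    act (hform a) (f \<cdot>\<^bsub>ucat (HV a b)\<^esub> f') (g \<cdot>\<^bsub>ucat (HV a b)\<^esub> g') \<phi>"
    by (simp add: interchange)
next
  fix x assume "x \<in> Ob (ucat (HV a b))"
  then have [simp]: "x \<in> Mor B" "src B x = a" "trg B x = b" by auto
  show "fo (vd (HV a b)) x \<in> Ob (ucat (HV a b))" by simp
  show "uni (hform a) x \<in> Frm (hform a) (fo (vd (HV a b)) x) x" by (simp add: cellsI)
  let ?h = "etabar B d \<eta> K a x" and ?Z = "res_a a x"
  note h = etabar[of x a, simplified]
  note [simp] = cellsD[OF h(1)]
  show "veta (HV a b) x \<in> homset (ucat (HV a b)) x (fo (vd (HV a b)) (fo (vd (HV a b)) x))"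
    using h(1) by simp
  have u: "uform a (D ?Z) \<in> cells B (D (D (res_a a (D ?Z))) \<odot> D ?Z) (one B a)" by (simp add: cellsI)
  \<comment> \<open>With \<open>ev a x\<close> written through \<open>etabar\<close> and the dual
    pairing, the \<open>\<eta> ?Z\<close> of the dual pairing cancels its inverse in
    \<open>uform\<close>.\<close>
  have 1: "uform a x = pairing_dual a (res_a a (D ?Z)) (D ?Z) (ev a (D ?Z)) \<bullet> (idt B (D (D ?Z)) \<star> ?h)"
    using h(2)[symmetric] by (simp add: uform_def dpair_eq interchange)
  let ?p = "pairing_dual a (D (D ?Z)) (D (res_a a (D ?Z)))
    (pairing_dual a (res_a a (D ?Z)) (D ?Z) (ev a (D ?Z)))"
  have "pairing_dual a (D (D ?Z)) x (uform a x) = ?p \<bullet> (dc ?h \<star> idt B (D (D (D ?Z))))"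
    unfolding 1
    by (subst pairing_dual_nat[where A="D (D ?Z)" and X="D (res_a a (D ?Z))"])
      (simp_all add: cellsI)
  then have "pairing_dual a (D (D ?Z)) x (uform a x) \<bullet> (idt B (D x) \<star> \<eta> (D ?Z)) =
    (?p \<bullet> (\<eta> (res_a a (D ?Z)) \<star> \<eta> (D ?Z))) \<bullet>
      ((inv2 B (\<eta> (res_a a (D ?Z))) \<bullet> dc ?h) \<star> idt B (D ?Z))"
    by (simp add: interchange)
  also have "\<dots> = uform a (D ?Z) \<bullet> (dc ?h \<star> idt B (D ?Z))"
    by (subst pairing_dual_dual) (simp_all add: cellsI uform_def interchange)
  finally show "act (hform a) (veta (HV a b) x) (Id (ucat (HV a b)) (fo (vd (HV a b)) x))
      (uni (hform a) (fo (vd (HV a b)) x)) = flip (hform a) (fo (vd (HV a b)) x) x (uni (hform a) x)"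
    by simp
next
  fix x y f g
  assume *: "f \<in> homset (ucat (HV a b)) x (fo (vd (HV a b)) y)"
    "g \<in> homset (ucat (HV a b)) x (fo (vd (HV a b)) y)" "y \<in> Ob (ucat (HV a b))"
    and eq: "act (hform a) f (Id (ucat (HV a b)) y) (uni (hform a) y) =
       act (hform a) g (Id (ucat (HV a b)) y) (uni (hform a) y)"
  then have f: "f \<in> cells B x (D (res_a a y))" and g: "g \<in> cells B x (D (res_a a y))"
    and [simp]: "src B x = a" "trg B x = b" "src B y = a" "trg B y = b" "y \<in> Mor B" by auto
  note [simp] = cellsD[OF f] cellsD[OF g] cells_Mor(1)[OF f]
  let ?i = "inv2 B (\<eta> (res_a a y))"
  \<comment> \<open>\<open>?i \<bullet> dc f\<close> is the cell from \<open>D x\<close> to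
    \<open>res_a a y\<close> through which the pulled back form factors over \<open>ev a y\<close>;
    the closure makes it unique.\<close>
  have "?i \<bullet> dc f = ?i \<bullet> dc g"
    by (rule res_inj[of y a "D x"]) (use eq in \<open>simp_all add: cellsI uform_def interchange\<close>)
  then have "dc f = dc g"
    by (rule iso2_mono) (simp_all add: iso2_inv2)
  then show "f = g" by (rule dc_faithful) simp_all
next
  fix f x y assume *: "f \<in> homset (ucat (HV a b)) x y"
  then have f: "f \<in> cells B x y" and [simp]: "src B x = a" "trg B x = b" by auto
  note [simp] = cellsD[OF f] cells_Mor[OF f]
  note r = res2[OF f, of a, simplified]
  note [simp] = cellsD[OF r(1)]
  show "fa (vd (HV a b)) f \<in> homset (ucat (HV a b)) (fo (vd (HV a b)) y) (fo (vd (HV a b)) x)"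
    by (simp add: cellsI)
  show "act (hform a) (fa (vd (HV a b)) f) (Id (ucat (HV a b)) x) (uni (hform a) x) =
    act (hform a) (Id (ucat (HV a b)) (fo (vd (HV a b)) y)) f (uni (hform a) y)"
    using vc_ext[OF r(2), of "inv2 B (\<eta> (res_a a y)) \<star> idt B x"] uform_dc[of x a "res2 B K a f"]
    by (simp add: interchange uform_def)
qed

section \<open>Composition and units as form maps\<close>

lemma inv_pcomp_nat:
  assumes [simp]: "f \<in> Cell B" "g \<in> Cell B" "src B (dm B g) = trg B (dm B f)"
  shows "inv2 B (pcomp d (cd B g) (cd B f)) \<bullet> dc (g \<star> f) =
    (dc f \<star> dc g) \<bullet> inv2 B (pcomp d (dm B g) (dm B f))"
proof (rule iso2_mono[of "pcomp d (cd B g) (cd B f)"])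
  show "pcomp d (cd B g) (cd B f) \<bullet> (inv2 B (pcomp d (cd B g) (cd B f)) \<bullet> dc (g \<star> f)) =
    pcomp d (cd B g) (cd B f) \<bullet> ((dc f \<star> dc g) \<bullet> inv2 B (pcomp d (dm B g) (dm B f)))"
    using vc_ext[OF pcomp_nat[OF assms refl refl], of "inv2 B (pcomp d (dm B g) (dm B f))"] by simp
qed simp_all

lemma inv_\<eta>_h1:
  assumes [simp]: "X \<in> Mor B" "Y \<in> Mor B" "src B Y = trg B X"
  shows "inv2 B (\<eta> (Y \<odot> X)) \<bullet> dc (pcomp d Y X) =
    (inv2 B (\<eta> Y) \<star> inv2 B (\<eta> X)) \<bullet> inv2 B (pcomp d (D X) (D Y))"
proof (rule iso2_mono[of "\<eta> (Y \<odot> X)"])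
  show "\<eta> (Y \<odot> X) \<bullet> (inv2 B (\<eta> (Y \<odot> X)) \<bullet> dc (pcomp d Y X)) =
    \<eta> (Y \<odot> X) \<bullet> ((inv2 B (\<eta> Y) \<star> inv2 B (\<eta> X)) \<bullet> inv2 B (pcomp d (D X) (D Y)))"
    by (simp add: \<eta>_h1 interchange_ext del: dc_vc) (simp add: \<eta>_h1[symmetric])
qed simp_all

lemma inv_\<eta>_one:
  assumes [simp]: "a \<in> Obj B"
  shows "inv2 B (\<eta> (one B a)) \<bullet> dc (punit d a) = inv2 B (punit d a)"
proof (rule iso2_mono[of "\<eta> (one B a)"])
  show "\<eta> (one B a) \<bullet> (inv2 B (\<eta> (one B a)) \<bullet> dc (punit d a)) = \<eta> (one B a) \<bullet> inv2 B (punit d a)"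
    by simp (simp add: \<eta>_one)
qed simp_all

text \<open>This is the associativity law of \<open>d\<close> in terms of the inverse constraints
  that \<open>form_comp\<close> contains; precomposition with an invertible cell brings back
  \<open>pcomp_asc\<close>.\<close>

lemma inv_pcomp_asc:
  assumes [simp]: "W \<in> Mor B" "Y \<in> Mor B" "X \<in> Mor B" "src B W = trg B Y" "src B Y = trg B X"
  shows "asc B (D X) (D Y) (D W) \<bullet> ((inv2 B (pcomp d Y X) \<star> idt B (D W)) \<bullet>
      (inv2 B (pcomp d W (Y \<odot> X)) \<bullet> dc (asc B W Y X))) =
    (idt B (D X) \<star> inv2 B (pcomp d W Y)) \<bullet> inv2 B (pcomp d (W \<odot> Y) X)"
proof (rule iso2_epi[of _ "pcomp d (W \<odot> Y) X \<bullet> (idt B (D X) \<star> pcomp d W Y)"])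
  show "asc B (D X) (D Y) (D W) \<bullet> ((inv2 B (pcomp d Y X) \<star> idt B (D W)) \<bullet>
      (inv2 B (pcomp d W (Y \<odot> X)) \<bullet> dc (asc B W Y X))) \<bullet>
      (pcomp d (W \<odot> Y) X \<bullet> (idt B (D X) \<star> pcomp d W Y)) =
    (idt B (D X) \<star> inv2 B (pcomp d W Y)) \<bullet> inv2 B (pcomp d (W \<odot> Y) X) \<bullet>
      (pcomp d (W \<odot> Y) X \<bullet> (idt B (D X) \<star> pcomp d W Y))"
    by (simp add: pcomp_asc xchg)
qed (simp_all add: iso2_vc iso2_h2 iso2_idt)

text \<open>The form \<open>\<psi>\<close> on \<open>Y'\<close> and \<open>Y\<close> is nested
  inside \<open>\<phi>\<close>. The inverse constraint splits \<open>D (Y' \<odot> X')\<close> as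
  \<open>D X' \<odot> D Y'\<close>, so that the factors meet in the order \<open>X'\<close>,
  \<open>Y'\<close>, \<open>Y\<close>, \<open>X\<close>.\<close>

definition form_comp :: "'m \<Rightarrow> 'm \<Rightarrow> 'm \<Rightarrow> 'm \<Rightarrow> 'c \<Rightarrow> 'c \<Rightarrow> 'c" where
  "form_comp Y' X' Y X \<psi> \<phi> =
    pairing_comp (D X') X (D Y') Y \<phi> \<psi> \<bullet> (inv2 B (pcomp d Y' X') \<star> idt B (Y \<odot> X))"

lemma form_comp_simps [simp]:
  assumes "X \<in> Mor B" "Y \<in> Mor B" "X' \<in> Mor B" "Y' \<in> Mor B"
    "src B X' = src B X" "trg B X' = trg B X" "src B Y = trg B X" "src B Y' = trg B X"
    "trg B Y' = trg B Y" "\<phi> \<in> Cell B" "dm B \<phi> = D X' \<odot> X" "cd B \<phi> = one B (src B X)"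
    "\<psi> \<in> Cell B" "dm B \<psi> = D Y' \<odot> Y" "cd B \<psi> = one B (trg B X)"
  shows "form_comp Y' X' Y X \<psi> \<phi> \<in> Cell B"
    "dm B (form_comp Y' X' Y X \<psi> \<phi>) = D (Y' \<odot> X') \<odot> (Y \<odot> X)"
    "cd B (form_comp Y' X' Y X \<psi> \<phi>) = one B (src B X)"
  using assms by (simp_all add: form_comp_def)

lemma form_comp_nat:
  assumes [simp]: "a \<in> Obj B" "b \<in> Obj B" "X \<in> Mor B" "X' \<in> Mor B" "Y \<in> Mor B" "Y' \<in> Mor B"
    "src B X = a" "trg B X = b" "src B X' = a" "trg B X' = b"
    "src B Y = b" "src B Y' = b" "trg B Y' = trg B Y"
    and \<phi>: "\<phi> \<in> cells B (D X' \<odot> X) (one B a)" and \<psi>: "\<psi> \<in> cells B (D Y' \<odot> Y) (one B b)"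
    and f': "f' \<in> cells B P' X'" and f: "f \<in> cells B P X"
    and g': "g' \<in> cells B Q' Y'" and g: "g \<in> cells B Q Y"
  shows "form_comp Q' P' Q P (\<psi> \<bullet> (dc g' \<star> g)) (\<phi> \<bullet> (dc f' \<star> f)) =
    form_comp Y' X' Y X \<psi> \<phi> \<bullet> (dc (g' \<star> f') \<star> (g \<star> f))"
proof -
  note [simp] = cellsD[OF \<phi>] cellsD[OF \<psi>] cellsD[OF f'] cellsD[OF f] cellsD[OF g'] cellsD[OF g]
    cells_Mor(1)[OF f] cells_Mor(1)[OF f'] cells_Mor(1)[OF g] cells_Mor(1)[OF g']
    cells_Mor(3,4)[OF f, symmetric] cells_Mor(3,4)[OF f', symmetric]
    cells_Mor(3,4)[OF g, symmetric] cells_Mor(3,4)[OF g', symmetric]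
  have "pairing_comp (D P') P (D Q') Q (\<phi> \<bullet> (dc f' \<star> f)) (\<psi> \<bullet> (dc g' \<star> g)) =
    pairing_comp (D X') X (D Y') Y \<phi> \<psi> \<bullet> ((dc f' \<star> dc g') \<star> (g \<star> f))"
    by (rule pairing_comp_nat[where a=a and b=b]) (use \<phi> \<psi> f g in \<open>simp_all add: cellsI\<close>)
  then show ?thesis
    using inv_pcomp_nat[of f' g'] by (simp add: form_comp_def interchange)
qed

text \<open>\<open>pairing_dual_comp\<close> dualises the nested pairing factor by factor. The
  constraints left over on the two sides are matched by the compatibility of \<open>\<eta>\<close>
  with composition, \<open>\<eta>_h1\<close>.\<close>

lemma form_comp_flip:
  assumes [simp]: "a \<in> Obj B" "b \<in> Obj B" "X \<in> Mor B" "X' \<in> Mor B" "Y \<in> Mor B" "Y' \<in> Mor B"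
    "src B X = a" "trg B X = b" "src B X' = a" "trg B X' = b"
    "src B Y = b" "src B Y' = b" "trg B Y' = trg B Y"
    and \<phi>: "\<phi> \<in> cells B (D X' \<odot> X) (one B a)" and \<psi>: "\<psi> \<in> cells B (D Y' \<odot> Y) (one B b)"
  shows "form_comp Y X Y' X' (flip (hform b) Y' Y \<psi>) (flip (hform a) X' X \<phi>) =
    flip (hform a) (Y' \<odot> X') (Y \<odot> X) (form_comp Y' X' Y X \<psi> \<phi>)"
proof -
  note [simp] = cellsD[OF \<phi>] cellsD[OF \<psi>]
  let ?pd = "pairing_dual a (D X' \<odot> D Y') (Y \<odot> X) (pairing_comp (D X') X (D Y') Y \<phi> \<psi>)"
  have "form_comp Y X Y' X' (flip (hform b) Y' Y \<psi>) (flip (hform a) X' X \<phi>) =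
    pairing_comp (D X) (D (D X')) (D Y) (D (D Y')) (pairing_dual a (D X') X \<phi>) (pairing_dual b (D Y') Y \<psi>)
      \<bullet> ((idt B (D X \<odot> D Y) \<star> (\<eta> Y' \<star> \<eta> X')) \<bullet> (inv2 B (pcomp d Y X) \<star> idt B (Y' \<odot> X')))"
    by (simp add: form_comp_def pairing_comp_nat[where a=a and b=b and A="D X" and C="D Y" and
          X="D (D X')" and Y="D (D Y')"] cellsI)
  also have "\<dots> = ?pd \<bullet> ((pcomp d Y X \<star> pcomp d (D X') (D Y')) \<bullet>
      ((idt B (D X \<odot> D Y) \<star> (\<eta> Y' \<star> \<eta> X')) \<bullet> (inv2 B (pcomp d Y X) \<star> idt B (Y' \<odot> X'))))"
    by (subst pairing_dual_comp[symmetric]) (use \<phi> \<psi> in \<open>simp_all add: cellsI\<close>)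
  also have "\<dots> = ?pd \<bullet> (idt B (D (Y \<odot> X)) \<star> (pcomp d (D X') (D Y') \<bullet> (\<eta> Y' \<star> \<eta> X')))"
    by (simp add: xchg)
  also have "\<dots> = (?pd \<bullet> (idt B (D (Y \<odot> X)) \<star> dc (inv2 B (pcomp d Y' X')))) \<bullet>
      (idt B (D (Y \<odot> X)) \<star> \<eta> (Y' \<odot> X'))"
    by (simp add: interchange \<eta>_h1 dc_inv2)
  also have "?pd \<bullet> (idt B (D (Y \<odot> X)) \<star> dc (inv2 B (pcomp d Y' X'))) =
    pairing_dual a (D (Y' \<odot> X')) (Y \<odot> X) (form_comp Y' X' Y X \<psi> \<phi>)"
    unfolding form_comp_def
    by (subst pairing_dual_nat[where A="D X' \<odot> D Y'" and X="Y \<odot> X"]) (simp_all add: cellsI)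
  finally show ?thesis by simp
qed

text \<open>In the second slot \<open>asc B W Y X\<close> cancels the inverse associator of
  \<open>pairing_comp_assoc\<close>; in the first slot the associativity law of \<open>d\<close>
  absorbs \<open>dc (asc B W' Y' X')\<close>.\<close>

lemma form_comp_assoc:
  assumes [simp]: "a \<in> Obj B" "b \<in> Obj B" "c \<in> Obj B"
    "X \<in> Mor B" "X' \<in> Mor B" "Y \<in> Mor B" "Y' \<in> Mor B" "W \<in> Mor B" "W' \<in> Mor B"
    "src B X = a" "trg B X = b" "src B X' = a" "trg B X' = b"
    "src B Y = b" "trg B Y = c" "src B Y' = b" "trg B Y' = c"
    "src B W = c" "src B W' = c" "trg B W' = trg B W"
    and \<phi>: "\<phi> \<in> cells B (D X' \<odot> X) (one B a)" and \<psi>: "\<psi> \<in> cells B (D Y' \<odot> Y) (one B b)"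
    and \<chi>: "\<chi> \<in> cells B (D W' \<odot> W) (one B c)"
  shows "form_comp W' (Y' \<odot> X') W (Y \<odot> X) \<chi> (form_comp Y' X' Y X \<psi> \<phi>) \<bullet>
      (dc (asc B W' Y' X') \<star> asc B W Y X) =
    form_comp (W' \<odot> Y') X' (W \<odot> Y) X (form_comp W' Y' W Y \<chi> \<psi>) \<phi>"
proof -
  note [simp] = cellsD[OF \<phi>] cellsD[OF \<psi>] cellsD[OF \<chi>]
  let ?l = "pairing_comp (D X' \<odot> D Y') (Y \<odot> X) (D W') W (pairing_comp (D X') X (D Y') Y \<phi> \<psi>) \<chi>"
  let ?r = "pairing_comp (D X') X (D Y' \<odot> D W') (W \<odot> Y) \<phi> (pairing_comp (D Y') Y (D W') W \<psi> \<chi>)"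
  have 1: "pairing_comp (D (Y' \<odot> X')) (Y \<odot> X) (D W') W
      (pairing_comp (D X') X (D Y') Y \<phi> \<psi> \<bullet> (inv2 B (pcomp d Y' X') \<star> idt B (Y \<odot> X))) \<chi> =
    ?l \<bullet> ((inv2 B (pcomp d Y' X') \<star> idt B (D W')) \<star> idt B (W \<odot> (Y \<odot> X)))"
    using pairing_comp_nat[of a c "D X' \<odot> D Y'" "Y \<odot> X" W "D W'" "pairing_comp (D X') X (D Y') Y \<phi> \<psi>" \<chi>
      "idt B (Y \<odot> X)" _ "idt B W" _ "idt B (D W')" _ "inv2 B (pcomp d Y' X')"] by (simp add: cellsI)
  have 2: "pairing_comp (D X') X (D (W' \<odot> Y')) (W \<odot> Y) \<phi>
      (pairing_comp (D Y') Y (D W') W \<psi> \<chi> \<bullet> (inv2 B (pcomp d W' Y') \<star> idt B (W \<odot> Y))) =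
    ?r \<bullet> ((idt B (D X') \<star> inv2 B (pcomp d W' Y')) \<star> idt B ((W \<odot> Y) \<odot> X))"
    using pairing_comp_nat[of a b "D X'" X "W \<odot> Y" "D Y' \<odot> D W'" \<phi> "pairing_comp (D Y') Y (D W') W \<psi> \<chi>"
      "idt B X" _ "idt B (W \<odot> Y)" _ "inv2 B (pcomp d W' Y')" _ "idt B (D X')"] by (simp add: cellsI)
  have 3: "?l = ?r \<bullet> (asc B (D X') (D Y') (D W') \<star> inv2 B (asc B W Y X))"
    by (rule pairing_comp_assoc[symmetric, where a=a and b=b and c=c])
      (use \<phi> \<psi> \<chi> in \<open>simp_all\<close>)
  have "form_comp W' (Y' \<odot> X') W (Y \<odot> X) \<chi> (form_comp Y' X' Y X \<psi> \<phi>) \<bullet>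
      (dc (asc B W' Y' X') \<star> asc B W Y X) =
    ?r \<bullet> ((asc B (D X') (D Y') (D W') \<bullet> ((inv2 B (pcomp d Y' X') \<star> idt B (D W')) \<bullet>
      (inv2 B (pcomp d W' (Y' \<odot> X')) \<bullet> dc (asc B W' Y' X')))) \<star> idt B ((W \<odot> Y) \<odot> X))"
    by (simp add: form_comp_def 1 3 xchg)
  also have "\<dots> = form_comp (W' \<odot> Y') X' (W \<odot> Y) X (form_comp W' Y' W Y \<chi> \<psi>) \<phi>"
    by (simp add: form_comp_def 2 inv_pcomp_asc interchange)
  finally show ?thesis .
qed

definition one_form :: "'o \<Rightarrow> 'c" where
  "one_form a = ru B (one B a) \<bullet> (inv2 B (punit d a) \<star> idt B (one B a))"

lemma one_form_simps [simp]:
  assumes "a \<in> Obj B"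
  shows "one_form a \<in> Cell B" "dm B (one_form a) = D (one B a) \<odot> one B a"
    "cd B (one_form a) = one B a"
  using assms by (simp_all add: one_form_def)

text \<open>By \<open>\<eta>_one\<close> the double dual of the unit contributes a single
  \<open>punit\<close>; inserting a second one together with its inverse makes
  \<open>pairing_dual_one\<close> applicable.\<close>

lemma one_form_flip:
  assumes [simp]: "a \<in> Obj B"
  shows "flip (hform a) (one B a) (one B a) (one_form a) = one_form a"
proof -
  let ?I = "one B a"
  have "pairing_dual a (D ?I) ?I (one_form a) =
    pairing_dual a ?I ?I (ru B ?I) \<bullet> (idt B (D ?I) \<star> dc (inv2 B (punit d a)))"
    unfolding one_form_def
    by (subst pairing_dual_nat[where A="?I" and X="?I"]) (simp_all add: cellsI)
  then have "flip (hform a) ?I ?I (one_form a) =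
    pairing_dual a ?I ?I (ru B ?I) \<bullet> ((punit d a \<star> punit d a) \<bullet> (inv2 B (punit d a) \<star> idt B ?I))"
    by (simp add: interchange \<eta>_one dc_inv2)
  also have "\<dots> = one_form a"
    using vc_ext[OF pairing_dual_one, of a "inv2 B (punit d a) \<star> idt B ?I"]
    by (simp add: one_form_def)
  finally show ?thesis .
qed

text \<open>The unit laws of \<open>d\<close> are solved for \<open>dc\<close> of a unitor. That
  \<open>d\<close> exchanges left and right unitors matches the crossed unitors in
  \<open>pairing_comp_one_right\<close> and \<open>pairing_comp_one_left\<close>.\<close>

lemma form_comp_one:
  assumes [simp]: "a \<in> Obj B" "b \<in> Obj B" "X \<in> Mor B" "X' \<in> Mor B"
    "src B X = a" "trg B X = b" "src B X' = a" "trg B X' = b"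
    and \<phi>: "\<phi> \<in> cells B (D X' \<odot> X) (one B a)"
  shows "\<phi> \<bullet> (dc (lu B X') \<star> lu B X) = form_comp (one B b) X' (one B b) X (one_form b) \<phi>"
    "\<phi> \<bullet> (dc (ru B X') \<star> ru B X) = form_comp X' (one B a) X (one B a) \<phi> (one_form a)"
proof -
  note [simp] = cellsD[OF \<phi>]
  let ?I = "one B b" and ?J = "one B a"
  have 1: "dc (lu B X') = ru B (D X') \<bullet> ((idt B (D X') \<star> inv2 B (punit d b)) \<bullet> inv2 B (pcomp d ?I X'))"
    by (simp add: pcomp_unit(1)[of X' b, symmetric] interchange_ext)
  have 2: "dc (ru B X') = lu B (D X') \<bullet> ((inv2 B (punit d a) \<star> idt B (D X')) \<bullet> inv2 B (pcomp d X' ?J))"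
    by (simp add: pcomp_unit(2)[of X' a, symmetric] interchange_ext)
  have 3: "pairing_comp (D X') X (D ?I) ?I \<phi> (ru B ?I \<bullet> (inv2 B (punit d b) \<star> idt B ?I)) =
    pairing_comp (D X') X ?I ?I \<phi> (ru B ?I) \<bullet> ((idt B (D X') \<star> inv2 B (punit d b)) \<star> idt B (?I \<odot> X))"
    using pairing_comp_nat[of a b "D X'" X ?I ?I \<phi> "ru B ?I" "idt B X" _ "idt B ?I" _
      "inv2 B (punit d b)" _ "idt B (D X')"] by (simp add: cellsI)
  have 4: "pairing_comp (D ?J) ?J (D X') X (ru B ?J \<bullet> (inv2 B (punit d a) \<star> idt B ?J)) \<phi> =
    pairing_comp ?J ?J (D X') X (ru B ?J) \<phi> \<bullet> ((inv2 B (punit d a) \<star> idt B (D X')) \<star> idt B (X \<odot> ?J))"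
    using pairing_comp_nat[of a a ?J ?J X "D X'" "ru B ?J" \<phi> "idt B ?J" _ "idt B X" _
      "idt B (D X')" _ "inv2 B (punit d a)"] by (simp add: cellsI)
  show "\<phi> \<bullet> (dc (lu B X') \<star> lu B X) = form_comp ?I X' ?I X (one_form b) \<phi>"
    using \<phi> by (simp add: form_comp_def one_form_def 1 3 pairing_comp_one_right[where a=a] interchange)
  show "\<phi> \<bullet> (dc (ru B X') \<star> ru B X) = form_comp X' ?J X ?J \<phi> (one_form a)"
    using \<phi> by (simp add: form_comp_def one_form_def 2 4 pairing_comp_one_left[where b=b] interchange)
qed

text \<open>The cell whose adjunct defines \<open>res_comp\<close> is the nested pairing of the two
  evaluations.\<close>

lemma res_comp:
  assumes [simp]: "X \<in> Mor B" "Y \<in> Mor B" "src B X = a" "trg B X = b" "src B Y = b"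
  shows "res_comp B K a b Y X \<in> cells B (res_a a X \<odot> res_a b Y) (res_a a (Y \<odot> X))"
    "ev a (Y \<odot> X) \<bullet> (res_comp B K a b Y X \<star> idt B (Y \<odot> X)) =
      pairing_comp (res_a a X) X (res_a b Y) Y (ev a X) (ev b Y)"
proof -
  have *: "res_comp B K a b Y X = radj B K (Y \<odot> X) (res_a a X \<odot> res_a b Y) (one B a)
    (pairing_comp (res_a a X) X (res_a b Y) Y (ev a X) (ev b Y))"
    by (simp add: res_comp_def pairing_comp_def cancel_def)
  show "res_comp B K a b Y X \<in> cells B (res_a a X \<odot> res_a b Y) (res_a a (Y \<odot> X))"
    "ev a (Y \<odot> X) \<bullet> (res_comp B K a b Y X \<star> idt B (Y \<odot> X)) =
      pairing_comp (res_a a X) X (res_a b Y) Y (ev a X) (ev b Y)"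
    unfolding * by (rule radj; simp add: cellsI)+
qed

text \<open>\<open>uform_dc\<close> replaces the double dual of \<open>res_comp\<close> by
  \<open>res_comp\<close> itself, which evaluates to the nested pairing; the inverse of
  \<open>\<eta>\<close> is then distributed over the two residuals. So the canonical map is the
  arrow representing \<open>form_comp\<close>.\<close>

lemma comp_str:
  assumes [simp]: "X \<in> Mor B" "Y \<in> Mor B" "src B X = a" "trg B X = b" "src B Y = b" "trg B Y = c"
    "a \<in> Obj B" "b \<in> Obj B"
  shows "comp_str B d K a b c (Y, X) \<in>
      cells B (D (res_a b Y) \<odot> D (res_a a X)) (D (res_a a (Y \<odot> X)))"
    "uform a (Y \<odot> X) \<bullet> (dc (comp_str B d K a b c (Y, X)) \<star> idt B (Y \<odot> X)) =
      form_comp (D (res_a b Y)) (D (res_a a X)) Y X (uform b Y) (uform a X)"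
proof -
  let ?R = "res_a a X" and ?S = "res_a b Y" and ?rc = "res_comp B K a b Y X"
  note rc = res_comp[OF assms(1-5)]
  note [simp] = cellsD[OF rc(1)]
  show "comp_str B d K a b c (Y, X) \<in> cells B (D ?S \<odot> D ?R) (D (res_a a (Y \<odot> X)))"
    by (simp add: comp_str_def cellsI)
  let ?p = "pairing_comp ?R X ?S Y (ev a X) (ev b Y)"
  have "uform a (Y \<odot> X) \<bullet> (dc (comp_str B d K a b c (Y, X)) \<star> idt B (Y \<odot> X)) =
    (uform a (Y \<odot> X) \<bullet> (dc (dc ?rc) \<star> idt B (Y \<odot> X))) \<bullet> (dc (pcomp d ?R ?S) \<star> idt B (Y \<odot> X))"
    by (simp add: comp_str_def interchange)
  also have "\<dots> = (ev a (Y \<odot> X) \<bullet> (?rc \<star> idt B (Y \<odot> X))) \<bullet>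
      ((inv2 B (\<eta> (?R \<odot> ?S)) \<bullet> dc (pcomp d ?R ?S)) \<star> idt B (Y \<odot> X))"
    by (subst uform_dc) (simp_all add: interchange)
  also have "\<dots> = ?p \<bullet> (((inv2 B (\<eta> ?R) \<star> inv2 B (\<eta> ?S)) \<star> (idt B Y \<star> idt B X)) \<bullet>
      (inv2 B (pcomp d (D ?S) (D ?R)) \<star> idt B (Y \<odot> X)))"
    unfolding rc(2) by (simp add: inv_\<eta>_h1 interchange)
  also have "\<dots> = form_comp (D ?S) (D ?R) Y X (uform b Y) (uform a X)"
    unfolding form_comp_def uform_def
    by (subst pairing_comp_nat[where a=a and b=b and A="?R" and X=X and C="?S" and Y=Y])
      (simp_all add: cellsI)
  finally show "uform a (Y \<odot> X) \<bullet> (dc (comp_str B d K a b c (Y, X)) \<star> idt B (Y \<odot> X)) =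
      form_comp (D ?S) (D ?R) Y X (uform b Y) (uform a X)" .
qed

text \<open>The same computation, with the unitor of the unit in place of the nested evaluation and
  \<open>inv_\<eta>_one\<close> in place of \<open>inv_\<eta>_h1\<close>.\<close>

lemma unit_str:
  assumes [simp]: "a \<in> Obj B"
  shows "unit_str B d K a \<in> cells B (one B a) (D (res_a a (one B a)))"
    "uform a (one B a) \<bullet> (dc (unit_str B d K a) \<star> idt B (one B a)) = one_form a"
proof -
  let ?I = "one B a" and ?j = "radj B K (one B a) (one B a) (one B a) (ru B (one B a))"
  have j: "?j \<in> cells B ?I (res_a a ?I)" "ev a ?I \<bullet> (?j \<star> idt B ?I) = ru B ?I"
    by (rule radj; simp add: cellsI)+
  note [simp] = cellsD[OF j(1)]
  show "unit_str B d K a \<in> cells B ?I (D (res_a a ?I))"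
    by (simp add: unit_str_def cellsI)
  have "uform a ?I \<bullet> (dc (unit_str B d K a) \<star> idt B ?I) =
    (uform a ?I \<bullet> (dc (dc ?j) \<star> idt B ?I)) \<bullet> (dc (punit d a) \<star> idt B ?I)"
    by (simp add: unit_str_def interchange)
  also have "\<dots> = (ev a ?I \<bullet> (?j \<star> idt B ?I)) \<bullet>
      ((inv2 B (\<eta> ?I) \<bullet> dc (punit d a)) \<star> idt B ?I)"
    by (subst uform_dc) (simp_all add: interchange)
  also have "\<dots> = one_form a"
    unfolding j(2) by (simp add: inv_\<eta>_one one_form_def)
  finally show "uform a ?I \<bullet> (dc (unit_str B d K a) \<star> idt B ?I) = one_form a" .
qed

section \<open>Composition, units and their coherence as maps of forms\<close>

abbreviation comp_map where "comp_map \<equiv> comp_vftr B (comp_str B d K)"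
abbreviation unit_map where "unit_map \<equiv> unit_vftr B (unit_str B d K)"
abbreviation comp_act where
  "comp_act \<equiv> (\<lambda>(Y', X') (Y, X) (\<psi>, \<phi>). form_comp Y' X' Y X \<psi> \<phi>)"
abbreviation hform2 where "hform2 b a \<equiv> form_prod (hform b) (hform a)"

lemma represents_comp:
  assumes [simp]: "a \<in> Obj B" "b \<in> Obj B" "c \<in> Obj B"
  shows "represents_map (vprod (HV b c) (HV a b)) (hform2 b a) (HV a c) (hform a)
    (comp_map a b c) comp_act"
  unfolding represents_map_def
proof (intro conjI allI impI ballI)
  show "is_functor (ucat (vprod (HV b c) (HV a b))) (ucat (HV a c)) (uftr (comp_map a b c))"
    by (simp add: comp_vftr_def functor_hcomp)
next
  fix x y \<phi> assume "x \<in> Ob (ucat (vprod (HV b c) (HV a b)))" "y \<in> Ob (ucat (vprod (HV b c) (HV a b)))"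
    "\<phi> \<in> Frm (hform2 b a) x y"
  then show "comp_act x y \<phi> \<in> Frm (hform a) (fo (uftr (comp_map a b c)) x) (fo (uftr (comp_map a b c)) y)"
    by (auto simp: comp_vftr_def hcomp_def cells_def)
next
  fix x x' y y' f g \<phi>
  assume *: "f \<in> homset (ucat (vprod (HV b c) (HV a b))) x' x"
    "g \<in> homset (ucat (vprod (HV b c) (HV a b))) y' y" "\<phi> \<in> Frm (hform2 b a) x y"
  obtain x1 x2 x1' x2' y1 y2 y1' y2' f1 f2 g1 g2 \<phi>1 \<phi>2 where
    xy: "x = (x1, x2)" "y = (y1, y2)" "x' = (x1', x2')" "y' = (y1', y2')" "f = (f1, f2)" "g = (g1, g2)"
    "\<phi> = (\<phi>1, \<phi>2)" by (metis surj_pair)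
  have f: "f1 \<in> cells B x1' x1" "f2 \<in> cells B x2' x2" "g1 \<in> cells B y1' y1" "g2 \<in> cells B y2' y2"
    using * by (auto simp: xy)
  show "comp_act x' y' (act (hform2 b a) f g \<phi>) = act (hform a) (fa (uftr (comp_map a b c)) f)
      (fa (uftr (comp_map a b c)) g) (comp_act x y \<phi>)"
    unfolding xy using * f cells_Mor(2)[OF f(1)] cells_Mor(2)[OF f(2)] cells_Mor(2)[OF f(3)] cells_Mor(2)[OF f(4)]
      cells_Mor(3,4)[OF f(1)] cells_Mor(3,4)[OF f(2)] cells_Mor(3,4)[OF f(3)] cells_Mor(3,4)[OF f(4)]
    by (simp add: xy comp_vftr_def hcomp_def form_comp_nat[where a=a and b=b])
next
  fix x assume "x \<in> Ob (ucat (vprod (HV b c) (HV a b)))"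
  then obtain Y X where x [simp]: "x = (Y, X)" and
    [simp]: "X \<in> Mor B" "Y \<in> Mor B" "src B X = a" "trg B X = b" "src B Y = b" "trg B Y = c"
    by auto
  note cs = comp_str[of X Y a b c, simplified]
  show "vstr (comp_map a b c) x \<in> homset (ucat (HV a c))
      (fo (uftr (comp_map a b c)) (fo (vd (vprod (HV b c) (HV a b))) x))
      (fo (vd (HV a c)) (fo (uftr (comp_map a b c)) x))"
    using cs(1) by (simp add: comp_vftr_def hcomp_def)
  show "act (hform a) (vstr (comp_map a b c) x) (Id (ucat (HV a c)) (fo (uftr (comp_map a b c)) x))
      (uni (hform a) (fo (uftr (comp_map a b c)) x)) =
    comp_act (fo (vd (vprod (HV b c) (HV a b))) x) x (uni (hform2 b a) x)"
    using cs(2) by (simp add: comp_vftr_def hcomp_def)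
qed

lemma flip_comp:
  assumes [simp]: "a \<in> Obj B" "b \<in> Obj B" "c \<in> Obj B"
  shows "flip_map (vprod (HV b c) (HV a b)) (hform2 b a) (hform a) (comp_map a b c) comp_act"
  unfolding flip_map_def
  by (auto simp: comp_vftr_def hcomp_def form_comp_flip[where a=a and b=b] simp del: hform_simps(3))

lemma represents_unit:
  assumes [simp]: "a \<in> Obj B"
  shows "represents_map vunit form_unit (HV a a) (hform a) (unit_map a) (\<lambda>_ _ _. one_form a)"
  using unit_str[OF assms] category_unit
  by (simp add: represents_map_def unit_vftr_def is_functor_def category_hom cellsI)

lemma flip_unit:
  assumes [simp]: "a \<in> Obj B"
  shows "flip_map vunit form_unit (hform a) (unit_map a) (\<lambda>_ _ _. one_form a)"
  using one_form_flip[OF assms] by (simp add: flip_map_def unit_vftr_def)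

lemmas form_intros = volutive_form_prod volutive_form_unit volutive_form_HV

lemma functor_prod_assoc:
  assumes [simp]: "category C1" "category C2" "category C3"
  shows "is_functor (prod_cat (prod_cat C1 C2) C3) (prod_cat C1 (prod_cat C2 C3)) prod_assoc"
  by (auto simp: is_functor_def category_prod prod_assoc_def)

lemma functor_unit_left: "category C \<Longrightarrow> is_functor C (prod_cat unit_cat C) unit_left"
  by (auto simp: is_functor_def category_prod category_unit unit_left_def)

lemma functor_unit_right: "category C \<Longrightarrow> is_functor C (prod_cat C unit_cat) unit_right"
  by (auto simp: is_functor_def category_prod category_unit unit_right_def)

text \<open>Each composite functor represents an iterated form map assembled from those of its
  factors, so the volutive condition on the associator becomes an equation between forms, namely
  \<open>form_comp_assoc\<close>.\<close>

lemma iso_assoc: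
  assumes [simp]: "a \<in> Obj B" "b \<in> Obj B" "c \<in> Obj B" "e \<in> Obj B"
  shows "lax_volutive_iso (vprod (vprod (HV c e) (HV b c)) (HV a b)) (HV a e)
          (vf_comp (HV a e) (comp_map a b e) (vf_prod (comp_map b c e) (vf_id (HV a b))))
          (vf_comp (HV a e) (comp_map a c e)
             (vf_comp (vprod (HV c e) (HV a c)) (vf_prod (vf_id (HV c e)) (comp_map a b c))
                (vstrict (vprod (vprod (HV c e) (HV b c)) (HV a b))
                   (vprod (HV c e) (vprod (HV b c) (HV a b))) prod_assoc)))
          (\<lambda>((W, Y), X). asc B W Y X)"
proof -
  let ?V = "vprod (vprod (HV c e) (HV b c)) (HV a b)" and ?S = "form_prod (hform2 c b) (hform a)"
  let ?V' = "vprod (HV c e) (vprod (HV b c) (HV a b))" and ?S' = "form_prod (hform c) (hform2 b a)"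
  have F: "represents_map ?V ?S (vprod (HV b e) (HV a b)) (hform2 b a)
      (vf_prod (comp_map b c e) (vf_id (HV a b)))
      (\<lambda>(x, x2) (y, y2). map_prod (comp_act x y) (\<lambda>\<phi>. \<phi>))"
    using represents_map_prod[OF represents_comp represents_map_id[OF volutive_form_HV], of b c e a b]
    by simp
  have G: "represents_map ?V ?S ?V' ?S' (vstrict ?V ?V' prod_assoc)
      (\<lambda>x y ((\<chi>, \<psi>), \<phi>). (\<chi>, (\<psi>, \<phi>)))"
    by (rule represents_map_strict)
      (auto intro!: form_intros functor_prod_assoc[unfolded prod_assoc_def] simp: category_hom prod_assoc_def)
  have H: "represents_map ?V' ?S' (vprod (HV c e) (HV a c)) (hform2 c a)
      (vf_prod (vf_id (HV c e)) (comp_map a b c))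
      (\<lambda>(x, x2) (y, y2). map_prod (\<lambda>\<phi>. \<phi>) (comp_act x2 y2))"
    using represents_map_prod[OF represents_map_id[OF volutive_form_HV] represents_comp, of c e a b c]
    by simp
  \<comment> \<open>\<open>FF\<close> belongs to the bracketing
    \<open>(W \<odot> Y) \<odot> X\<close> and \<open>GHF\<close> to
    \<open>W \<odot> (Y \<odot> X)\<close>.\<close>
  note FF = represents_map_comp[OF _ _ _ F represents_comp]
  note GH = represents_map_comp[OF _ _ _ G H]
  note GHF = represents_map_comp[OF _ _ _ GH represents_comp]
  show ?thesis
  proof (rule represents_map_iso[OF _ _ FF GHF])
    show "nat_iso (ucat ?V) (ucat (HV a e))
      (uftr (vf_comp (HV a e) (comp_map a b e) (vf_prod (comp_map b c e) (vf_id (HV a b)))))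
      (uftr (vf_comp (HV a e) (comp_map a c e)
             (vf_comp (vprod (HV c e) (HV a c)) (vf_prod (vf_id (HV c e)) (comp_map a b c))
                (vstrict ?V ?V' prod_assoc)))) (\<lambda>((W, Y), X). asc B W Y X)"
      using nat_iso_asc[OF assms]
      by (simp add: vf_comp_def vf_prod_def comp_vftr_def vf_id_def vstrict_def)
  qed (auto intro!: form_intros simp: vf_prod_def vf_id_def vf_comp_def vstrict_def comp_vftr_def
      hcomp_def prod_assoc_def form_comp_assoc[where a=a and b=b and c=c])
qed

text \<open>The composite functor sends a form to its composite with \<open>one_form b\<close>, so
  the condition on \<open>lu B\<close> is the first equation of
  \<open>form_comp_one\<close>.\<close>

lemma iso_unit_left:
  assumes [simp]: "a \<in> Obj B" "b \<in> Obj B"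
  shows "lax_volutive_iso (HV a b) (HV a b)
          (vf_comp (HV a b) (comp_map a b b)
             (vf_comp (vprod (HV b b) (HV a b)) (vf_prod (unit_map b) (vf_id (HV a b)))
                (vstrict (HV a b) (vprod vunit (HV a b)) unit_left)))
          (vf_id (HV a b)) (lu B)"
proof -
  let ?U = "vprod vunit (HV a b)"
  have G: "represents_map (HV a b) (hform a) ?U (form_prod form_unit (hform a))
      (vstrict (HV a b) ?U unit_left) (\<lambda>x y \<phi>. ((), \<phi>))"
    by (rule represents_map_strict)
      (auto intro!: form_intros functor_unit_left[unfolded unit_left_def] simp: category_hom unit_left_def)
  have H: "represents_map ?U (form_prod form_unit (hform a)) (vprod (HV b b) (HV a b)) (hform2 b a)
      (vf_prod (unit_map b) (vf_id (HV a b)))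
      (\<lambda>(x, x2) (y, y2). map_prod (\<lambda>_. one_form b) (\<lambda>\<phi>. \<phi>))"
    using represents_map_prod[OF represents_unit represents_map_id[OF volutive_form_HV], of b a b]
    by simp
  note GH = represents_map_comp[OF _ _ _ G H]
  note GHF = represents_map_comp[OF _ _ _ GH represents_comp]
  show ?thesis
  proof (rule represents_map_iso[OF _ _ GHF represents_map_id])
    show "nat_iso (ucat (HV a b)) (ucat (HV a b))
      (uftr (vf_comp (HV a b) (comp_map a b b)
             (vf_comp (vprod (HV b b) (HV a b)) (vf_prod (unit_map b) (vf_id (HV a b)))
                (vstrict (HV a b) ?U unit_left)))) (uftr (vf_id (HV a b))) (lu B)"
      using nat_iso_lu_ru(1)[OF assms]
      by (simp add: vf_comp_def vf_prod_def comp_vftr_def unit_vftr_def vf_id_def vstrict_def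
          unit_left_def hcomp_def ftr_comp_def ftr_prod_def postcomp_def ftr_id_def)
  qed (auto intro!: form_intros simp: vf_prod_def vf_id_def vf_comp_def vstrict_def comp_vftr_def
      unit_vftr_def hcomp_def unit_left_def form_comp_one[where a=a and b=b])
qed

lemma iso_unit_right:
  assumes [simp]: "a \<in> Obj B" "b \<in> Obj B"
  shows "lax_volutive_iso (HV a b) (HV a b)
          (vf_comp (HV a b) (comp_map a a b)
             (vf_comp (vprod (HV a b) (HV a a)) (vf_prod (vf_id (HV a b)) (unit_map a))
                (vstrict (HV a b) (vprod (HV a b) vunit) unit_right)))
          (vf_id (HV a b)) (ru B)"
proof -
  let ?U = "vprod (HV a b) vunit"
  have G: "represents_map (HV a b) (hform a) ?U (form_prod (hform a) form_unit)
      (vstrict (HV a b) ?U unit_right) (\<lambda>x y \<phi>. (\<phi>, ()))"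
    by (rule represents_map_strict)
      (auto intro!: form_intros functor_unit_right[unfolded unit_right_def] simp: category_hom unit_right_def)
  have H: "represents_map ?U (form_prod (hform a) form_unit) (vprod (HV a b) (HV a a)) (hform2 a a)
      (vf_prod (vf_id (HV a b)) (unit_map a))
      (\<lambda>(x, x2) (y, y2). map_prod (\<lambda>\<phi>. \<phi>) (\<lambda>_. one_form a))"
    using represents_map_prod[OF represents_map_id[OF volutive_form_HV] represents_unit, of a b a]
    by simp
  note GH = represents_map_comp[OF _ _ _ G H]
  note GHF = represents_map_comp[OF _ _ _ GH represents_comp]
  show ?thesis
  proof (rule represents_map_iso[OF _ _ GHF represents_map_id])
    show "nat_iso (ucat (HV a b)) (ucat (HV a b))
      (uftr (vf_comp (HV a b) (comp_map a a b)
             (vf_comp (vprod (HV a b) (HV a a)) (vf_prod (vf_id (HV a b)) (unit_map a))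
                (vstrict (HV a b) ?U unit_right)))) (uftr (vf_id (HV a b))) (ru B)"
      using nat_iso_lu_ru(2)[OF assms]
      by (simp add: vf_comp_def vf_prod_def comp_vftr_def unit_vftr_def vf_id_def vstrict_def
          unit_right_def hcomp_def ftr_comp_def ftr_prod_def precomp_def ftr_id_def)
  qed (auto intro!: form_intros simp: vf_prod_def vf_id_def vf_comp_def vstrict_def comp_vftr_def
      unit_vftr_def hcomp_def unit_right_def form_comp_one[where a=a and b=b])
qed

end

theorem proposition6p5p7:
  fixes B :: "('o, 'm, 'c) bicat"
    and d :: "('o, 'm, 'c, 'o, 'm, 'c) psftr"
    and \<eta> :: "'m \<Rightarrow> 'c"
    and K :: "('m, 'c) closure"
  assumes dagger: "dagger_bicategory B d \<eta>"
    and closed: "one_closed B K"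
  shows "lax_volutive_enrichment B (hom_volutive B d \<eta> K) (comp_str B d K) (unit_str B d K)"
proof -
  have B: "bicategory B" using dagger by (simp add: dagger_bicategory_def)
  interpret closed_dagger_bicat B d \<eta> K
    by unfold_locales (fact B dagger closed)+
  show ?thesis
    unfolding lax_volutive_enrichment_def
    using B volutive_form.lax_volutive[OF volutive_form_HV] iso_assoc iso_unit_left iso_unit_right
      represents_map_lax_volutive[OF volutive_form_prod[OF volutive_form_HV volutive_form_HV]
        volutive_form_HV represents_comp flip_comp]
      represents_map_lax_volutive[OF volutive_form_unit volutive_form_HV represents_unit flip_unit]
    by simp
qed

end
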